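(* Let $A$ be a self-adjoint operator, semi-bounded from below, on a Hilbert space $\mathcal{H}$, with spectral measure $E$. Let $a<b$ be real numbers in $\rho(A)$, $\Delta=[a,b]$, and suppose $\sigma(A)\cap\Delta=\{\lambda_1,\dots,\lambda_d\}\subset\sigma_{\mathrm{dis}}(A)$ with $d<\infty$. Fix $\lambda\in\{\lambda_1,\dots,\lambda_d\}$ and $0<r<1/2$ such that \[ \mathbb{D}(\lambda+i,2r)\cap(\sigma(A)+i)=\{\lambda+i\}\quad\text{and}\quad\mathbb{D}(\lambda+i,2r)\cap\Gamma_{a,b}^{0,1}=\varnothing . \] Let $(P_n)_{n\in\mathbb{N}}$ be a sequence of orthogonal projections on $\mathcal{H}$ converging strongly to the identity, with ranges $\mathcal{L}_n$, and let $\varepsilon_n=\delta(\mathcal{L}(\Delta),\mathcal{L}_n)$. Let $\mathcal{M}_n(\{\lambda+i\})$ be the spectral subspace of $A+iP_n$ corresponding to $\sigma(A+iP_n)\cap\mathbb{D}(\lambda+i,r)$. Then there exists a constant $c_0>0$ such that \[ \hat{\delta}_{\mathfrak{a}}\big(\mathcal{L}(\{\lambda\}),\mathcal{M}_n(\{\lambda+i\})\big)\le c_0\,\varepsilon_n\quad\text{for all sufficiently large }n. \]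
   Context: $\mathbb{D}(x,y)$ is the closed disc in $\mathbb{C}$ with centre $x$ and radius $y$. For a Borel set $S\subset\mathbb{R}$, $\mathcal{L}(S)$ is the range of $E(S)$. $\sigma_{\mathrm{dis}}(A)$ is the discrete spectrum (isolated eigenvalues of finite multiplicity). For all sufficiently large $n$ the circle $|z-\lambda-i|=r$ lies in $\rho(A+iP_n)$, and the spectral subspace is the range of the Riesz projection $-\frac{1}{2\pi i}\int_{|\zeta-\lambda-i|=r}(A+iP_n-\zeta)^{-1}d\zeta$. Let $\mathfrak{a}$ be the quadratic form of $A$ and $m=\min\sigma(A)$. $\mathcal{H}_{\mathfrak{a}}$ is the Hilbert space $\mathrm{Dom}(\mathfrak{a})$ with inner product $\langle u,v\rangle_{\mathfrak{a}}=\mathfrak{a}(u,v)-(m-1)\langle u,v\rangle$ and norm $\|u\|_{\mathfrak{a}}=\|(A-m+1)^{1/2}u\|$. For subspaces, $\delta(\mathcal{M},\mathcal{N})=\sup_{u\in\mathcal{M},\|u\|=1}\mathrm{dist}(u,\mathcal{N})$ and $\hat\delta(\mathcal{M},\mathcal{N})=\max[\delta(\mathcal{M},\mathcal{N}),\delta(\mathcal{N},\mathcal{M})]$; $\delta_{\mathfrak{a}},\hat\delta_{\mathfrak{a}}$ denote the same quantities with norm and distance taken with respect to $\|\cdot\|_{\mathfrak{a}}$. The curve $\Gamma_{a,b}^{0,1}$: if $b-a\le1$, then $\Gamma_{a,b}^{0,1}=\{x+ih_\pm(x):x\in[a,b]\}$ (both signs) with $h_\pm(x)=\frac12\pm\sqrt{\frac14+(x-a)(x-b)}$;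 if $b-a>1$, then $\Gamma_{a,b}^{0,1}=\{k_\pm(y)+iy:y\in[0,1]\}$ (both signs) with $k_\pm(y)=\frac{a+b}{2}\pm\sqrt{(\frac{b-a}{2})^2+y(y-1)}$. *)

theory Defs
  imports "HOL-Analysis.Analysis" "HOL-Complex_Analysis.Complex_Analysis"
begin

section \<open>Complex Hilbert spaces\<close>

text \<open>The inner product is linear in its first argument.\<close>

class complex_hilbert_space = banach +
  fixes scaleC :: "complex \<Rightarrow> 'a \<Rightarrow> 'a"  (infixr \<open>*\<^sub>C\<close> 75)
    and cinner :: "'a \<Rightarrow> 'a \<Rightarrow> complex"
  assumes scaleC_add_right: "c *\<^sub>C (x + y) = c *\<^sub>C x + c *\<^sub>C y"
    and scaleC_add_left: "(c + d) *\<^sub>C x = c *\<^sub>C x + d *\<^sub>C x"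
    and scaleC_scaleC: "c *\<^sub>C (d *\<^sub>C x) = (c * d) *\<^sub>C x"
    and scaleC_of_real: "complex_of_real t *\<^sub>C x = t *\<^sub>R x"
    and cinner_add_left: "cinner (x + y) z = cinner x z + cinner y z"
    and cinner_scaleC_left: "cinner (c *\<^sub>C x) y = c * cinner x y"
    and cinner_commute: "cinner x y = cnj (cinner y x)"
    and cinner_self: "cinner x x = complex_of_real ((norm x)\<^sup>2)"

instantiation complex :: complex_hilbert_space
begin

definition scaleC_complex :: "complex \<Rightarrow> complex \<Rightarrow> complex"
  where "scaleC_complex c x = c * x"

definition cinner_complex :: "complex \<Rightarrow> complex \<Rightarrow> complex"
  where "cinner_complex x y = x * cnj y"

instance
  by intro_classes
    (auto simp: scaleC_complex_def cinner_complex_def algebra_simps scaleR_conv_of_real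
      simp flip: complex_norm_square)

end

global_interpretation complex_vector:
  vector_space "scaleC :: complex \<Rightarrow> 'a \<Rightarrow> 'a::complex_hilbert_space"
  defines csubspace = "complex_vector.subspace"
    and cspan = "complex_vector.span"
proof unfold_locales
  fix x :: 'a
  show "1 *\<^sub>C x = x"
    using scaleC_of_real[of 1 x] by simp
qed (simp_all add: scaleC_add_right scaleC_add_left scaleC_scaleC)

section \<open>Unbounded operators\<close>

text \<open>
  An operator is given by its domain \<open>D\<close> together with a function \<open>T\<close>, only the values of
  which on \<open>D\<close> matter.
\<close>

definition clinear_on :: "'a::complex_hilbert_space set \<Rightarrow> ('a \<Rightarrow> 'a) \<Rightarrow> bool"
  where "clinear_on D T \<longleftrightarrow> csubspace D \<and>
    (\<forall>x\<in>D. \<forall>y\<in>D. T (x + y) = T x + T y) \<and> (\<forall>c. \<forall>x\<in>D. T (c *\<^sub>C x) = c *\<^sub>C T x)"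

definition adjoint_graph :: "'a::complex_hilbert_space set \<Rightarrow> ('a \<Rightarrow> 'a) \<Rightarrow> ('a \<times> 'a) set"
  where "adjoint_graph D T = {(y, z). \<forall>x\<in>D. cinner (T x) y = cinner x z}"

definition self_adjoint :: "'a::complex_hilbert_space set \<Rightarrow> ('a \<Rightarrow> 'a) \<Rightarrow> bool"
  where "self_adjoint D A \<longleftrightarrow> clinear_on D A \<and> closure D = UNIV \<and>
    adjoint_graph D A = {(x, A x) | x. x \<in> D}"

definition semibounded_below :: "'a::complex_hilbert_space set \<Rightarrow> ('a \<Rightarrow> 'a) \<Rightarrow> bool"
  where "semibounded_below D A \<longleftrightarrow>
    (\<exists>\<gamma>::real. \<forall>u\<in>D. \<gamma> * (norm u)\<^sup>2 \<le> Re (cinner (A u) u))"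

definition orthogonal_projection :: "('a::complex_hilbert_space \<Rightarrow> 'a) \<Rightarrow> bool"
  where "orthogonal_projection P \<longleftrightarrow> clinear_on UNIV P \<and>
    (\<forall>x. P (P x) = P x) \<and> (\<forall>x y. cinner (P x) y = cinner x (P y))"

definition resolvent ::
    "'a::complex_hilbert_space set \<Rightarrow> ('a \<Rightarrow> 'a) \<Rightarrow> complex \<Rightarrow> 'a \<Rightarrow> 'a"
  where "resolvent D T z = inv_into D (\<lambda>x. T x - z *\<^sub>C x)"

definition resolvent_set :: "'a::complex_hilbert_space set \<Rightarrow> ('a \<Rightarrow> 'a) \<Rightarrow> complex set"
  where "resolvent_set D T =
    {z. bij_betw (\<lambda>x. T x - z *\<^sub>C x) D UNIV \<and> bounded_linear (resolvent D T z)}"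

definition spectrum :: "'a::complex_hilbert_space set \<Rightarrow> ('a \<Rightarrow> 'a) \<Rightarrow> complex set"
  where "spectrum D T = - resolvent_set D T"

definition eigenspace :: "'a::complex_hilbert_space set \<Rightarrow> ('a \<Rightarrow> 'a) \<Rightarrow> complex \<Rightarrow> 'a set"
  where "eigenspace D T z = {x \<in> D. T x = z *\<^sub>C x}"

text \<open>
  Multiplicity is geometric multiplicity; below the discrete spectrum is only taken of
  self-adjoint operators, for which it agrees with algebraic multiplicity.
\<close>

definition discrete_spectrum :: "'a::complex_hilbert_space set \<Rightarrow> ('a \<Rightarrow> 'a) \<Rightarrow> complex set"
  where "discrete_spectrum D T =
    {z \<in> spectrum D T. (\<exists>e>0. ball z e \<inter> spectrum D T = {z}) \<and>
       eigenspace D T z \<noteq> {0} \<and> (\<exists>B. finite B \<and> eigenspace D T z \<subseteq> cspan B)}"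

definition spectrum_min :: "'a::complex_hilbert_space set \<Rightarrow> ('a \<Rightarrow> 'a) \<Rightarrow> real"
  where "spectrum_min D A = (LEAST t. complex_of_real t \<in> spectrum D A)"

section \<open>Riesz projections\<close>

text \<open>Analogue of \<^const>\<open>contour_integral\<close> for functions with values in a Hilbert space.\<close>

definition vector_contour_integral ::
    "(real \<Rightarrow> complex) \<Rightarrow> (complex \<Rightarrow> 'a::complex_hilbert_space) \<Rightarrow> 'a"
  where "vector_contour_integral g f =
    integral {0..1} (\<lambda>t. vector_derivative g (at t within {0..1}) *\<^sub>C f (g t))"

text \<open>
  The minus sign goes with the resolvent being the inverse of \<open>T - \<zeta>\<close>;
  \<^const>\<open>circlepath\<close> is positively oriented.
\<close>

definition riesz_projection ::
    "'a::complex_hilbert_space set \<Rightarrow> ('a \<Rightarrow> 'a) \<Rightarrow> complex \<Rightarrow> real \<Rightarrow> 'a \<Rightarrow> 'a"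
  where "riesz_projection D T c r x =
    (- 1 / (2 * complex_of_real pi * \<i>)) *\<^sub>C
      vector_contour_integral (circlepath c r) (\<lambda>\<zeta>. resolvent D T \<zeta> x)"

section \<open>Spectral measures\<close>

text \<open>Only the values \<open>E S\<close> on Borel sets \<open>S\<close> matter.\<close>

definition projection_valued_measure ::
    "(real set \<Rightarrow> 'a::complex_hilbert_space \<Rightarrow> 'a) \<Rightarrow> bool"
  where "projection_valued_measure E \<longleftrightarrow>
    (\<forall>S\<in>sets borel. orthogonal_projection (E S)) \<and>
    (\<forall>x. E UNIV x = x) \<and>
    (\<forall>F :: nat \<Rightarrow> real set. range F \<subseteq> sets borel \<longrightarrow> disjoint_family F \<longrightarrow>
       (\<forall>x. (\<lambda>i. E (F i) x) sums E (\<Union>i. F i) x))"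

text \<open>The Borel measure \<open>S \<mapsto> \<langle>E(S)u, u\<rangle>\<close>.\<close>

definition scalar_spectral_measure ::
    "(real set \<Rightarrow> 'a::complex_hilbert_space \<Rightarrow> 'a) \<Rightarrow> 'a \<Rightarrow> real measure"
  where "scalar_spectral_measure E u =
    measure_of UNIV (sets borel) (\<lambda>S. ennreal (Re (cinner (E S u) u)))"

text \<open>
  \<open>A = \<integral> t dE(t)\<close>: the domain consists of the \<open>u\<close> with \<open>\<integral> t\<^sup>2 d\<langle>E(t)u, u\<rangle> < \<infinity>\<close>, and there
  \<open>\<langle>Au, u\<rangle> = \<integral> t d\<langle>E(t)u, u\<rangle>\<close>, which by polarization determines \<open>A\<close>.
\<close>

definition spectral_measure_of ::
    "(real set \<Rightarrow> 'a::complex_hilbert_space \<Rightarrow> 'a) \<Rightarrow> 'a set \<Rightarrow> ('a \<Rightarrow> 'a) \<Rightarrow> bool"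
  where "spectral_measure_of E D A \<longleftrightarrow> projection_valued_measure E \<and>
    D = {u. integrable (scalar_spectral_measure E u) (\<lambda>t. t\<^sup>2)} \<and>
    (\<forall>u\<in>D. cinner (A u) u = complex_of_real (\<integral>t. t \<partial>scalar_spectral_measure E u))"

section \<open>The quadratic form of a semi-bounded self-adjoint operator\<close>

text \<open>
  If \<open>E\<close> is the spectral measure of \<open>A\<close>, then its form \<open>\<aa>\<close> has domain
  \<open>{u. \<integral> \<bar>t\<bar> d\<langle>E(t)u, u\<rangle> < \<infinity>}\<close>, the domain of \<open>\<bar>A\<bar>\<^sup>1\<^sup>/\<^sup>2\<close>, and \<open>\<aa>[u] = \<integral> t d\<langle>E(t)u, u\<rangle>\<close> on it.
  The form and the inner product and norm derived from it are meaningful only on this domain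
  (a Bochner integral that does not exist is \<open>0\<close>).
\<close>

definition form_domain :: "(real set \<Rightarrow> 'a::complex_hilbert_space \<Rightarrow> 'a) \<Rightarrow> 'a set"
  where "form_domain E = {u. integrable (scalar_spectral_measure E u) (\<lambda>t. t)}"

definition quadratic_form :: "(real set \<Rightarrow> 'a::complex_hilbert_space \<Rightarrow> 'a) \<Rightarrow> 'a \<Rightarrow> real"
  where "quadratic_form E u = (\<integral>t. t \<partial>scalar_spectral_measure E u)"

definition sesquilinear_form ::
    "(real set \<Rightarrow> 'a::complex_hilbert_space \<Rightarrow> 'a) \<Rightarrow> 'a \<Rightarrow> 'a \<Rightarrow> complex"
  where "sesquilinear_form E u v =
    (complex_of_real (quadratic_form E (u + v)) - complex_of_real (quadratic_form E (u - v))
      + \<i> * complex_of_real (quadratic_form E (u + \<i> *\<^sub>C v))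
      - \<i> * complex_of_real (quadratic_form E (u - \<i> *\<^sub>C v))) / 4"

definition form_inner ::
    "(real set \<Rightarrow> 'a::complex_hilbert_space \<Rightarrow> 'a) \<Rightarrow> real \<Rightarrow> 'a \<Rightarrow> 'a \<Rightarrow> complex"
  where "form_inner E m u v =
    sesquilinear_form E u v - complex_of_real (m - 1) * cinner u v"

definition form_norm ::
    "(real set \<Rightarrow> 'a::complex_hilbert_space \<Rightarrow> 'a) \<Rightarrow> real \<Rightarrow> 'a \<Rightarrow> real"
  where "form_norm E m u = sqrt (Re (form_inner E m u u))"

section \<open>Gap between subspaces\<close>

text \<open>
  \<open>N\<close> is the norm with respect to which the gap is taken. The inserted \<open>0\<close> makes the supremum
  over the empty set \<open>0\<close>, so that the distance of \<open>{0}\<close> to any subspace is \<open>0\<close>; it does not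
  change the supremum otherwise.
\<close>

definition subspace_delta :: "('a::ab_group_add \<Rightarrow> real) \<Rightarrow> 'a set \<Rightarrow> 'a set \<Rightarrow> real"
  where "subspace_delta N U V =
    Sup (insert 0 ((\<lambda>u. INF v\<in>V. N (u - v)) ` {u \<in> U. N u = 1}))"

definition subspace_gap :: "('a::ab_group_add \<Rightarrow> real) \<Rightarrow> 'a set \<Rightarrow> 'a set \<Rightarrow> real"
  where "subspace_gap N U V = max (subspace_delta N U V) (subspace_delta N V U)"

section \<open>The curve $\Gamma_{a,b}^{0,1}$\<close>

definition Gamma_curve :: "real \<Rightarrow> real \<Rightarrow> complex set"
  where "Gamma_curve a b =
    (if b - a \<le> 1 then
       (\<Union>x\<in>{a..b}. {Complex x (1/2 + sqrt (1/4 + (x - a) * (x - b))),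
                        Complex x (1/2 - sqrt (1/4 + (x - a) * (x - b)))})
     else
       (\<Union>y\<in>{0..1}. {Complex ((a + b)/2 + sqrt (((b - a)/2)\<^sup>2 + y * (y - 1))) y,
                        Complex ((a + b)/2 - sqrt (((b - a)/2)\<^sup>2 + y * (y - 1))) y}))"

end

(*
  On the spectral subspace of [a,b] the operator A + iP_n is A + i up to an error eps_n. On its
  complement, (A - (a+b)/2)^2 >= ((b-a)/2)^2 and 0 <= QP_nQ <= 1 force the spectrum of the
  compression to lie in the region (x-a)(b-x) <= y(1-y). The curve Gamma is the part of its boundary
  that could separate the disc from lambda+i, so the disc misses that region and the compressed
  resolvent is bounded on it independently of n. Hence the resolvent of A + iP_n differs from a
  block diagonal parametrix, whose Riesz projection is E{lambda}, by O(eps_n) in the graph norm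
  of A, uniformly on the circle. Integrating, the idempotents E{lambda} and the Riesz projection
  of A + iP_n are O(eps_n)-close as maps from H to Dom(A). The graph norm dominates the form
  norm, which dominates the norm of H, so the gap in the form norm is O(eps_n).
*)

theory Submission
  imports Defs
begin

section \<open>Complex Hilbert spaces\<close>

text \<open>\<open>A + \<i>P\<close> is not normal, so the location of its spectrum gives no bound
  on its resolvent. All bounds come from testing with the vector itself: <A u, u> is real, so the
  imaginary part of <f, u> determines the weight of the projection on u. The adjoint has the form
  \<open>A - \<i>P\<close>, so each lower bound is proved for both signs \<open>s\<close> in {1,
  -1}; the bound for -1 gives surjectivity. The circle may enclose spectrum of
  \<open>A + \<i>P\<close>, so its resolvent is controlled only on an annulus around the circle. The
  complement block of the parametrix, in contrast, must be holomorphic on the whole disc to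
  integrate to zero. It is therefore completed on the spectral subspace of [a,b] by
  \<open>A\<close>, whose spectrum is real, and not by \<open>A + \<i>\<close>, which has the centre
  of the disc as an eigenvalue. Closing the estimate takes a small eps_n. Strong convergence gives
  this because L([a,b]) is finite-dimensional: finitely many eigenvalues of finite multiplicity. No
  constant depends on the projection, so one choice serves all large n.\<close>

lemma scaleC_one [simp]: "1 *\<^sub>C x = (x::'a::complex_hilbert_space)"
  by (rule complex_vector.scale_one)

lemma cinner_zero_left [simp]: "cinner 0 (x::'a::complex_hilbert_space) = 0"
  using cinner_add_left[of 0 0 x] by simp

lemma cinner_zero_right [simp]: "cinner (x::'a::complex_hilbert_space) 0 = 0"
  by (subst cinner_commute) simp

lemma cinner_minus_left [simp]: "cinner (- x) (y::'a::complex_hilbert_space) = - cinner x y"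
  using cinner_add_left[of x "- x" y] by (simp add: add_eq_0_iff)

lemma cinner_diff_left: "cinner (x - z) (y::'a::complex_hilbert_space) = cinner x y - cinner z y"
  using cinner_add_left[of x "- z" y] by simp

lemma cinner_add_right: "cinner x (y + z) = cinner x y + cinner x (z::'a::complex_hilbert_space)"
  by (subst (1 2 3) cinner_commute) (simp add: cinner_add_left)

lemma cinner_minus_right [simp]: "cinner x (- y) = - cinner x (y::'a::complex_hilbert_space)"
  by (subst (1 2) cinner_commute) simp

lemma cinner_diff_right: "cinner x (y - z) = cinner x y - cinner x (z::'a::complex_hilbert_space)"
  by (subst (1 2 3) cinner_commute) (simp add: cinner_diff_left)

lemma cinner_scaleC_right: "cinner x (c *\<^sub>C y) = cnj c * cinner x (y::'a::complex_hilbert_space)"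
  by (subst (1 2) cinner_commute) (simp add: cinner_scaleC_left)

lemma cinner_scaleR_left: "cinner (t *\<^sub>R x) (y::'a::complex_hilbert_space) = t *\<^sub>R cinner x y"
  by (simp add: cinner_scaleC_left scaleR_conv_of_real flip: scaleC_of_real)

lemma cinner_scaleR_right: "cinner x (t *\<^sub>R y) = t *\<^sub>R cinner x (y::'a::complex_hilbert_space)"
  by (simp add: cinner_scaleC_right scaleR_conv_of_real flip: scaleC_of_real)

lemmas cinner_simps = cinner_add_left cinner_add_right cinner_diff_left cinner_diff_right
  cinner_scaleC_left cinner_scaleC_right cinner_scaleR_left cinner_scaleR_right

lemma cinner_sum_left:
  "cinner (sum f F) (y::'a::complex_hilbert_space) = (\<Sum>i\<in>F. cinner (f i) y)"
  by (induction F rule: infinite_finite_induct) (auto simp: cinner_add_left)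

lemma cinner_sum_right:
  "cinner (y::'a::complex_hilbert_space) (sum f F) = (\<Sum>i\<in>F. cinner y (f i))"
  by (induction F rule: infinite_finite_induct) (auto simp: cinner_add_right)

lemma Re_cinner_self: "Re (cinner x x) = (norm (x::'a::complex_hilbert_space))\<^sup>2"
  by (simp add: cinner_self)

lemma norm_add_sq:
  "(norm (x + y))\<^sup>2 = (norm x)\<^sup>2 + 2 * Re (cinner x y) + (norm (y::'a::complex_hilbert_space))\<^sup>2"
proof -
  have "Re (cinner y x) = Re (cinner x y)"
    by (subst cinner_commute) simp
  then show ?thesis
    by (simp add: cinner_simps flip: Re_cinner_self)
qed

lemma norm_diff_sq:
  "(norm (x - y))\<^sup>2 = (norm x)\<^sup>2 - 2 * Re (cinner x y) + (norm (y::'a::complex_hilbert_space))\<^sup>2"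
  using norm_add_sq[of x "- y"] by simp

lemma norm_scaleC: "norm (c *\<^sub>C x) = norm c * norm (x::'a::complex_hilbert_space)"
proof -
  have "complex_of_real ((norm (c *\<^sub>C x))\<^sup>2) = c * cnj c * complex_of_real ((norm x)\<^sup>2)"
    unfolding cinner_self[symmetric] by (simp add: cinner_simps mult_ac)
  also have "c * cnj c = complex_of_real ((norm c)\<^sup>2)"
    by (rule complex_norm_square[symmetric])
  finally have "(norm (c *\<^sub>C x))\<^sup>2 = (norm c * norm x)\<^sup>2"
    unfolding of_real_mult[symmetric] of_real_eq_iff power_mult_distrib .
  then show ?thesis
    by (simp add: power2_eq_iff_nonneg)
qed

lemma cinner_eq_zero_norm_add:
  assumes "cinner x y = 0"
  shows "(norm (x + y))\<^sup>2 = (norm x)\<^sup>2 + (norm (y::'a::complex_hilbert_space))\<^sup>2"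
  using assms by (simp add: norm_add_sq)

lemma cinner_Cauchy_Schwarz: "norm (cinner x y) \<le> norm x * norm (y::'a::complex_hilbert_space)"
proof (cases "y = 0")
  case False
  define c where "c = cinner x y / complex_of_real ((norm y)\<^sup>2)"
  have ny: "norm y > 0" using False by simp
  have 1: "cinner (x - c *\<^sub>C y) (c *\<^sub>C y) = 0"
    using False by (simp add: cinner_simps c_def cinner_self)
  have "(norm x)\<^sup>2 = (norm (x - c *\<^sub>C y))\<^sup>2 + (norm (c *\<^sub>C y))\<^sup>2"
    using cinner_eq_zero_norm_add[OF 1] by simp
  then have "(norm (c *\<^sub>C y))\<^sup>2 \<le> (norm x)\<^sup>2" by simp
  then have "norm (c *\<^sub>C y) \<le> norm x" by simp
  moreover have "norm (c *\<^sub>C y) = norm (cinner x y) / norm y"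
    using ny by (simp add: norm_scaleC c_def norm_divide norm_mult power2_eq_square)
  ultimately show ?thesis using ny by (simp add: field_simps)
qed simp

lemma Re_cinner_le: "\<bar>Re (cinner x y)\<bar> \<le> norm x * norm (y::'a::complex_hilbert_space)"
  using abs_Re_le_cmod[of "cinner x y"] cinner_Cauchy_Schwarz[of x y] by linarith

lemma Im_cinner_le: "\<bar>Im (cinner x y)\<bar> \<le> norm x * norm (y::'a::complex_hilbert_space)"
  using abs_Im_le_cmod[of "cinner x y"] cinner_Cauchy_Schwarz[of x y] by linarith

lemma bounded_linear_cinner_left: "bounded_linear (\<lambda>x. cinner x (y::'a::complex_hilbert_space))"
  by (rule bounded_linear_intro[where K = "norm y"])
     (auto simp: cinner_simps cinner_Cauchy_Schwarz)

lemma bounded_linear_cinner_right: "bounded_linear (\<lambda>y. cinner (x::'a::complex_hilbert_space) y)"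
proof (rule bounded_linear_intro[where K = "norm x"])
  show "norm (cinner x y) \<le> norm y * norm x" for y
    using cinner_Cauchy_Schwarz[of x y] by (simp add: mult.commute)
qed (auto simp: cinner_simps)

lemma scaleC_scaleR: "c *\<^sub>C t *\<^sub>R x = t *\<^sub>R c *\<^sub>C (x::'a::complex_hilbert_space)"
  by (metis scaleC_of_real scaleC_scaleC mult.commute)

lemma scaleR_scaleC: "(t *\<^sub>R c) *\<^sub>C x = t *\<^sub>R c *\<^sub>C (x::'a::complex_hilbert_space)"
  by (metis scaleC_of_real scaleC_scaleC scaleR_conv_of_real)

lemma bounded_linear_scaleC_right: "bounded_linear (\<lambda>x::'a::complex_hilbert_space. c *\<^sub>C x)"
  by (rule bounded_linear_intro[where K = "norm c"])
     (auto simp: scaleC_add_right norm_scaleC mult.commute scaleC_scaleR)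

lemma bounded_bilinear_scaleC:
  "bounded_bilinear (\<lambda>c (x::'a::complex_hilbert_space). c *\<^sub>C x)"
proof
  show "\<exists>K. \<forall>a b. norm (a *\<^sub>C (b::'a)) \<le> norm a * norm b * K"
    by (rule exI[of _ 1]) (simp add: norm_scaleC)
qed (auto simp: scaleC_add_left scaleC_add_right scaleC_scaleR scaleR_scaleC)

lemmas continuous_on_scaleC [continuous_intros] =
  bounded_bilinear.continuous_on[OF bounded_bilinear_scaleC]

text \<open>Minimise the distance from a point outside \<open>V\<close>: the parallelogram law makes
  a minimising sequence Cauchy, and the point minus the limit is orthogonal to \<open>V\<close>.
  This supplies surjectivity in \<open>bounded_below_bij\<close>.\<close>

lemma closed_subspace_orthogonal:
  fixes V :: "'a::complex_hilbert_space set"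
  assumes V: "csubspace V" "closed V" "V \<noteq> UNIV"
  obtains v where "v \<noteq> 0" "\<And>u. u \<in> V \<Longrightarrow> cinner u v = 0"
proof -
  obtain x where x: "x \<notin> V" using V(3) by auto
  have V0: "0 \<in> V" and Vadd: "\<And>u v. u \<in> V \<Longrightarrow> v \<in> V \<Longrightarrow> u + v \<in> V"
    and Vsc: "\<And>c v. v \<in> V \<Longrightarrow> c *\<^sub>C v \<in> V"
    using V(1) by (auto simp: complex_vector.subspace_def)
  define d where "d = infdist x V"
  have d0: "d \<ge> 0" by (simp add: d_def infdist_nonneg)
  have dle: "d \<le> norm (x - u)" if "u \<in> V" for u
    using infdist_le[OF that, of x] by (simp add: d_def dist_norm)
  have "\<exists>u\<in>V. norm (x - u) < d + 1 / (real n + 1)" for n :: nat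
  proof -
    have "Inf ((\<lambda>a. dist x a) ` V) < d + 1 / (real n + 1)"
      using V0 by (auto simp: d_def infdist_def)
    then obtain y where "y \<in> (\<lambda>a. dist x a) ` V" "y < d + 1 / (real n + 1)"
      using V0 by (metis cInf_lessD empty_iff image_eqI)
    then show ?thesis by (auto simp: dist_norm)
  qed
  then obtain u where u: "\<And>n. u n \<in> V" "\<And>n. norm (x - u n) < d + 1 / (real n + 1)"
    by metis
  \<comment> \<open>Parallelogram law; the midpoint of \<open>u i\<close> and \<open>u j\<close>
    stays in \<open>V\<close>, hence at distance at least \<open>d\<close> from
    \<open>x\<close>.\<close>
  have key: "(norm (u i - u j))\<^sup>2 \<le> 2 * (norm (x - u i))\<^sup>2 + 2 * (norm (x - u j))\<^sup>2 - 4 * d\<^sup>2" for i j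
  proof -
    define p q where "p = x - u i" and "q = x - u j"
    have "(1/2) *\<^sub>C (u i + u j) \<in> V" using u(1) Vadd Vsc by blast
    then have "d \<le> norm (x - (1/2) *\<^sub>C (u i + u j))" by (rule dle)
    also have "x - (1/2) *\<^sub>C (u i + u j) = (1/2) *\<^sub>C (p + q)"
    proof -
      have "x = (1/2) *\<^sub>C x + (1/2) *\<^sub>C x"
        by (simp flip: scaleC_add_left)
      then show ?thesis
        by (simp add: p_def q_def scaleC_add_right complex_vector.scale_right_diff_distrib algebra_simps)
    qed
    also have "norm ((1/2) *\<^sub>C (p + q)) = norm (p + q) / 2"
      by (simp add: norm_scaleC)
    finally have "(2 * d)\<^sup>2 \<le> (norm (p + q))\<^sup>2" using d0 by (intro power_mono) auto
    moreover have "u i - u j = q - p" by (simp add: p_def q_def)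
    then have "(norm (u i - u j))\<^sup>2 = 2 * (norm p)\<^sup>2 + 2 * (norm q)\<^sup>2 - (norm (p + q))\<^sup>2"
      by (simp add: norm_add_sq[of p q] norm_diff_sq[of p q] norm_minus_commute[of q p])
    ultimately show ?thesis by (simp add: p_def q_def power_mult_distrib)
  qed
  have lim0: "(\<lambda>n. (norm (x - u n))\<^sup>2) \<longlonglongrightarrow> d\<^sup>2"
  proof -
    have "(\<lambda>n. d + 1 / (real n + 1)) \<longlonglongrightarrow> d + 0"
      by (intro tendsto_add tendsto_const) (use LIMSEQ_inverse_real_of_nat in \<open>simp add: inverse_eq_divide add.commute\<close>)
    then have "(\<lambda>n. norm (x - u n)) \<longlonglongrightarrow> d"
      by (intro tendsto_sandwich[OF _ _ tendsto_const, of d "\<lambda>n. norm (x - u n)" _ "\<lambda>n. d + 1 / (real n + 1)"])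
        (use u dle in \<open>auto intro!: always_eventually less_imp_le\<close>)
    then show ?thesis by (intro tendsto_intros)
  qed
  have "Cauchy u"
  proof (rule CauchyI)
    fix e :: real assume e: "e > 0"
    have "eventually (\<lambda>n. (norm (x - u n))\<^sup>2 < d\<^sup>2 + e\<^sup>2 / 4) sequentially"
      using order_tendstoD(2)[OF lim0, of "d\<^sup>2 + e\<^sup>2 / 4"] e by simp
    then obtain N where N: "\<And>n. n \<ge> N \<Longrightarrow> (norm (x - u n))\<^sup>2 < d\<^sup>2 + e\<^sup>2 / 4"
      by (auto simp: eventually_sequentially)
    show "\<exists>M. \<forall>m\<ge>M. \<forall>n\<ge>M. norm (u m - u n) < e"
    proof (intro exI allI impI)
      fix m n assume "N \<le> m" "N \<le> n"
      then have "(norm (u m - u n))\<^sup>2 < e\<^sup>2"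
        using key[of m n] N[of m] N[of n] by linarith
      then show "norm (u m - u n) < e"
        using e by (simp add: power_less_imp_less_base)
    qed
  qed
  then obtain p where p: "u \<longlonglongrightarrow> p"
    using Cauchy_convergent convergent_def by blast
  have pV: "p \<in> V" using closed_sequentially[OF V(2)] u(1) p by blast
  have "(\<lambda>n. (norm (x - u n))\<^sup>2) \<longlonglongrightarrow> (norm (x - p))\<^sup>2"
    by (intro tendsto_intros p)
  with lim0 have dp: "(norm (x - p))\<^sup>2 = d\<^sup>2" using LIMSEQ_unique by blast
  define v where "v = x - p"
  show ?thesis
  proof
    show "v \<noteq> 0" using pV x by (auto simp: v_def)
    fix w assume w: "w \<in> V"
    show "cinner w v = 0"
    proof (cases "w = 0")
      case False
      \<comment> \<open>\<open>c w\<close> is the component of \<open>v\<close> along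
        \<open>w\<close>; unless it is zero, removing it would shorten \<open>v\<close>, against the
        minimality of \<open>p\<close>.\<close>
      define c where "c = cinner v w / complex_of_real ((norm w)\<^sup>2)"
      have "p + c *\<^sub>C w \<in> V" using pV w Vadd Vsc by blast
      then have "d \<le> norm (v - c *\<^sub>C w)" using dle by (simp add: v_def algebra_simps)
      then have "(norm v)\<^sup>2 \<le> (norm (v - c *\<^sub>C w))\<^sup>2"
        using dp d0 by (simp add: v_def power_mono)
      moreover have "cinner (v - c *\<^sub>C w) (c *\<^sub>C w) = 0"
        using False by (simp add: cinner_simps c_def cinner_self)
      then have "(norm v)\<^sup>2 = (norm (v - c *\<^sub>C w))\<^sup>2 + (norm (c *\<^sub>C w))\<^sup>2"
        using cinner_eq_zero_norm_add by fastforce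
      ultimately have "c *\<^sub>C w = 0" by simp
      then have "c = 0" using False norm_scaleC[of c w] by simp
      then have "cinner v w = 0" using False by (simp add: c_def)
      then show ?thesis by (subst cinner_commute) simp
    qed simp
  qed
qed

section \<open>Orthogonal projections and projection-valued measures\<close>

locale hilbert_projection =
  fixes P :: "'a::complex_hilbert_space \<Rightarrow> 'a"
  assumes orth_proj: "orthogonal_projection P"
begin

lemma add: "P (x + y) = P x + P y"
  and scaleC: "P (c *\<^sub>C x) = c *\<^sub>C P x"
  and idem [simp]: "P (P x) = P x"
  and sym: "cinner (P x) y = cinner x (P y)"
  using orth_proj by (auto simp: orthogonal_projection_def clinear_on_def)

lemma cinner_self_proj: "cinner (P x) x = complex_of_real ((norm (P x))\<^sup>2)"
  by (metis idem sym cinner_self)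

lemma scaleR: "P (t *\<^sub>R x) = t *\<^sub>R P x"
  by (simp add: scaleC flip: scaleC_of_real)

lemma norm_le: "norm (P x) \<le> norm x"
proof -
  have "norm (P x) * norm (P x) \<le> norm (P x) * norm x"
    using Re_cinner_le[of "P x" x] by (simp add: cinner_self_proj power2_eq_square)
  then show ?thesis
    by (cases "P x = 0") auto
qed

lemma bounded_linear: "bounded_linear P"
  by (rule bounded_linear_intro[where K = 1]) (auto simp: add scaleR norm_le)

sublocale bl: bounded_linear P
  by (rule bounded_linear)

lemma diff: "P (x - y) = P x - P y"
  by (rule bl.diff)

lemma in_range_iff: "x \<in> range P \<longleftrightarrow> P x = x"
  by (metis idem rangeI rangeE)

lemma compl_sym: "cinner (x - P x) y = cinner x (y - P y)"
  by (simp add: cinner_simps sym)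

lemma norm_compl_le: "norm (x - P x) \<le> norm x"
proof -
  have "cinner (x - P x) (P x) = 0"
    by (simp add: cinner_simps sym)
  from cinner_eq_zero_norm_add[OF this] have "(norm (x - P x))\<^sup>2 \<le> (norm x)\<^sup>2" by simp
  then show ?thesis by simp
qed

lemma norm_diff_proj_le: "norm (u - P u) \<le> norm (u - P v)"
proof -
  have "cinner (u - P u) (P (u - v)) = 0"
    by (simp add: cinner_simps diff flip: sym)
  then have "cinner (u - P u) (P u - P v) = 0" by (simp add: diff)
  from cinner_eq_zero_norm_add[OF this] have "(norm (u - P u))\<^sup>2 \<le> (norm (u - P v))\<^sup>2" by simp
  then show ?thesis by simp
qed

end

locale pvm =
  fixes E :: "real set \<Rightarrow> 'a::complex_hilbert_space \<Rightarrow> 'a"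
  assumes pvm: "projection_valued_measure E"
begin

lemma proj: "S \<in> sets borel \<Longrightarrow> hilbert_projection (E S)"
  using pvm by (auto simp: projection_valued_measure_def hilbert_projection_def)

lemmas add = hilbert_projection.add[OF proj]
  and scaleC = hilbert_projection.scaleC[OF proj]
  and idem = hilbert_projection.idem[OF proj]
  and sym = hilbert_projection.sym[OF proj]
  and norm_le = hilbert_projection.norm_le[OF proj]
  and diff = hilbert_projection.diff[OF proj]
  and cinner_self_proj = hilbert_projection.cinner_self_proj[OF proj]

lemma UNIV_eq [simp]: "E UNIV x = x"
  using pvm by (simp add: projection_valued_measure_def)

lemma sums: "range F \<subseteq> sets borel \<Longrightarrow> disjoint_family F \<Longrightarrow> (\<lambda>i. E (F i) x) sums E (\<Union>i. F i) x"
  using pvm by (simp add: projection_valued_measure_def)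

lemma empty_eq [simp]: "E {} x = 0"
proof -
  have "(\<lambda>i::nat. E {} x) sums E (\<Union>i::nat. {}) x"
    by (rule sums) (auto simp: disjoint_family_on_def)
  then have "(\<lambda>i::nat. E {} x) \<longlonglongrightarrow> 0"
    by (intro summable_LIMSEQ_zero sums_summable)
  then show ?thesis
    by (simp add: LIMSEQ_const_iff)
qed

lemma Un:
  assumes "S \<in> sets borel" "T \<in> sets borel" "S \<inter> T = {}"
  shows "E (S \<union> T) x = E S x + E T x"
proof -
  have "(\<lambda>i. E (binaryset S T i) x) sums E (\<Union>i. binaryset S T i) x"
    using assms by (intro sums) (auto simp: disjoint_family_on_def binaryset_def)
  then have "(\<lambda>i. E (binaryset S T i) x) sums E (S \<union> T) x"
    by (simp add: UN_binaryset_eq)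
  moreover have "(\<lambda>i. E (binaryset S T i) x) sums (E S x + E T x)"
    by (rule binaryset_sums[of "\<lambda>S. E S x"]) simp
  ultimately show ?thesis
    by (rule sums_unique2)
qed

text \<open>The axioms ask only for additivity; multiplicativity starts here. For \<open>y\<close>
  in the range of \<open>E T\<close>, the square norm of \<open>E (S \<union> T) y\<close> is the
  sum of those of \<open>E S y\<close> and \<open>y\<close>, and a projection is a
  contraction.\<close>

lemma disjoint_zero:
  assumes "S \<in> sets borel" "T \<in> sets borel" "S \<inter> T = {}"
  shows "E S (E T x) = 0"
proof -
  have ST: "S \<union> T \<in> sets borel" using assms by auto
  define y where "y = E T x"
  have yT: "E T y = y" using idem[OF assms(2)] by (simp add: y_def)
  have "cinner (E (S \<union> T) y) y = cinner (E S y) y + cinner y y"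
    by (simp add: Un[OF assms] cinner_simps yT)
  then have "(norm (E (S \<union> T) y))\<^sup>2 = (norm (E S y))\<^sup>2 + (norm y)\<^sup>2"
    unfolding cinner_self_proj[OF ST] cinner_self_proj[OF assms(1)] cinner_self
    by (metis of_real_add of_real_eq_iff)
  moreover have "(norm (E (S \<union> T) y))\<^sup>2 \<le> (norm y)\<^sup>2"
    using norm_le[OF ST] by (simp add: power_mono)
  ultimately have "(norm (E S y))\<^sup>2 \<le> 0" by linarith
  then show ?thesis by (simp add: y_def)
qed

lemma Int:
  assumes "S \<in> sets borel" "T \<in> sets borel"
  shows "E S (E T x) = E (S \<inter> T) x"
proof -
  have "E T x = E (S \<inter> T) x + E (T - S) x"
  proof -
    have "S \<inter> T \<union> (T - S) = T" by auto
    then show ?thesis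
      using Un[of "S \<inter> T" "T - S" x] assms by auto
  qed
  then have "E S (E T x) = E S (E (S \<inter> T) x) + E S (E (T - S) x)"
    using add[OF assms(1)] by simp
  also have "E S (E (T - S) x) = 0"
    using assms by (intro disjoint_zero) auto
  also have "E S (E (S \<inter> T) x) = E (S \<inter> T) (E (S \<inter> T) x) + E (S - T) (E (S \<inter> T) x)"
  proof -
    have "S \<inter> T \<union> (S - T) = S" by auto
    then show ?thesis
      using Un[of "S \<inter> T" "S - T" "E (S \<inter> T) x"] assms by auto
  qed
  also have "E (S - T) (E (S \<inter> T) x) = 0"
    using assms by (intro disjoint_zero) auto
  finally show ?thesis
    using idem[of "S \<inter> T"] assms by simp
qed

lemma Compl: "S \<in> sets borel \<Longrightarrow> E (- S) x = x - E S x"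
  using Un[of S "- S" x] by (simp add: algebra_simps)

section \<open>Scalar spectral measures\<close>

abbreviation \<mu> :: "'a \<Rightarrow> real measure"
  where "\<mu> \<equiv> scalar_spectral_measure E"

lemma sets_\<mu> [simp, measurable_cong]: "sets (\<mu> u) = sets borel"
  by (simp add: scalar_spectral_measure_def sigma_algebra.sigma_sets_eq
      sets.sigma_algebra_axioms[of borel, simplified])

lemma space_\<mu> [simp]: "space (\<mu> u) = UNIV"
  by (simp add: scalar_spectral_measure_def)

lemma emeasure_\<mu>:
  assumes "S \<in> sets borel"
  shows "emeasure (\<mu> u) S = ennreal ((norm (E S u))\<^sup>2)"
proof -
  have eq: "ennreal (Re (cinner (E S u) u)) = ennreal ((norm (E S u))\<^sup>2)" if "S \<in> sets borel" for S
    using cinner_self_proj[OF that] by simp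
  have "emeasure (\<mu> u) S = ennreal (Re (cinner (E S u) u))"
  proof (rule emeasure_measure_of[OF scalar_spectral_measure_def])
    show "countably_additive (sets (\<mu> u)) (\<lambda>S. ennreal (Re (cinner (E S u) u)))"
    proof (rule countably_additiveI)
      fix F :: "nat \<Rightarrow> real set"
      assume F: "range F \<subseteq> sets (\<mu> u)" "disjoint_family F" "(\<Union>i. F i) \<in> sets (\<mu> u)"
      have "(\<lambda>i. Re (cinner (E (F i) u) u)) sums Re (cinner (E (\<Union>i. F i) u) u)"
        using F by (intro bounded_linear.sums[OF bounded_linear_Re]
            bounded_linear.sums[OF bounded_linear_cinner_left] sums) auto
      then show "(\<Sum>i. ennreal (Re (cinner (E (F i) u) u))) = ennreal (Re (cinner (E (\<Union>i. F i) u) u))"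
        using F(1) by (intro suminf_ennreal_eq) (auto simp: cinner_self_proj)
    qed
  qed (use assms in \<open>auto simp: positive_def\<close>)
  with eq[OF assms] show ?thesis by simp
qed

lemma measure_\<mu>: "S \<in> sets borel \<Longrightarrow> measure (\<mu> u) S = (norm (E S u))\<^sup>2"
  by (simp add: measure_def emeasure_\<mu>)

lemma finite_measure_\<mu>: "finite_measure (\<mu> u)"
  by (rule finite_measureI) (simp add: emeasure_\<mu>)

text \<open>Restricting the measure instead of the vector: domain and form of \<open>E S u\<close>
  become integrals over \<open>S\<close> against the measure of \<open>u\<close>.\<close>

lemma \<mu>_proj:
  assumes S: "S \<in> sets borel"
  shows "\<mu> (E S u) = density (\<mu> u) (indicator S)"
proof (rule measure_eqI)
  fix T assume "T \<in> sets (\<mu> (E S u))"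
  then have T: "T \<in> sets borel" by simp
  then have "emeasure (density (\<mu> u) (indicator S)) T = emeasure (\<mu> u) (S \<inter> T)"
    using S by (subst emeasure_density) (auto simp flip: indicator_inter_arith)
  then show "emeasure (\<mu> (E S u)) T = emeasure (density (\<mu> u) (indicator S)) T"
    using S T by (simp add: emeasure_\<mu> Int Int_commute)
qed simp

lemma integrable_\<mu>_proj:
  fixes f :: "real \<Rightarrow> real"
  assumes "S \<in> sets borel" "f \<in> borel_measurable borel"
  shows "integrable (\<mu> (E S u)) f \<longleftrightarrow> integrable (\<mu> u) (\<lambda>t. indicator S t * f t)"
proof -
  have "density (\<mu> u) (indicator S) = density (\<mu> u) (\<lambda>t. ennreal (indicator S t))"
    by (simp add: ennreal_indicator)
  then show ?thesis
    unfolding \<mu>_proj[OF assms(1)] using assms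
    by (simp add: integrable_density)
qed

lemma integral_\<mu>_proj:
  fixes f :: "real \<Rightarrow> real"
  assumes "S \<in> sets borel" "f \<in> borel_measurable borel"
  shows "(\<integral>t. f t \<partial>\<mu> (E S u)) = (\<integral>t. indicator S t * f t \<partial>\<mu> u)"
proof -
  have "density (\<mu> u) (indicator S) = density (\<mu> u) (\<lambda>t. ennreal (indicator S t))"
    by (simp add: ennreal_indicator)
  then show ?thesis
    unfolding \<mu>_proj[OF assms(1)] using assms
    by (simp add: integral_density)
qed

lemma AE_proj:
  assumes "S \<in> sets borel" "E S u = u"
  shows "AE t in \<mu> u. t \<in> S"
proof (rule AE_I)
  show "emeasure (\<mu> u) (- S) = 0"
    using assms by (simp add: emeasure_\<mu> Compl)
qed (use assms in auto)

lemma zero_UN: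
  fixes F :: "'i \<Rightarrow> real set"
  assumes "countable I" "\<And>i. i \<in> I \<Longrightarrow> F i \<in> sets borel" "\<And>i x. i \<in> I \<Longrightarrow> E (F i) x = 0"
  shows "E (\<Union>i\<in>I. F i) x = 0"
proof -
  have "(\<Union>i\<in>I. F i) \<in> null_sets (\<mu> x)"
    using assms by (intro null_sets_UN') (auto simp: emeasure_\<mu> null_sets_def)
  moreover have "(\<Union>i\<in>I. F i) \<in> sets borel" using assms by auto
  ultimately show ?thesis by (simp add: emeasure_\<mu> null_sets_def)
qed

text \<open>The cover by null intervals may be uncountable; Lindelof reduces it to a countable one,
  and \<open>E\<close> vanishes on countable unions of null sets.\<close>

lemma zero_open:
  assumes "\<And>t. t \<in> S \<Longrightarrow> \<exists>e>0. \<forall>x. E {t-e<..<t+e} x = 0" and "S \<in> sets borel"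
  shows "E S x = 0"
proof -
  from assms(1) have "\<forall>t\<in>S. \<exists>e>0. \<forall>x. E {t-e<..<t+e} x = 0" by blast
  then obtain e where "\<forall>t\<in>S. e t > 0 \<and> (\<forall>x. E {t - e t<..<t + e t} x = 0)"
    by (rule bchoice[THEN exE])
  then have e: "\<And>t. t \<in> S \<Longrightarrow> e t > 0" "\<And>t x. t \<in> S \<Longrightarrow> E {t - e t<..<t + e t} x = 0"
    by blast+
  define \<F> where "\<F> = (\<lambda>t. {t - e t<..<t + e t}) ` S"
  obtain \<G> where G: "\<G> \<subseteq> \<F>" "countable \<G>" "\<Union>\<G> = \<Union>\<F>"
  proof (rule Lindelof[of \<F>])
    show "open G" if "G \<in> \<F>" for G
      using that by (auto simp: \<F>_def)
  qed
  have mem: "\<exists>t\<in>S. G = {t - e t<..<t + e t}" if "G \<in> \<G>" for G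
    using G(1) that unfolding \<F>_def by blast
  define U where "U = (\<Union>G\<in>\<G>. G)"
  have zero: "E U y = 0" for y
    unfolding U_def
  proof (rule zero_UN[OF G(2)])
    show "G \<in> sets borel" if "G \<in> \<G>" for G using mem[OF that] by auto
    show "E G z = 0" if "G \<in> \<G>" for G z using mem[OF that] e(2) by auto
  qed
  have U: "U \<in> sets borel"
    unfolding U_def
  proof (rule sets.countable_UN'[OF G(2)])
    show "(\<lambda>G. G) ` \<G> \<subseteq> sets borel"
    proof safe
      fix G assume "G \<in> \<G>"
      then show "G \<in> sets borel" using mem[of G] by auto
    qed
  qed
  have "t \<in> U" if "t \<in> S" for t
  proof -
    have "t \<in> {t - e t<..<t + e t}" "{t - e t<..<t + e t} \<in> \<F>"
      using e(1)[OF that] that by (auto simp: \<F>_def)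
    then have "t \<in> \<Union>\<F>" by blast
    then show ?thesis unfolding U_def G(3)[symmetric] by simp
  qed
  then have "S \<inter> U = S" by blast
  then have "E S x = E S (E U x)"
    using Int[OF assms(2) U] by simp
  also have "\<dots> = 0"
    unfolding zero using hilbert_projection.bounded_linear[OF proj[OF assms(2)]]
    by (rule linear_simps(3))
  finally show ?thesis .
qed

lemma finite_UN_sum:
  assumes "finite F"
  shows "E F x = (\<Sum>t\<in>F. E {t} x)"
  using assms
proof (induction F)
  case (insert t F)
  have "E ({t} \<union> F) x = E {t} x + E F x"
    using insert by (intro Un) (auto simp: finite_imp_closed)
  with insert show ?case by simp
qed simp

end

section \<open>Self-adjoint operators\<close>

locale selfadj =
  fixes D :: "'a::complex_hilbert_space set" and A :: "'a \<Rightarrow> 'a"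
  assumes self_adjoint: "self_adjoint D A"
begin

lemma dom_subspace: "csubspace D"
  using self_adjoint by (simp add: self_adjoint_def clinear_on_def)

lemma dom_zero [simp]: "0 \<in> D"
  and dom_add: "x \<in> D \<Longrightarrow> y \<in> D \<Longrightarrow> x + y \<in> D"
  and dom_diff: "x \<in> D \<Longrightarrow> y \<in> D \<Longrightarrow> x - y \<in> D"
  and dom_scaleC: "x \<in> D \<Longrightarrow> c *\<^sub>C x \<in> D"
  using complex_vector.subspace_0[OF dom_subspace] complex_vector.subspace_add[OF dom_subspace]
    complex_vector.subspace_diff[OF dom_subspace] complex_vector.subspace_scale[OF dom_subspace]
  by auto

lemma dom_sum: "(\<And>i. i \<in> F \<Longrightarrow> f i \<in> D) \<Longrightarrow> (\<Sum>i\<in>F. f i) \<in> D"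
  by (rule complex_vector.subspace_sum[OF dom_subspace])

lemma dom_scaleR: "x \<in> D \<Longrightarrow> t *\<^sub>R x \<in> D"
  using dom_scaleC[of x "complex_of_real t"] by (simp add: scaleC_of_real)

lemma op_add: "x \<in> D \<Longrightarrow> y \<in> D \<Longrightarrow> A (x + y) = A x + A y"
  and op_scaleC: "x \<in> D \<Longrightarrow> A (c *\<^sub>C x) = c *\<^sub>C A x"
  using self_adjoint by (auto simp: self_adjoint_def clinear_on_def)

lemma op_scaleR: "x \<in> D \<Longrightarrow> A (t *\<^sub>R x) = t *\<^sub>R A x"
  using op_scaleC[of x "complex_of_real t"] by (simp add: scaleC_of_real)

lemma op_zero [simp]: "A 0 = 0"
  using op_scaleC[of 0 0] by simp

lemma op_diff: "x \<in> D \<Longrightarrow> y \<in> D \<Longrightarrow> A (x - y) = A x - A y"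
  using op_add[of "x - y" y] dom_diff[of x y] by simp

lemma op_sym: "x \<in> D \<Longrightarrow> y \<in> D \<Longrightarrow> cinner (A x) y = cinner x (A y)"
proof -
  assume "x \<in> D" "y \<in> D"
  then have "(y, A y) \<in> adjoint_graph D A"
    using self_adjoint by (auto simp: self_adjoint_def)
  with \<open>x \<in> D\<close> show ?thesis by (auto simp: adjoint_graph_def)
qed

text \<open>The main use of self-adjointness: a weak identity against all of \<open>D\<close>
  already puts \<open>y\<close> into the domain. Closedness, surjectivity and the passage of
  \<open>A\<close> under an integral sign all go through it.\<close>

lemma adjointI:
  assumes "\<And>x. x \<in> D \<Longrightarrow> cinner (A x) y = cinner x z"
  shows "y \<in> D" "A y = z"
proof -
  have "(y, z) \<in> adjoint_graph D A"
    using assms by (auto simp: adjoint_graph_def)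
  then show "y \<in> D" "A y = z"
    using self_adjoint by (auto simp: self_adjoint_def)
qed

lemma dense_orthogonal:
  assumes "\<And>x. x \<in> D \<Longrightarrow> cinner x z = 0"
  shows "z = 0"
proof -
  have "closed ((\<lambda>x. cinner x z) -` {0})"
    by (intro closed_vimage linear_continuous_on bounded_linear_cinner_left) auto
  moreover have "D \<subseteq> (\<lambda>x. cinner x z) -` {0}"
    using assms by auto
  ultimately have "closure D \<subseteq> (\<lambda>x. cinner x z) -` {0}"
    by (intro closure_minimal)
  then have "cinner z z = 0"
    using self_adjoint by (auto simp: self_adjoint_def)
  then show ?thesis by (simp add: cinner_self)
qed

lemma closed_op:
  assumes "\<And>n. u n \<in> D" "u \<longlonglongrightarrow> x" "(\<lambda>n. A (u n)) \<longlonglongrightarrow> y"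
  shows "x \<in> D" "A x = y"
proof -
  have "cinner (A w) x = cinner w y" if w: "w \<in> D" for w
  proof -
    have "(\<lambda>n. cinner (A w) (u n)) \<longlonglongrightarrow> cinner (A w) x"
      by (rule bounded_linear.tendsto[OF bounded_linear_cinner_right assms(2)])
    moreover have "(\<lambda>n. cinner w (A (u n))) \<longlonglongrightarrow> cinner w y"
      by (rule bounded_linear.tendsto[OF bounded_linear_cinner_right assms(3)])
    ultimately show ?thesis
      using op_sym[OF w assms(1)] LIMSEQ_unique by simp
  qed
  then show "x \<in> D" "A x = y"
    using adjointI[of x y] by auto
qed

lemma Im_cinner_op: "x \<in> D \<Longrightarrow> Im (cinner (A x) x) = 0"
  using op_sym[of x x] cinner_commute[of "A x" x]
  by (metis Reals_cnj_iff complex_is_Real_iff)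

text \<open>Since <A u, u> is real, the imaginary part of <A u - z u, u> comes from \<open>z\<close>
  alone.\<close>

lemma norm_op_diff_ge_Im:
  assumes "u \<in> D"
  shows "\<bar>Im z\<bar> * norm u \<le> norm (A u - z *\<^sub>C u)"
proof -
  have "Im (cinner (A u - z *\<^sub>C u) u) = - Im z * (norm u)\<^sup>2"
    by (simp add: cinner_simps Im_cinner_op[OF assms] cinner_self)
  then have "\<bar>Im z\<bar> * (norm u)\<^sup>2 \<le> norm (A u - z *\<^sub>C u) * norm u"
    using Im_cinner_le[of "A u - z *\<^sub>C u" u] by (simp add: abs_mult)
  then show ?thesis
    by (cases "u = 0") (auto simp: power2_eq_square)
qed

text \<open>
  The adjoint of \<open>A + \<i>B - z\<close> is \<open>A - \<i>B - cnj z\<close>, so lower bounds for both (the two values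
  of the sign \<open>s\<close>) make the range closed and dense.
\<close>

lemma bounded_below_bij:
  assumes B: "clinear_on UNIV B" "bounded_linear B" "\<And>x y. cinner (B x) y = cinner x (B y)"
    and \<kappa>: "\<kappa> > 0"
    and lower: "\<And>s u. s \<in> {1, -1} \<Longrightarrow> u \<in> D \<Longrightarrow>
      \<kappa> * norm u \<le> norm (A u + (complex_of_real s * \<i>) *\<^sub>C B u - Complex (Re z) (s * Im z) *\<^sub>C u)"
  shows "bij_betw (\<lambda>u. A u + \<i> *\<^sub>C B u - z *\<^sub>C u) D UNIV"
proof -
  define S where "S u = A u + \<i> *\<^sub>C B u - z *\<^sub>C u" for u
  have B_add: "B (x + y) = B x + B y" and B_sc: "B (c *\<^sub>C x) = c *\<^sub>C B x" for x y c
    using B(1) by (auto simp: clinear_on_def)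
  have low: "\<kappa> * norm u \<le> norm (S u)" if "u \<in> D" for u
    using lower[of 1 u] that by (simp add: S_def)
  have S_add: "S (x + y) = S x + S y" if "x \<in> D" "y \<in> D" for x y
    using that by (simp add: S_def op_add B_add scaleC_add_right)
  have S_sc: "S (c *\<^sub>C x) = c *\<^sub>C S x" if "x \<in> D" for x c
    using that by (simp add: S_def op_scaleC B_sc scaleC_add_right scaleC_scaleC mult.commute
        complex_vector.scale_right_diff_distrib)
  have S_diff: "S (x - y) = S x - S y" if "x \<in> D" "y \<in> D" for x y
    using S_add[of "x - y" y] dom_diff[of x y] that by simp
  have inj: "inj_on S D"
  proof (rule inj_onI)
    fix x y assume xy: "x \<in> D" "y \<in> D" "S x = S y"
    then have "\<kappa> * norm (x - y) \<le> 0"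
      using low[OF dom_diff[OF xy(1,2)]] S_diff[OF xy(1,2)] by simp
    then show "x = y" using \<kappa> by (simp add: mult_le_0_iff)
  qed
  have sub: "csubspace (S ` D)"
  proof -
    have "0 \<in> S ` D"
      using S_sc[of 0 0] dom_zero by (auto intro!: image_eqI[of _ _ 0])
    moreover have "x + y \<in> S ` D" if "x \<in> S ` D" "y \<in> S ` D" for x y
      using that S_add dom_add by (auto simp flip: S_add)
    moreover have "c *\<^sub>C x \<in> S ` D" if "x \<in> S ` D" for x c
      using that dom_scaleC by (auto simp flip: S_sc)
    ultimately show ?thesis by (auto simp: complex_vector.subspace_def)
  qed
  have cl: "closed (S ` D)"
    unfolding closed_sequential_limits
  proof (intro allI impI, elim conjE)
    fix f g assume "\<forall>n. f n \<in> S ` D" and fg: "f \<longlonglongrightarrow> g"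
    then have "\<forall>n. \<exists>u. u \<in> D \<and> f n = S u" by blast
    then obtain u where u: "\<And>n. u n \<in> D" "\<And>n. f n = S (u n)" by metis
    have "Cauchy u"
    proof (rule CauchyI)
      fix e :: real assume "e > 0"
      then have "\<kappa> * e > 0" using \<kappa> by simp
      then obtain N where N: "\<And>m n. m \<ge> N \<Longrightarrow> n \<ge> N \<Longrightarrow> norm (f m - f n) < \<kappa> * e"
        using LIMSEQ_imp_Cauchy[OF fg] CauchyD by blast
      have "norm (u m - u n) < e" if "m \<ge> N" "n \<ge> N" for m n
      proof -
        have "\<kappa> * norm (u m - u n) \<le> norm (f m - f n)"
          using low[OF dom_diff[OF u(1,1)]] S_diff[OF u(1,1)] u(2) by simp
        also have "\<dots> < \<kappa> * e" by (rule N) fact+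
        finally show ?thesis using \<kappa> by simp
      qed
      then show "\<exists>M. \<forall>m\<ge>M. \<forall>n\<ge>M. norm (u m - u n) < e" by blast
    qed
    then obtain x where x: "u \<longlonglongrightarrow> x" using Cauchy_convergent convergent_def by blast
    have "(\<lambda>n. f n - \<i> *\<^sub>C B (u n) + z *\<^sub>C u n) \<longlonglongrightarrow> g - \<i> *\<^sub>C B x + z *\<^sub>C x"
      by (intro tendsto_intros fg x bounded_linear.tendsto[OF bounded_linear_scaleC_right]
          bounded_linear.tendsto[OF B(2)])
    moreover have "f n - \<i> *\<^sub>C B (u n) + z *\<^sub>C u n = A (u n)" for n
      by (simp add: u(2) S_def)
    ultimately have "(\<lambda>n. A (u n)) \<longlonglongrightarrow> g - \<i> *\<^sub>C B x + z *\<^sub>C x" by simp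
    from closed_op[OF u(1) x this] have "x \<in> D" "g = S x" by (auto simp: S_def)
    then show "g \<in> S ` D" by blast
  qed
  have "S ` D = UNIV"
  proof (rule ccontr)
    assume "S ` D \<noteq> UNIV"
    then obtain v where v: "v \<noteq> 0" "\<And>w. w \<in> S ` D \<Longrightarrow> cinner w v = 0"
      using closed_subspace_orthogonal[OF sub cl] by metis
    \<comment> \<open>Orthogonality to the range says weakly that \<open>v\<close> is an eigenvector
      of the adjoint \<open>A - \<i>B\<close> at \<open>cnj z\<close>. \<open>adjointI\<close> puts
      \<open>v\<close> into \<open>D\<close>, where the bound with \<open>s = -1\<close>
      applies.\<close>
    have "cinner (A x) v = cinner x (\<i> *\<^sub>C B v + cnj z *\<^sub>C v)" if "x \<in> D" for x
    proof -
      have "cinner (S x) v = 0" using v(2) that by blast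
      then show ?thesis by (simp add: S_def cinner_simps B(3) algebra_simps add_eq_0_iff2)
    qed
    from adjointI[OF this] have vD: "v \<in> D" and "A v = \<i> *\<^sub>C B v + cnj z *\<^sub>C v" by auto
    moreover have "Complex (Re z) (- Im z) = cnj z" by (simp add: complex_eq_iff)
    ultimately have "\<kappa> * norm v \<le> 0"
      using lower[of "-1" v] by simp
    with v(1) \<kappa> show False by (simp add: mult_le_0_iff)
  qed
  then have "bij_betw S D UNIV" using inj by (simp add: bij_betw_def)
  moreover have "S = (\<lambda>u. A u + \<i> *\<^sub>C B u - z *\<^sub>C u)" by (auto simp: S_def)
  ultimately show ?thesis by simp
qed

lemma resolvent_props:
  fixes T :: "'a \<Rightarrow> 'a"
  assumes "bij_betw (\<lambda>u. T u - z *\<^sub>C u) D UNIV"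
  shows "resolvent D T z f \<in> D"
    and "T (resolvent D T z f) - z *\<^sub>C resolvent D T z f = f"
    and "u \<in> D \<Longrightarrow> resolvent D T z (T u - z *\<^sub>C u) = u"
proof -
  have "f \<in> (\<lambda>u. T u - z *\<^sub>C u) ` D" using assms by (simp add: bij_betw_def)
  then show "resolvent D T z f \<in> D" "T (resolvent D T z f) - z *\<^sub>C resolvent D T z f = f"
    unfolding resolvent_def
    by (rule inv_into_into, rule f_inv_into_f[where f = "\<lambda>u. T u - z *\<^sub>C u"])
  show "resolvent D T z (T u - z *\<^sub>C u) = u" if "u \<in> D"
    unfolding resolvent_def using assms that
    by (intro inv_into_f_f[where f = "\<lambda>u. T u - z *\<^sub>C u"]) (auto simp: bij_betw_def)
qed

text \<open>\<open>A - t\<close> is its own adjoint, so both signs in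
  \<open>bounded_below_bij\<close>, taken with \<open>B = 0\<close>, ask for the same inequality,
  and a lower bound alone gives surjectivity.\<close>

lemma real_resolvent_set_iff:
  "complex_of_real t \<in> resolvent_set D A \<longleftrightarrow> (\<exists>c>0. \<forall>u\<in>D. c * norm u \<le> norm (A u - t *\<^sub>R u))"
proof
  assume t: "complex_of_real t \<in> resolvent_set D A"
  then have bij: "bij_betw (\<lambda>u. A u - complex_of_real t *\<^sub>C u) D UNIV"
    and bl: "bounded_linear (resolvent D A (complex_of_real t))"
    by (auto simp: resolvent_set_def)
  obtain K where K: "K > 0" "\<And>x. norm (resolvent D A (complex_of_real t) x) \<le> norm x * K"
    using bounded_linear.pos_bounded[OF bl] by blast
  have "inverse K * norm u \<le> norm (A u - t *\<^sub>R u)" if "u \<in> D" for u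
    using K(2)[of "A u - complex_of_real t *\<^sub>C u"] resolvent_props(3)[OF bij that] K(1)
    by (simp add: field_simps scaleC_of_real)
  then show "\<exists>c>0. \<forall>u\<in>D. c * norm u \<le> norm (A u - t *\<^sub>R u)"
    using K(1) by (intro exI[of _ "inverse K"]) auto
next
  assume "\<exists>c>0. \<forall>u\<in>D. c * norm u \<le> norm (A u - t *\<^sub>R u)"
  then obtain c where c: "c > 0" "\<And>u. u \<in> D \<Longrightarrow> c * norm u \<le> norm (A u - t *\<^sub>R u)" by auto
  have *: "Complex t 0 = complex_of_real t" by (simp add: complex_eq_iff)
  have "bij_betw (\<lambda>u. A u + \<i> *\<^sub>C (0::'a) - complex_of_real t *\<^sub>C u) D UNIV"
    by (rule bounded_below_bij[OF _ _ _ c(1)])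
       (use c(2) in \<open>auto simp: clinear_on_def complex_vector.subspace_UNIV * scaleC_of_real\<close>)
  then have bij: "bij_betw (\<lambda>u. A u - complex_of_real t *\<^sub>C u) D UNIV"
    by simp
  note R = resolvent_props[OF bij]
  define Q where "Q = resolvent D A (complex_of_real t)"
  have Q: "Q x \<in> D" "A (Q x) - t *\<^sub>R Q x = x" "u \<in> D \<Longrightarrow> Q (A u - t *\<^sub>R u) = u" for x u
    using R by (simp_all add: Q_def scaleC_of_real)
  have "bounded_linear Q"
  proof (rule bounded_linear_intro[where K = "inverse c"])
    show "Q (x + y) = Q x + Q y" for x y
    proof -
      have "A (Q x + Q y) - t *\<^sub>R (Q x + Q y) = (A (Q x) - t *\<^sub>R Q x) + (A (Q y) - t *\<^sub>R Q y)"
        by (simp add: op_add Q(1) algebra_simps)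
      then have "A (Q x + Q y) - t *\<^sub>R (Q x + Q y) = x + y" by (simp only: Q(2))
      then show ?thesis using Q(3)[OF dom_add[OF Q(1,1)]] by metis
    qed
    show "Q (a *\<^sub>R x) = a *\<^sub>R Q x" for a x
    proof -
      have "A (a *\<^sub>R Q x) - t *\<^sub>R (a *\<^sub>R Q x) = a *\<^sub>R (A (Q x) - t *\<^sub>R Q x)"
        by (simp add: op_scaleR Q(1) scaleR_diff_right mult.commute)
      then have "A (a *\<^sub>R Q x) - t *\<^sub>R (a *\<^sub>R Q x) = a *\<^sub>R x"
        by (simp only: Q(2))
      then show ?thesis
        using Q(3)[OF dom_scaleR[OF Q(1), of a x]] by metis
    qed
    show "norm (Q x) \<le> norm x * inverse c" for x
      using c(2)[OF Q(1)[of x]] c(1) Q(2)[of x] by (simp add: field_simps)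
  qed
  with bij show "complex_of_real t \<in> resolvent_set D A"
    by (simp add: resolvent_set_def Q_def)
qed

end

section \<open>Self-adjoint operators with a spectral measure\<close>

locale spectral = selfadj D A + pvm E
  for D :: "'a::complex_hilbert_space set" and A :: "'a \<Rightarrow> 'a" and E :: "real set \<Rightarrow> 'a \<Rightarrow> 'a" +
  assumes spectral_measure: "spectral_measure_of E D A"
begin

lemma dom_iff: "u \<in> D \<longleftrightarrow> integrable (\<mu> u) (\<lambda>t. t\<^sup>2)"
  using spectral_measure unfolding spectral_measure_of_def by blast

lemma cinner_op: "u \<in> D \<Longrightarrow> cinner (A u) u = complex_of_real (\<integral>t. t \<partial>\<mu> u)"
  using spectral_measure unfolding spectral_measure_of_def by blast

lemma integrable_id: "u \<in> D \<Longrightarrow> integrable (\<mu> u) (\<lambda>t. t)"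
proof -
  assume "u \<in> D"
  interpret finite_measure "\<mu> u" by (rule finite_measure_\<mu>)
  have "integrable (\<mu> u) (\<lambda>t. 1 + t\<^sup>2)"
    using \<open>u \<in> D\<close> by (simp add: dom_iff)
  then show ?thesis
  proof (rule Bochner_Integration.integrable_bound)
    show "AE t in \<mu> u. norm t \<le> norm (1 + t\<^sup>2)"
    proof (intro AE_I2)
      fix t :: real
      have "0 \<le> (\<bar>t\<bar> - 1)\<^sup>2" by simp
      then have "\<bar>t\<bar> \<le> 1 + t\<^sup>2" by (simp add: power2_diff)
      then show "norm t \<le> norm (1 + t\<^sup>2)" by simp
    qed
  qed simp
qed

section \<open>Commutation of \<open>A\<close> with its spectral projections\<close>

lemma proj_dom:
  assumes "S \<in> sets borel" "u \<in> D"
  shows "E S u \<in> D"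
  unfolding dom_iff integrable_\<mu>_proj[OF assms(1) borel_measurable_power[OF measurable_ident, unfolded id_def]]
  using integrable_real_mult_indicator[of S "\<mu> u" "\<lambda>t. t\<^sup>2"] assms
  by (simp add: dom_iff mult.commute)

lemma cinner_op_split:
  assumes S: "S \<in> sets borel" and u: "u \<in> D"
  shows "cinner (A u) u = cinner (A (E S u)) (E S u) + cinner (A (E (- S) u)) (E (- S) u)"
proof -
  have S': "- S \<in> sets borel" using S by auto
  have I: "integrable (\<mu> u) (\<lambda>t. indicator T t * t)" if "T \<in> sets borel" for T
    using that integrable_id[OF u] integrable_real_mult_indicator[of T "\<mu> u" "\<lambda>t. t"]
    by (simp add: mult.commute)
  have "(\<integral>t. t \<partial>\<mu> u) = (\<integral>t. indicator S t * t + indicator (- S) t * t \<partial>\<mu> u)"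
    by (intro Bochner_Integration.integral_cong) (auto simp: indicator_def)
  also have "\<dots> = (\<integral>t. t \<partial>\<mu> (E S u)) + (\<integral>t. t \<partial>\<mu> (E (- S) u))"
    using I[OF S] I[OF S'] by (simp add: integral_\<mu>_proj S S')
  finally show ?thesis
    by (simp add: cinner_op u proj_dom S S')
qed

text \<open>\<open>spectral_measure_of\<close> ties \<open>A\<close> to \<open>E\<close> only
  through <A u, u>, so commutation has to be extracted from the form. For \<open>x\<close> in the
  range of \<open>E S\<close> and \<open>y\<close> in that of \<open>E (- S)\<close>, the integral
  for \<open>x + y\<close> splits into those for \<open>x\<close> and \<open>y\<close>; hence the
  cross terms, twice the real part of <A x, y>, vanish.\<close>

lemma op_proj_orthogonal:
  assumes S: "S \<in> sets borel" and u: "u \<in> D" "v \<in> D"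
  shows "cinner (A (E S u)) (E (- S) v) = 0"
proof -
  have S': "- S \<in> sets borel" using S by auto
  have Re0: "Re (cinner (A (E S u)) (E (- S) v)) = 0" if v: "v \<in> D" for v
  proof -
    define x y where "x = E S u" and "y = E (- S) v"
    have D: "x \<in> D" "y \<in> D" using u v S S' by (auto simp: x_def y_def proj_dom)
    have E: "E S x = x" "E (- S) y = y" "E (- S) x = 0" "E S y = 0"
      using S S' by (auto simp: x_def y_def idem disjoint_zero)
    have 1: "cinner (A (x + y)) (x + y) = cinner (A x) x + cinner (A y) y"
      using cinner_op_split[OF S dom_add[OF D]] E by (simp add: add[OF S] add[OF S'])
    have "cinner (A (x + y)) (x + y) = cinner (A x) x + cinner (A y) y + (cinner (A x) y + cinner (A y) x)"
      by (simp add: op_add D cinner_simps)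
    with 1 have "cinner (A x) y + cinner (A y) x = 0" by simp
    moreover have "cinner (A y) x = cnj (cinner (A x) y)"
      using op_sym[OF D(2) D(1)] cinner_commute[of "A x" y] by (metis cinner_commute)
    ultimately have "cinner (A x) y + cnj (cinner (A x) y) = 0" by simp
    then show ?thesis by (simp add: complex_eq_iff x_def y_def)
  qed
  \<comment> \<open>Replacing \<open>v\<close> by \<open>\<i> v\<close> turns the real part into the
    imaginary part.\<close>
  have "Re (cinner (A (E S u)) (E (- S) (\<i> *\<^sub>C v))) = 0"
    by (rule Re0[OF dom_scaleC[OF u(2)]])
  then have "Im (cinner (A (E S u)) (E (- S) v)) = 0"
    by (simp add: scaleC[OF S'] cinner_simps)
  with Re0[OF u(2)] show ?thesis by (simp add: complex_eq_iff)
qed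

text \<open>Orthogonality to the dense domain gives \<open>E (- S) A E S = 0\<close>. Used for
  \<open>S\<close> and for its complement, this makes \<open>A\<close> block diagonal.\<close>

lemma proj_op:
  assumes S: "S \<in> sets borel" and u: "u \<in> D"
  shows "A (E S u) = E S (A u)"
proof -
  have *: "E (- S) (A (E S u)) = 0" if "S \<in> sets borel" for S
  proof (rule dense_orthogonal)
    have S': "- S \<in> sets borel" using that by auto
    fix v assume v: "v \<in> D"
    have "cinner (E (- S) (A (E S u))) v = 0"
      using op_proj_orthogonal[OF that u v] by (simp add: sym[OF S'])
    then show "cinner v (E (- S) (A (E S u))) = 0"
      by (subst cinner_commute) simp
  qed
  have S': "- S \<in> sets borel" using S by auto
  have "u = E S u + E (- S) u" by (simp add: Compl S)
  then have "A u = A (E S u) + A (E (- S) u)"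
    using op_add[OF proj_dom[OF S u] proj_dom[OF S' u]] by simp
  then have "E S (A u) = E S (A (E S u)) + E S (A (E (- S) u))"
    by (simp add: add[OF S])
  also have "E S (A (E (- S) u)) = 0" using *[OF S'] by simp
  also have "E S (A (E S u)) = A (E S u)" using *[OF S] by (simp add: Compl S)
  finally show ?thesis by simp
qed

section \<open>Bounds on \<open>A\<close> from the location of the spectral support\<close>

lemma cinner_op_ge:
  assumes S: "S \<in> sets borel" and u: "u \<in> D" "E S u = u" and "\<And>t. t \<in> S \<Longrightarrow> \<alpha> \<le> t"
  shows "\<alpha> * (norm u)\<^sup>2 \<le> Re (cinner (A u) u)"
proof -
  interpret finite_measure "\<mu> u" by (rule finite_measure_\<mu>)
  have "(\<integral>t. \<alpha> \<partial>\<mu> u) \<le> (\<integral>t. t \<partial>\<mu> u)"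
    using AE_proj[OF S u(2)] assms(4)
    by (intro integral_mono_AE integrable_id u) auto
  then show ?thesis
    using measure_\<mu>[of UNIV u] by (simp add: cinner_op u mult.commute)
qed

lemma cinner_op_le:
  assumes S: "S \<in> sets borel" and u: "u \<in> D" "E S u = u" and "\<And>t. t \<in> S \<Longrightarrow> t \<le> \<beta>"
  shows "Re (cinner (A u) u) \<le> \<beta> * (norm u)\<^sup>2"
proof -
  interpret finite_measure "\<mu> u" by (rule finite_measure_\<mu>)
  have "(\<integral>t. t \<partial>\<mu> u) \<le> (\<integral>t. \<beta> \<partial>\<mu> u)"
    using AE_proj[OF S u(2)] assms(4)
    by (intro integral_mono_AE integrable_id u) auto
  then show ?thesis
    using measure_\<mu>[of UNIV u] by (simp add: cinner_op u mult.commute)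
qed

lemma bounded_proj_dom:
  assumes S: "S \<in> sets borel" "E S u = u" and "\<And>t. t \<in> S \<Longrightarrow> \<bar>t\<bar> \<le> K"
  shows "u \<in> D"
  unfolding dom_iff
proof -
  interpret finite_measure "\<mu> u" by (rule finite_measure_\<mu>)
  show "integrable (\<mu> u) (\<lambda>t. t\<^sup>2)"
  proof (rule integrable_const_bound[where B = "K\<^sup>2"])
    show "AE t in \<mu> u. norm (t\<^sup>2) \<le> K\<^sup>2"
      using AE_proj[OF S]
    proof (rule eventually_mono)
      fix t assume "t \<in> S"
      then have "\<bar>t\<bar>\<^sup>2 \<le> K\<^sup>2" using assms(3) by (intro power_mono) auto
      then show "norm (t\<^sup>2) \<le> K\<^sup>2" by simp
    qed
  qed simp
qed

text \<open>The spectral integral bounds only the form of \<open>B = A - c\<close>. For a symmetric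
  operator the form controls the norm: polarize <B u, v> with \<open>v\<close> the multiple of
  \<open>B u\<close> that has the length of \<open>u\<close>.\<close>

lemma norm_op_diff_le:
  assumes \<delta>: "\<delta> \<ge> 0" and u: "E {c-\<delta>..c+\<delta>} u = u"
  shows "norm (A u - c *\<^sub>R u) \<le> \<delta> * norm u"
proof -
  define J where "J = {c-\<delta>..c+\<delta>}"
  have J: "J \<in> sets borel" by (simp add: J_def)
  have dom: "x \<in> D" if "E J x = x" for x
    by (rule bounded_proj_dom[OF J that, where K = "\<bar>c\<bar> + \<delta>"]) (auto simp: J_def)
  define B where "B x = A x - c *\<^sub>R x" for x
  define q where "q x = Re (cinner (B x) x)" for x
  have q: "\<bar>q x\<bar> \<le> \<delta> * (norm x)\<^sup>2" if "E J x = x" for x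
  proof -
    have "(c - \<delta>) * (norm x)\<^sup>2 \<le> Re (cinner (A x) x)"
      by (rule cinner_op_ge[OF J dom[OF that] that]) (auto simp: J_def)
    moreover have "Re (cinner (A x) x) \<le> (c + \<delta>) * (norm x)\<^sup>2"
      by (rule cinner_op_le[OF J dom[OF that] that]) (auto simp: J_def)
    ultimately show ?thesis
      by (simp add: q_def B_def cinner_simps Re_cinner_self abs_le_iff algebra_simps cinner_self)
  qed
  have u: "E J u = u" using u by (simp add: J_def)
  have uD: "u \<in> D" by (rule dom[OF u])
  have Bu: "E J (B u) = B u"
    using proj_op[OF J uD] u by (simp add: B_def diff[OF J] hilbert_projection.scaleR[OF proj[OF J]])
  show ?thesis
  proof (cases "u = 0 \<or> B u = 0")
    case False
    then have nz: "norm u > 0" "norm (B u) > 0" by auto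
    define s where "s = norm u / norm (B u)"
    define v where "v = s *\<^sub>R B u"
    have v: "E J v = v" using Bu by (simp add: v_def hilbert_projection.scaleR[OF proj[OF J]])
    have vD: "v \<in> D" by (rule dom[OF v])
    have nv: "norm v = norm u" using nz by (simp add: v_def s_def)
    have "cinner (B v) u = cinner v (B u)"
      by (simp add: B_def cinner_simps op_sym[OF vD uD])
    then have "cinner (B v) u = cnj (cinner (B u) v)" by (metis cinner_commute)
    then have "Re (cinner (B v) u) = Re (cinner (B u) v)" by simp
    moreover have "B (u + v) = B u + B v" "B (u - v) = B u - B v"
      by (simp_all add: B_def op_add op_diff uD vD scaleR_add_right scaleR_diff_right)
    ultimately have "4 * Re (cinner (B u) v) = q (u + v) - q (u - v)"
      by (simp add: q_def cinner_add_left cinner_add_right cinner_diff_left cinner_diff_right)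
    also have "\<dots> \<le> \<delta> * (norm (u + v))\<^sup>2 + \<delta> * (norm (u - v))\<^sup>2"
      using q[of "u + v"] q[of "u - v"] u v by (simp add: add[OF J] diff[OF J] abs_le_iff)
    \<comment> \<open>Parallelogram law; the equal lengths of \<open>u\<close> and \<open>v\<close>
      make the constant exactly \<delta>.\<close>
    also have "\<dots> = 4 * (\<delta> * (norm u)\<^sup>2)"
      by (simp add: norm_add_sq norm_diff_sq nv algebra_simps)
    finally have "Re (cinner (B u) v) \<le> \<delta> * (norm u)\<^sup>2" by simp
    moreover have "Re (cinner (B u) v) = norm u * norm (B u)"
      using nz by (simp add: v_def s_def cinner_simps Re_cinner_self cinner_self power2_eq_square)
    ultimately have "norm u * norm (B u) \<le> norm u * (\<delta> * norm u)"
      by (simp add: power2_eq_square mult_ac)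
    then have "norm (B u) \<le> \<delta> * norm u" using nz by simp
    then show ?thesis by (simp add: B_def)
  next
    case True
    then show ?thesis using \<delta> by (auto simp: B_def)
  qed
qed

lemma eigen_dom: "E {t} u \<in> D"
  using bounded_proj_dom[of "{t}" "E {t} u" "\<bar>t\<bar>"] by (simp add: idem)

lemma eigen_op: "A (E {t} u) = t *\<^sub>R E {t} u"
  using norm_op_diff_le[of 0 t "E {t} u"] by (simp add: idem)

text \<open>On the part below \<open>a\<close> the form of \<open>A - (a + b) / 2\<close> is at most
  \<open>-(b - a) / 2\<close>, on the part above \<open>b\<close> at least
  \<open>(b - a) / 2\<close>. The two parts are orthogonal and stay so under the operator, hence
  squares add.\<close>

lemma gap_lower_bound:
  assumes "a < b" and u: "u \<in> D" "E {a..b} u = 0"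
  shows "((b - a) / 2 * norm u)\<^sup>2 \<le> (norm (A u - ((a + b) / 2) *\<^sub>R u))\<^sup>2"
proof -
  define c h where "c = (a + b) / 2" and "h = (b - a) / 2"
  have h: "h > 0" using assms by (simp add: h_def)
  define x y where "x = E {..<a} u" and "y = E {b<..} u"
  have D: "x \<in> D" "y \<in> D" using u by (auto simp: x_def y_def proj_dom)
  have "- {a..b} = {..<a} \<union> {b<..}" "{..<a} \<inter> {b<..} = {}" using \<open>a < b\<close> by auto
  then have uxy: "u = x + y"
    using Compl[of "{a..b}" u] Un[of "{..<a}" "{b<..}" u] u \<open>a < b\<close>
    by (auto simp: x_def y_def)
  define B where "B x = A x - c *\<^sub>R x" for x
  have BE: "B (E S v) = E S (B v)" if "S \<in> sets borel" "v \<in> D" for S v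
    using that by (simp add: B_def proj_op diff hilbert_projection.scaleR[OF proj])
  have orth: "cinner (E {..<a} v) (E {b<..} w) = 0" for v w
    using disjoint_zero[of "{..<a}" "{b<..}" w] \<open>{..<a} \<inter> {b<..} = {}\<close> by (simp add: sym)
  have 1: "(norm u)\<^sup>2 = (norm x)\<^sup>2 + (norm y)\<^sup>2"
    unfolding uxy by (rule cinner_eq_zero_norm_add) (simp add: x_def y_def orth)
  have Buxy: "B u = B x + B y"
    by (simp add: B_def uxy op_add D scaleR_add_right)
  have 2: "(norm (B u))\<^sup>2 = (norm (B x))\<^sup>2 + (norm (B y))\<^sup>2"
    unfolding Buxy by (rule cinner_eq_zero_norm_add) (simp add: x_def y_def BE u orth)
  have step: "(h * norm v)\<^sup>2 \<le> (norm (B v))\<^sup>2" if "h * (norm v)\<^sup>2 \<le> \<bar>Re (cinner (B v) v)\<bar>" for v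
  proof -
    have "h * (norm v)\<^sup>2 \<le> norm (B v) * norm v"
      using that Re_cinner_le[of "B v" v] by linarith
    then have "h * norm v \<le> norm (B v)"
      by (cases "v = 0") (auto simp: power2_eq_square)
    then show ?thesis using h by (intro power_mono) auto
  qed
  have "(c + h) * (norm y)\<^sup>2 \<le> Re (cinner (A y) y)"
    by (rule cinner_op_ge[of "{b<..}", OF _ D(2)]) (auto simp: y_def c_def h_def field_simps idem)
  then have "h * (norm y)\<^sup>2 \<le> \<bar>Re (cinner (B y) y)\<bar>"
    by (simp add: B_def cinner_simps cinner_self algebra_simps)
  from step[OF this] have 3: "(h * norm y)\<^sup>2 \<le> (norm (B y))\<^sup>2" .
  have "Re (cinner (A x) x) \<le> (c - h) * (norm x)\<^sup>2"
    by (rule cinner_op_le[of "{..<a}", OF _ D(1)]) (auto simp: x_def c_def h_def field_simps idem)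
  then have "h * (norm x)\<^sup>2 \<le> \<bar>Re (cinner (B x) x)\<bar>"
    by (simp add: B_def cinner_simps cinner_self algebra_simps)
  from step[OF this] have 4: "(h * norm x)\<^sup>2 \<le> (norm (B x))\<^sup>2" .
  from 1 2 3 4 show ?thesis
    by (simp add: power_mult_distrib B_def algebra_simps flip: c_def h_def)
qed

text \<open>A nonzero vector in the range of \<open>E\<close> of the interval of radius
  \<open>c / 2\<close> about \<open>t\<close> would satisfy
  \<open>norm (A u - t *\<^sub>R u) \<le> c / 2 * norm u\<close>, against the lower bound
  \<open>c\<close> valid at resolvent points. So \<open>E\<close> vanishes near each such point, and
  \<open>zero_open\<close> glues.\<close>

lemma proj_zero_resolvent_set:
  assumes S: "S \<in> sets borel" "\<And>t. t \<in> S \<Longrightarrow> complex_of_real t \<in> resolvent_set D A"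
  shows "E S x = 0"
proof (rule zero_open[OF _ S(1)])
  fix t assume "t \<in> S"
  then obtain c where c: "c > 0" "\<And>u. u \<in> D \<Longrightarrow> c * norm u \<le> norm (A u - t *\<^sub>R u)"
    using S(2) real_resolvent_set_iff by blast
  have "E {t - c/2<..<t + c/2} x = 0" for x
  proof -
    define u where "u = E {t - c/2<..<t + c/2} x"
    have "{t - c/2..t + c/2} \<inter> {t - c/2<..<t + c/2} = {t - c/2<..<t + c/2}" by auto
    then have u: "E {t - c/2..t + c/2} u = u" by (simp add: u_def Int)
    have "u \<in> D"
      by (rule bounded_proj_dom[OF _ u, where K = "\<bar>t\<bar> + c/2"]) auto
    moreover have "norm (A u - t *\<^sub>R u) \<le> c / 2 * norm u"
      using norm_op_diff_le[OF _ u] c(1) by simp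
    ultimately have "c * norm u \<le> 0" using c(2)[of u] by linarith
    then show ?thesis using c(1) by (simp add: u_def mult_le_0_iff)
  qed
  then show "\<exists>e>0. \<forall>x. E {t-e<..<t+e} x = 0"
    using c(1) by (intro exI[of _ "c/2"]) auto
qed

lemma proj_Icc_eq_sum:
  assumes "finite \<Lambda>" "\<Lambda> \<subseteq> {a..b}" "spectrum D A \<inter> complex_of_real ` {a..b} \<subseteq> complex_of_real ` \<Lambda>"
  shows "E {a..b} x = (\<Sum>t\<in>\<Lambda>. E {t} x)"
proof -
  have F: "\<Lambda> \<in> sets borel" using assms(1) by (simp add: finite_imp_closed)
  have "complex_of_real t \<in> resolvent_set D A" if "t \<in> {a..b} - \<Lambda>" for t
    using that assms(3) by (auto simp: spectrum_def)
  then have "E ({a..b} - \<Lambda>) x = 0"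
    using F by (intro proj_zero_resolvent_set) auto
  moreover have "E (({a..b} - \<Lambda>) \<union> \<Lambda>) x = E ({a..b} - \<Lambda>) x + E \<Lambda> x"
    using F by (intro Un) auto
  moreover have "({a..b} - \<Lambda>) \<union> \<Lambda> = {a..b}" using assms(2) by auto
  ultimately show ?thesis using finite_UN_sum[OF assms(1)] by simp
qed

text \<open>\<open>spectrum_min\<close> is a \<open>LEAST\<close> over the reals, so a minimum has
  to exist: the set of real spectral points is nonempty, bounded below by semi-boundedness, and
  closed. As \<open>E\<close> vanishes below the minimum, the spectral integral gives the
  bound.\<close>

lemma form_lower_bound:
  assumes semi: "semibounded_below D A" and ne: "complex_of_real l \<in> spectrum D A" and u: "u \<in> D"
  shows "spectrum_min D A * (norm u)\<^sup>2 \<le> Re (cinner (A u) u)"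
proof -
  obtain \<gamma> where \<gamma>: "\<And>u. u \<in> D \<Longrightarrow> \<gamma> * (norm u)\<^sup>2 \<le> Re (cinner (A u) u)"
    using semi by (auto simp: semibounded_below_def)
  define X where "X = {t. complex_of_real t \<in> spectrum D A}"
  have lX: "l \<in> X" using ne by (simp add: X_def)
  have bdd: "\<gamma> \<le> t" if "t \<in> X" for t
  proof (rule ccontr)
    assume "\<not> \<gamma> \<le> t"
    then have pos: "\<gamma> - t > 0" by simp
    have "(\<gamma> - t) * norm u \<le> norm (A u - t *\<^sub>R u)" if u: "u \<in> D" for u
    proof -
      have "(\<gamma> - t) * (norm u)\<^sup>2 \<le> Re (cinner (A u - t *\<^sub>R u) u)"
        using \<gamma>[OF u] by (simp add: cinner_simps cinner_self algebra_simps)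
      also have "\<dots> \<le> norm (A u - t *\<^sub>R u) * norm u"
        using Re_cinner_le[of "A u - t *\<^sub>R u" u] by linarith
      finally show ?thesis by (cases "u = 0") (auto simp: power2_eq_square)
    qed
    then have "complex_of_real t \<in> resolvent_set D A"
      using pos real_resolvent_set_iff by blast
    with that show False by (simp add: X_def spectrum_def)
  qed
  have "open (- X)"
    unfolding open_dist
  proof
    fix t assume "t \<in> - X"
    then obtain c where c: "c > 0" "\<And>u. u \<in> D \<Longrightarrow> c * norm u \<le> norm (A u - t *\<^sub>R u)"
      using real_resolvent_set_iff[of t] by (auto simp: X_def spectrum_def)
    show "\<exists>e>0. \<forall>s. dist s t < e \<longrightarrow> s \<in> - X"
    proof (intro exI[of _ "c/2"] conjI allI impI)
      fix s assume s: "dist s t < c/2"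
      have "c/2 * norm u \<le> norm (A u - s *\<^sub>R u)" if u: "u \<in> D" for u
      proof -
        have "A u - t *\<^sub>R u = (A u - s *\<^sub>R u) + (s - t) *\<^sub>R u"
          by (simp add: algebra_simps)
        then have "norm (A u - t *\<^sub>R u) \<le> norm (A u - s *\<^sub>R u) + \<bar>s - t\<bar> * norm u"
          by (metis norm_triangle_ineq norm_scaleR)
        moreover have "\<bar>s - t\<bar> * norm u \<le> c/2 * norm u"
          using s by (intro mult_right_mono) (auto simp: dist_real_def)
        ultimately show ?thesis using c(2)[OF u] by (simp add: field_simps)
      qed
      then have "\<exists>c>0. \<forall>u\<in>D. c * norm u \<le> norm (A u - s *\<^sub>R u)"
        using c(1) by (intro exI[of _ "c/2"]) auto
      then show "s \<in> - X"
        unfolding X_def spectrum_def using real_resolvent_set_iff[of s] by simp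
    qed (use c in auto)
  qed
  then have cl: "closed X" by (simp add: closed_def)
  define m where "m = Inf X"
  have bX: "bdd_below X" using bdd by (auto simp: bdd_below_def)
  have mX: "m \<in> X"
    unfolding m_def by (rule closed_contains_Inf[OF _ bX cl]) (use lX in auto)
  have mle: "m \<le> t" if "t \<in> X" for t
    unfolding m_def using that bX by (rule cInf_lower)
  have "spectrum_min D A = m"
    unfolding spectrum_min_def using mX mle by (intro Least_equality) (auto simp: X_def)
  moreover have "E {..<m} u = 0"
    using mle by (intro proj_zero_resolvent_set) (force simp: X_def spectrum_def)+
  then have "E (- {..<m}) u = u"
    by (simp only: Compl borel_open open_lessThan) simp
  then have "m * (norm u)\<^sup>2 \<le> Re (cinner (A u) u)"
    by (intro cinner_op_ge[OF _ u]) auto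
  ultimately show ?thesis by simp
qed

text \<open>In the polarization formula at \<open>u, u\<close> the two imaginary terms cancel
  because \<open>1 + \<i>\<close> and \<open>1 - \<i>\<close> have equal modulus, which leaves <A u,
  u>.\<close>

lemma form_norm_sq:
  assumes u: "u \<in> D"
  shows "form_norm E m u = sqrt (Re (cinner (A u) u) - (m - 1) * (norm u)\<^sup>2)"
proof -
  have q: "complex_of_real (quadratic_form E v) = cinner (A v) v" if "v \<in> D" for v
    using cinner_op[OF that] by (simp add: quadratic_form_def)
  have q0: "quadratic_form E 0 = 0" using q[of 0] by simp
  have "sesquilinear_form E u u = cinner (A u) u"
    unfolding sesquilinear_form_def
    using u by (simp add: q q0 dom_add dom_diff dom_scaleC op_add op_diff op_scaleC cinner_simps algebra_simps)
  then show ?thesis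
    by (simp add: form_norm_def form_inner_def cinner_self)
qed

end

section \<open>Contour integrals of resolvents\<close>

lemma cinner_ext: "(\<And>v. cinner x v = cinner (y::'a::complex_hilbert_space) v) \<Longrightarrow> x = y"
  by (metis cinner_diff_left cinner_self eq_iff_diff_eq_0 norm_eq_zero of_real_eq_0_iff
      power_eq_0_iff)

abbreviation circle_integral ::
    "complex \<Rightarrow> real \<Rightarrow> (complex \<Rightarrow> 'a::complex_hilbert_space) \<Rightarrow> 'a"
  where "circle_integral c r \<equiv> vector_contour_integral (circlepath c r)"

lemma continuous_circlepath_integrand:
  fixes f :: "complex \<Rightarrow> 'a::complex_hilbert_space"
  assumes "r \<ge> 0" "continuous_on (sphere c r) f"
  shows "continuous_on {0..1} (\<lambda>t. vector_derivative (circlepath c r) (at t within {0..1}) *\<^sub>C f (circlepath c r t))"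
proof -
  have "continuous_on {0..1} (\<lambda>t. (2 * pi * \<i> * r * exp (2 * pi * \<i> * t)) *\<^sub>C f (circlepath c r t))"
  proof (intro continuous_intros continuous_on_compose2[OF assms(2)])
    show "continuous_on {0..1} (circlepath c r)"
      using path_circlepath[of c r] by (simp add: path_def)
    show "circlepath c r ` {0..1} \<subseteq> sphere c r"
      using assms(1) path_image_circlepath[of c r] by (simp add: path_image_def)
  qed
  then show ?thesis
    by (rule continuous_on_eq) (auto simp: vector_derivative_circlepath01)
qed

lemma circle_integral_cong:
  assumes "r \<ge> 0" "\<And>\<zeta>. \<zeta> \<in> sphere c r \<Longrightarrow> f \<zeta> = g \<zeta>"
  shows "circle_integral c r f = circle_integral c r g"
  unfolding vector_contour_integral_def
proof (rule integral_cong)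
  fix t :: real assume "t \<in> {0..1}"
  then have "circlepath c r t \<in> sphere c r"
    using assms(1) path_image_circlepath[of c r] by (auto simp: path_image_def)
  then show "vector_derivative (circlepath c r) (at t within {0..1}) *\<^sub>C f (circlepath c r t)
      = vector_derivative (circlepath c r) (at t within {0..1}) *\<^sub>C g (circlepath c r t)"
    by (simp add: assms(2))
qed

lemma circle_integral_linear:
  fixes f :: "complex \<Rightarrow> 'a::complex_hilbert_space" and L :: "'a \<Rightarrow> 'b::complex_hilbert_space"
  assumes "r \<ge> 0" "continuous_on (sphere c r) f"
    and "bounded_linear L" "\<And>c x. L (c *\<^sub>C x) = c *\<^sub>C L x"
  shows "L (circle_integral c r f) = circle_integral c r (\<lambda>\<zeta>. L (f \<zeta>))"
  using integral_linear[OF integrable_continuous_real[OF continuous_circlepath_integrand[OF assms(1,2)]] assms(3)]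
  by (simp add: vector_contour_integral_def o_def assms(4))

lemma circle_integral_complex:
  assumes "r \<ge> 0" "continuous_on (sphere c r) f"
  shows "circle_integral c r f = contour_integral (circlepath c r) f"
proof -
  have "(f has_contour_integral circle_integral c r f) (circlepath c r)"
    unfolding has_contour_integral_def vector_contour_integral_def
    using integrable_integral[OF integrable_continuous_real[OF continuous_circlepath_integrand[OF assms]]]
    by (simp add: scaleC_complex_def mult.commute)
  then show ?thesis by (simp add: contour_integral_unique)
qed

text \<open>The bridge to complex analysis: tested against a vector, a Hilbert space valued integral
  is an ordinary contour integral, and \<open>cinner_ext\<close> carries Cauchy's theorem
  back.\<close>

lemma cinner_circle_integral:
  fixes f :: "complex \<Rightarrow> 'a::complex_hilbert_space"
  assumes "r \<ge> 0" "continuous_on (sphere c r) f"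
  shows "cinner (circle_integral c r f) v = contour_integral (circlepath c r) (\<lambda>\<zeta>. cinner (f \<zeta>) v)"
proof -
  have "cinner (circle_integral c r f) v = circle_integral c r (\<lambda>\<zeta>. cinner (f \<zeta>) v)"
    by (rule circle_integral_linear[OF assms bounded_linear_cinner_left])
       (simp add: cinner_scaleC_left scaleC_complex_def)
  also have "\<dots> = contour_integral (circlepath c r) (\<lambda>\<zeta>. cinner (f \<zeta>) v)"
    by (intro circle_integral_complex assms bounded_linear.continuous_on[OF bounded_linear_cinner_left])
  finally show ?thesis .
qed

lemma circle_integral_diff:
  fixes f :: "complex \<Rightarrow> 'a::complex_hilbert_space"
  assumes "r \<ge> 0" "continuous_on (sphere c r) f" "continuous_on (sphere c r) g"
  shows "circle_integral c r (\<lambda>\<zeta>. f \<zeta> - g \<zeta>) = circle_integral c r f - circle_integral c r g"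
  using integral_diff[OF integrable_continuous_real[OF continuous_circlepath_integrand[OF assms(1,2)]]
      integrable_continuous_real[OF continuous_circlepath_integrand[OF assms(1,3)]]]
  by (simp add: vector_contour_integral_def complex_vector.scale_right_diff_distrib)

lemma circle_integral_add:
  fixes f :: "complex \<Rightarrow> 'a::complex_hilbert_space"
  assumes "r \<ge> 0" "continuous_on (sphere c r) f" "continuous_on (sphere c r) g"
  shows "circle_integral c r (\<lambda>\<zeta>. f \<zeta> + g \<zeta>) = circle_integral c r f + circle_integral c r g"
  using integral_add[OF integrable_continuous_real[OF continuous_circlepath_integrand[OF assms(1,2)]]
      integrable_continuous_real[OF continuous_circlepath_integrand[OF assms(1,3)]]]
  by (simp add: vector_contour_integral_def scaleC_add_right)

lemma circle_integral_sum:
  fixes f :: "'i \<Rightarrow> complex \<Rightarrow> 'a::complex_hilbert_space"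
  assumes "r \<ge> 0" "finite I" "\<And>i. i \<in> I \<Longrightarrow> continuous_on (sphere c r) (f i)"
  shows "circle_integral c r (\<lambda>\<zeta>. \<Sum>i\<in>I. f i \<zeta>) = (\<Sum>i\<in>I. circle_integral c r (f i))"
  using assms(2,3)
proof (induction I rule: finite_induct)
  case empty
  show ?case by (simp add: vector_contour_integral_def)
next
  case (insert i I)
  then show ?case
    using assms(1) by (simp add: circle_integral_add continuous_on_sum)
qed

lemma circle_integral_scaleC:
  fixes x :: "'a::complex_hilbert_space"
  assumes "r \<ge> 0" "continuous_on (sphere c r) h"
  shows "circle_integral c r (\<lambda>\<zeta>. h \<zeta> *\<^sub>C x) = contour_integral (circlepath c r) h *\<^sub>C x"
  using circle_integral_linear[OF assms bounded_bilinear.bounded_linear_left[OF bounded_bilinear_scaleC, of x]] circle_integral_complex[OF assms]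
  by (simp add: scaleC_complex_def scaleC_scaleC)

lemma norm_circle_integral_le:
  fixes f :: "complex \<Rightarrow> 'a::complex_hilbert_space"
  assumes "r \<ge> 0" "continuous_on (sphere c r) f" "\<And>\<zeta>. \<zeta> \<in> sphere c r \<Longrightarrow> norm (f \<zeta>) \<le> B"
  shows "norm (circle_integral c r f) \<le> 2 * pi * r * B"
proof -
  have "norm (circle_integral c r f) \<le> (2 * pi * r * B) * (1 - 0)"
    unfolding vector_contour_integral_def
  proof (rule integral_bound[OF _ continuous_circlepath_integrand[OF assms(1,2)]])
    fix t :: real assume t: "t \<in> {0..1}"
    have "circlepath c r t \<in> sphere c r"
      using t assms(1) path_image_circlepath[of c r] by (auto simp: path_image_def)
    moreover have "norm (vector_derivative (circlepath c r) (at t within {0..1})) = 2 * pi * r"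
      using t assms(1) by (simp add: vector_derivative_circlepath01 norm_mult)
    ultimately show "norm (vector_derivative (circlepath c r) (at t within {0..1}) *\<^sub>C f (circlepath c r t)) \<le> 2 * pi * r * B"
      using assms(1,3) by (simp add: norm_scaleC mult_left_mono)
  qed simp
  then show ?thesis by simp
qed

text \<open>\<open>A\<close> is unbounded, so \<open>circle_integral_linear\<close> does not cover
  it. Instead \<open>A\<close> is moved onto the test vector, and \<open>adjointI\<close> brings it
  back.\<close>

lemma (in selfadj) circle_integral_closed_op:
  assumes "r \<ge> 0" "continuous_on (sphere c r) f" "continuous_on (sphere c r) (\<lambda>\<zeta>. A (f \<zeta>))"
    and "\<And>\<zeta>. \<zeta> \<in> sphere c r \<Longrightarrow> f \<zeta> \<in> D"
  shows "circle_integral c r f \<in> D"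
    and "A (circle_integral c r f) = circle_integral c r (\<lambda>\<zeta>. A (f \<zeta>))"
proof -
  have "cinner (A x) (circle_integral c r f) = cinner x (circle_integral c r (\<lambda>\<zeta>. A (f \<zeta>)))"
    if x: "x \<in> D" for x
  proof -
    have "cinner (circle_integral c r f) (A x) = contour_integral (circlepath c r) (\<lambda>\<zeta>. cinner (f \<zeta>) (A x))"
      by (rule cinner_circle_integral[OF assms(1,2)])
    also have "\<dots> = contour_integral (circlepath c r) (\<lambda>\<zeta>. cinner (A (f \<zeta>)) x)"
      using assms(1,4) x by (intro contour_integral_cong) (auto simp: op_sym)
    also have "\<dots> = cinner (circle_integral c r (\<lambda>\<zeta>. A (f \<zeta>))) x"
      by (rule cinner_circle_integral[OF assms(1,3), symmetric])
    finally show ?thesis by (metis cinner_commute)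
  qed
  from adjointI[OF this] show "circle_integral c r f \<in> D"
    "A (circle_integral c r f) = circle_integral c r (\<lambda>\<zeta>. A (f \<zeta>))" by auto
qed

text \<open>Linearity, a uniform bound and the first resolvent identity carry all contour arguments.
  They are used for \<open>A + \<i>P\<close> on an annulus and for the completed compression on a
  disc.\<close>

locale resolvent_family =
  fixes U :: "complex set" and R :: "complex \<Rightarrow> 'a::complex_hilbert_space \<Rightarrow> 'a" and M :: real
  assumes R_add: "\<zeta> \<in> U \<Longrightarrow> R \<zeta> (x + y) = R \<zeta> x + R \<zeta> y"
    and R_scaleC: "\<zeta> \<in> U \<Longrightarrow> R \<zeta> (k *\<^sub>C x) = k *\<^sub>C R \<zeta> x"
    and R_bound: "\<zeta> \<in> U \<Longrightarrow> norm (R \<zeta> x) \<le> M * norm x"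
    and R_identity: "\<zeta> \<in> U \<Longrightarrow> \<eta> \<in> U \<Longrightarrow> R \<zeta> x - R \<eta> x = (\<zeta> - \<eta>) *\<^sub>C R \<zeta> (R \<eta> x)"
begin

lemma R_bounded_linear: "\<zeta> \<in> U \<Longrightarrow> bounded_linear (R \<zeta>)"
  by (rule bounded_linear_intro[where K = M])
     (auto simp: R_add R_bound mult.commute R_scaleC simp flip: scaleC_of_real)

lemma R_Lipschitz:
  assumes "\<zeta> \<in> U" "\<eta> \<in> U"
  shows "norm (R \<zeta> x - R \<eta> x) \<le> norm (\<zeta> - \<eta>) * (\<bar>M\<bar> * (\<bar>M\<bar> * norm x))"
proof -
  have M: "norm (R \<xi> y) \<le> \<bar>M\<bar> * norm y" if "\<xi> \<in> U" for \<xi> y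
    using R_bound[OF that, of y] mult_right_mono[OF abs_ge_self[of M] norm_ge_zero[of y]] by linarith
  have "norm (R \<zeta> (R \<eta> x)) \<le> \<bar>M\<bar> * (\<bar>M\<bar> * norm x)"
    using M[OF assms(1), of "R \<eta> x"] mult_left_mono[OF M[OF assms(2), of x], of "\<bar>M\<bar>"] by linarith
  then show ?thesis
    by (simp add: R_identity[OF assms] norm_scaleC mult_left_mono)
qed

lemma R_continuous: "continuous_on U (\<lambda>\<zeta>. R \<zeta> x)"
proof (rule lipschitz_on_continuous_on)
  show "(\<bar>M\<bar> * (\<bar>M\<bar> * norm x))-lipschitz_on U (\<lambda>\<zeta>. R \<zeta> x)"
    by (rule lipschitz_onI) (auto simp: dist_norm R_Lipschitz mult.commute)
qed

text \<open>By the resolvent identity the difference quotient at \<eta> is <R \<zeta> (R \<eta> x),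
  v>, which is continuous in \<zeta>.\<close>

lemma R_holomorphic:
  assumes "open U"
  shows "(\<lambda>\<zeta>. cinner (R \<zeta> x) v) holomorphic_on U"
  unfolding holomorphic_on_open[OF assms]
proof
  fix \<eta> assume \<eta>: "\<eta> \<in> U"
  have "((\<lambda>\<zeta>. (cinner (R \<zeta> x) v - cinner (R \<eta> x) v) / (\<zeta> - \<eta>)) \<longlongrightarrow> cinner (R \<eta> (R \<eta> x)) v) (at \<eta>)"
  proof (rule Lim_transform_eventually)
    have "isCont (\<lambda>\<zeta>. R \<zeta> (R \<eta> x)) \<eta>"
      using R_continuous \<eta> assms by (metis continuous_on_eq_continuous_at)
    then show "((\<lambda>\<zeta>. cinner (R \<zeta> (R \<eta> x)) v) \<longlongrightarrow> cinner (R \<eta> (R \<eta> x)) v) (at \<eta>)"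
      by (intro bounded_linear.tendsto[OF bounded_linear_cinner_left]) (simp add: isCont_def)
    have "\<forall>\<^sub>F \<zeta> in at \<eta>. \<zeta> \<in> U \<and> \<zeta> \<noteq> \<eta>"
      using assms \<eta> by (auto simp: eventually_at_topological)
    then show "\<forall>\<^sub>F \<zeta> in at \<eta>. cinner (R \<zeta> (R \<eta> x)) v = (cinner (R \<zeta> x) v - cinner (R \<eta> x) v) / (\<zeta> - \<eta>)"
    proof (rule eventually_mono)
      fix \<zeta> assume "\<zeta> \<in> U \<and> \<zeta> \<noteq> \<eta>"
      then have "cinner (R \<zeta> x) v - cinner (R \<eta> x) v = (\<zeta> - \<eta>) * cinner (R \<zeta> (R \<eta> x)) v"
        using \<eta> by (metis R_identity cinner_diff_left cinner_scaleC_left)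
      then show "cinner (R \<zeta> (R \<eta> x)) v = (cinner (R \<zeta> x) v - cinner (R \<eta> x) v) / (\<zeta> - \<eta>)"
        using \<open>\<zeta> \<in> U \<and> \<zeta> \<noteq> \<eta>\<close> by simp
    qed
  qed
  then show "\<exists>f'. ((\<lambda>\<zeta>. cinner (R \<zeta> x) v) has_field_derivative f') (at \<eta>)"
    by (auto simp: has_field_derivative_iff)
qed

lemma circle_integral_disc:
  assumes "0 \<le> r" "r < \<rho>" "U = ball c \<rho>"
  shows "circle_integral c r (\<lambda>\<zeta>. R \<zeta> x) = 0"
proof (rule cinner_ext)
  fix v
  have sub: "sphere c r \<subseteq> U" using assms by auto
  have "((\<lambda>\<zeta>. cinner (R \<zeta> x) v) has_contour_integral 0) (circlepath c r)"
    using assms(1,2) R_holomorphic[of x v] sub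
    by (intro Cauchy_theorem_disc_simple[of _ c \<rho>]) (auto simp: assms(3))
  then show "cinner (circle_integral c r (\<lambda>\<zeta>. R \<zeta> x)) v = cinner 0 v"
    using cinner_circle_integral[OF assms(1) continuous_on_subset[OF R_continuous sub]]
    by (simp add: contour_integral_unique)
qed

text \<open>
  With \<open>J\<^sub>s\<close> the integral over the circle of radius \<open>s\<close>, \<open>J\<^sub>r = J\<^sub>s\<close> by Cauchy's theorem; for \<open>s < r\<close>
  the resolvent identity splits the integrand of \<open>J\<^sub>r J\<^sub>s\<close> into two terms, in one of which the
  inner integral vanishes, and in the other of which Fubini leaves a multiple of \<open>J\<^sub>s\<close>.
\<close>

lemma circle_integral_annulus:
  assumes s: "0 \<le> s\<^sub>1" "s\<^sub>1 < r" "r < s\<^sub>2" and U: "U = {\<zeta>. s\<^sub>1 < dist c \<zeta> \<and> dist c \<zeta> < s\<^sub>2}"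
  shows "circle_integral c r (\<lambda>\<zeta>. R \<zeta> (circle_integral c r (\<lambda>\<eta>. R \<eta> x)))
    = - (2 * complex_of_real pi * \<i>) *\<^sub>C circle_integral c r (\<lambda>\<eta>. R \<eta> x)"
proof -
  \<comment> \<open>A circle inside that of radius \<open>r\<close> but still in the annulus, so
    that the two integration variables never meet.\<close>
  define s where "s = (s\<^sub>1 + r) / 2"
  have s': "s\<^sub>1 < s" "s < r" "0 < s" "0 < r" "s < s\<^sub>2" using s by (auto simp: s_def)
  have sph: "sphere c \<rho> \<subseteq> U" if "s\<^sub>1 < \<rho>" "\<rho> < s\<^sub>2" for \<rho> using that by (auto simp: U)
  note sr = sph[OF s(2,3)] and ss = sph[OF s'(1,5)]
  have "open U"
  proof -
    have "U = - cball c s\<^sub>1 \<inter> ball c s\<^sub>2" by (auto simp: U)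
    then show ?thesis by auto
  qed
  note hol = R_holomorphic[OF this]
  have cont: "continuous_on S (\<lambda>\<zeta>. R \<zeta> y)" if "S \<subseteq> U" for S y
    by (rule continuous_on_subset[OF R_continuous that])
  \<comment> \<open>The annulus is not simply connected, so Cauchy's theorem is used in its homotopy
    form; the segments between the circles stay at radii between \<open>s\<close> and
    \<open>r\<close>.\<close>
  have change: "contour_integral (circlepath c r) (\<lambda>\<zeta>. cinner (R \<zeta> y) v)
      = contour_integral (circlepath c s) (\<lambda>\<zeta>. cinner (R \<zeta> y) v)" for y v
  proof (rule Cauchy_theorem_homotopic_loops[OF _ \<open>open U\<close> hol])
    show "homotopic_loops U (circlepath c r) (circlepath c s)"
    proof (rule homotopic_loops_linear)
      fix t :: real assume "t \<in> {0..1}"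
      show "closed_segment (circlepath c r t) (circlepath c s t) \<subseteq> U"
      proof
        fix z assume "z \<in> closed_segment (circlepath c r t) (circlepath c s t)"
        then obtain k where k: "0 \<le> k" "k \<le> 1"
          "z = (1 - k) *\<^sub>R circlepath c r t + k *\<^sub>R circlepath c s t"
          by (auto simp: closed_segment_def)
        have "z - c = complex_of_real ((1 - k) * r + k * s) * exp (2 * of_real pi * \<i> * of_real t)"
          by (simp add: k(3) circlepath scaleR_conv_of_real algebra_simps)
        then have "norm (z - c) = \<bar>(1 - k) * r + k * s\<bar>"
          by (simp only: norm_mult norm_of_real) simp
        moreover have "s \<le> (1 - k) * r + k * s" "(1 - k) * r + k * s \<le> r"
          using k s' mult_left_mono[of s r "1-k"] mult_left_mono[of s r k] by (auto simp: algebra_simps)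
        ultimately have "s \<le> norm (z - c)" "norm (z - c) \<le> r" using s' by auto
        then show "z \<in> U" using s s' by (auto simp: U dist_norm norm_minus_commute)
      qed
    qed auto
  qed auto
  have Jrs: "circle_integral c r (\<lambda>\<eta>. R \<eta> y) = circle_integral c s (\<lambda>\<eta>. R \<eta> y)" for y
  proof (rule cinner_ext)
    fix v
    have "0 \<le> r" "0 \<le> s" using s' by auto
    then show "cinner (circle_integral c r (\<lambda>\<eta>. R \<eta> y)) v = cinner (circle_integral c s (\<lambda>\<eta>. R \<eta> y)) v"
      unfolding cinner_circle_integral[OF \<open>0 \<le> r\<close> cont[OF sr]] cinner_circle_integral[OF \<open>0 \<le> s\<close> cont[OF ss]]
      by (intro change)
  qed
  define J where "J = circle_integral c s (\<lambda>\<eta>. R \<eta> x)"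
  have "cinner (circle_integral c r (\<lambda>\<zeta>. R \<zeta> J)) v = cinner (- (2 * complex_of_real pi * \<i>) *\<^sub>C J) v" for v
  proof -
    define \<phi> where "\<phi> \<zeta> = cinner (R \<zeta> x) v" for \<zeta>
    have \<phi>cont: "continuous_on S \<phi>" if "S \<subseteq> U" for S
      unfolding \<phi>_def by (intro bounded_linear.continuous_on[OF bounded_linear_cinner_left] cont that)
    have ne: "\<zeta> \<noteq> \<eta>" if "\<zeta> \<in> sphere c r" "\<eta> \<in> sphere c s" for \<zeta> \<eta> using that s' by auto
    have inner: "cinner (R \<zeta> J) v = contour_integral (circlepath c s) (\<lambda>\<eta>. - \<phi> \<eta> / (\<zeta> - \<eta>))"
      if \<zeta>: "\<zeta> \<in> sphere c r" for \<zeta>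
    proof -
      have \<zeta>U: "\<zeta> \<in> U" using \<zeta> sr by auto
      have "R \<zeta> J = circle_integral c s (\<lambda>\<eta>. R \<zeta> (R \<eta> x))"
        unfolding J_def using s' by (intro circle_integral_linear cont ss R_bounded_linear R_scaleC \<zeta>U) auto
      moreover have "continuous_on (sphere c s) (\<lambda>\<eta>. R \<zeta> (R \<eta> x))"
        by (intro bounded_linear.continuous_on[OF R_bounded_linear] cont ss \<zeta>U)
      ultimately have "cinner (R \<zeta> J) v = contour_integral (circlepath c s) (\<lambda>\<eta>. cinner (R \<zeta> (R \<eta> x)) v)"
        using s' by (simp add: cinner_circle_integral)
      also have "\<dots> = contour_integral (circlepath c s) (\<lambda>\<eta>. \<phi> \<zeta> / (\<zeta> - \<eta>) - \<phi> \<eta> / (\<zeta> - \<eta>))"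
      proof (rule contour_integral_cong)
        fix \<eta> assume "\<eta> \<in> path_image (circlepath c s)"
        then have \<eta>: "\<eta> \<in> sphere c s" using s' by simp
        then have "\<phi> \<zeta> - \<phi> \<eta> = (\<zeta> - \<eta>) * cinner (R \<zeta> (R \<eta> x)) v"
          using ss \<zeta>U by (metis \<phi>_def R_identity cinner_diff_left cinner_scaleC_left subsetD)
        then show "cinner (R \<zeta> (R \<eta> x)) v = \<phi> \<zeta> / (\<zeta> - \<eta>) - \<phi> \<eta> / (\<zeta> - \<eta>)"
          using ne[OF \<zeta> \<eta>] by (simp flip: diff_divide_distrib)
      qed simp
      also have "\<dots> = contour_integral (circlepath c s) (\<lambda>\<eta>. \<phi> \<zeta> / (\<zeta> - \<eta>))
          - contour_integral (circlepath c s) (\<lambda>\<eta>. \<phi> \<eta> / (\<zeta> - \<eta>))"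
        using s' ne[OF \<zeta>]
        by (intro contour_integral_diff contour_integrable_continuous_circlepath continuous_intros \<phi>cont)
           (auto intro: subsetD[OF ss])
      also have "contour_integral (circlepath c s) (\<lambda>\<eta>. \<phi> \<zeta> / (\<zeta> - \<eta>)) = 0"
      proof (intro contour_integral_unique Cauchy_theorem_disc_simple[of _ c r])
        show "(\<lambda>\<eta>. \<phi> \<zeta> / (\<zeta> - \<eta>)) holomorphic_on ball c r"
          using \<zeta> by (intro holomorphic_intros) auto
      qed (use s' in auto)
      also have "0 - contour_integral (circlepath c s) (\<lambda>\<eta>. \<phi> \<eta> / (\<zeta> - \<eta>))
          = contour_integral (circlepath c s) (\<lambda>\<eta>. - (\<phi> \<eta> / (\<zeta> - \<eta>)))"
        by (simp add: contour_integral_neg)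
      finally show ?thesis by simp
    qed
    have "cinner (circle_integral c r (\<lambda>\<zeta>. R \<zeta> J)) v = contour_integral (circlepath c r) (\<lambda>\<zeta>. cinner (R \<zeta> J) v)"
      using s' by (intro cinner_circle_integral cont sr) auto
    also have "\<dots> = contour_integral (circlepath c r) (\<lambda>\<zeta>. contour_integral (circlepath c s) (\<lambda>\<eta>. - \<phi> \<eta> / (\<zeta> - \<eta>)))"
      using s' by (intro contour_integral_cong inner) auto
    also have "\<dots> = contour_integral (circlepath c s) (\<lambda>\<eta>. contour_integral (circlepath c r) (\<lambda>\<zeta>. - \<phi> \<eta> / (\<zeta> - \<eta>)))"
    proof (rule contour_integral_swap)
      have "continuous_on (sphere c r \<times> sphere c s) (\<lambda>p. - \<phi> (snd p) / (fst p - snd p))"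
        using ne by (intro continuous_intros continuous_on_compose2[OF \<phi>cont[OF ss]]) auto
      then show "continuous_on (path_image (circlepath c r) \<times> path_image (circlepath c s))
          (\<lambda>(\<zeta>, \<eta>). - \<phi> \<eta> / (\<zeta> - \<eta>))"
        using s' by (simp add: case_prod_unfold)
    qed (auto simp: vector_derivative_circlepath intro!: continuous_intros)
    also have "\<dots> = contour_integral (circlepath c s) (\<lambda>\<eta>. - (2 * of_real pi * \<i>) * \<phi> \<eta>)"
    proof (rule contour_integral_cong)
      fix \<eta> assume "\<eta> \<in> path_image (circlepath c s)"
      then have "norm (\<eta> - c) < r" using s' by (auto simp: dist_norm norm_minus_commute)
      then have "((\<lambda>\<zeta>. - \<phi> \<eta> / (\<zeta> - \<eta>)) has_contour_integral (2 * of_real pi * \<i> * (- \<phi> \<eta>))) (circlepath c r)"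
        by (intro Cauchy_integral_circlepath_simple) auto
      then show "contour_integral (circlepath c r) (\<lambda>\<zeta>. - \<phi> \<eta> / (\<zeta> - \<eta>)) = - (2 * of_real pi * \<i>) * \<phi> \<eta>"
        by (simp add: contour_integral_unique)
    qed simp
    also have "\<dots> = - (2 * of_real pi * \<i>) * contour_integral (circlepath c s) \<phi>"
      using s' ss by (intro contour_integral_lmul contour_integrable_continuous_circlepath \<phi>cont) auto
    also have "contour_integral (circlepath c s) \<phi> = cinner J v"
      unfolding J_def \<phi>_def using s' by (intro cinner_circle_integral[symmetric] cont ss) auto
    finally show ?thesis by (simp add: cinner_simps)
  qed
  then have "circle_integral c r (\<lambda>\<zeta>. R \<zeta> J) = - (2 * complex_of_real pi * \<i>) *\<^sub>C J"
    by (rule cinner_ext)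
  then show ?thesis by (simp only: Jrs J_def)
qed

end

section \<open>The region enclosed by the curve\<close>

text \<open>Both cases of \<open>Gamma_curve\<close> parametrise this conic, solved for
  \<open>y\<close> if \<open>b - a \<le> 1\<close> and for \<open>x\<close> otherwise; in each case
  the radicand is nonnegative on the whole parameter range.\<close>

lemma zero_mem_Gamma_curve:
  assumes "a < b" "x \<in> {a..b}" "y \<in> {0..1}" "y * (1 - y) = (x - a) * (b - x)"
  shows "Complex x y \<in> Gamma_curve a b"
proof (cases "b - a \<le> 1")
  case True
  have "1/4 + (x - a) * (x - b) = (y - 1/2)\<^sup>2"
    using assms(4) by (simp add: power2_eq_square algebra_simps)
  then have "sqrt (1/4 + (x - a) * (x - b)) = \<bar>y - 1/2\<bar>" by simp
  then have "y = 1/2 + sqrt (1/4 + (x - a) * (x - b)) \<or> y = 1/2 - sqrt (1/4 + (x - a) * (x - b))"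
    by linarith
  then show ?thesis
    using True assms(2) by (auto simp: Gamma_curve_def intro!: bexI[of _ x])
next
  case False
  have "((b - a)/2)\<^sup>2 + y * (y - 1) = (x - (a + b)/2)\<^sup>2"
    using assms(4) by (simp add: power2_eq_square field_simps)
  then have "sqrt (((b - a)/2)\<^sup>2 + y * (y - 1)) = \<bar>x - (a + b)/2\<bar>" by simp
  then have "x = (a + b)/2 + sqrt (((b - a)/2)\<^sup>2 + y * (y - 1)) \<or>
      x = (a + b)/2 - sqrt (((b - a)/2)\<^sup>2 + y * (y - 1))"
    by linarith
  then show ?thesis
    using False assms(3) unfolding Gamma_curve_def by (auto intro!: bexI[of _ y])
qed

text \<open>The function \<open>g\<close> is negative at the centre. The half of the disc with
  \<open>Im z \<le> 1\<close> is convex, so a change of sign there would produce a zero, and a zero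
  there lies on the curve. A point above height 1 is compared with its projection to that
  height.\<close>

lemma disc_inside_Gamma_curve:
  assumes ab: "a < b" and l: "a < l" "l < b" and r: "0 < r" "r < 1/2"
    and disj: "cball (complex_of_real l + \<i>) (2 * r) \<inter> Gamma_curve a b = {}"
    and z: "z \<in> cball (complex_of_real l + \<i>) (2 * r)"
  shows "Im z * (1 - Im z) < (Re z - a) * (b - Re z)"
proof -
  define c where "c = complex_of_real l + \<i>"
  have c: "c = Complex l 1" by (simp add: c_def complex_eq_iff)
  define g where "g z = Im z * (1 - Im z) - (Re z - a) * (b - Re z)" for z
  define H where "H = cball c (2 * r) \<inter> {z. Im z \<le> 1}"
  have neg: "g z < 0" if "z \<in> H" for z
  proof (rule ccontr)
    assume nn: "\<not> g z < 0"
    have "connected H"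
      unfolding H_def by (intro convex_connected convex_Int convex_cball convex_halfspace_Im_le)
    then have "connected (g ` H)"
      unfolding g_def by (intro connected_continuous_image continuous_intros)
    moreover have "c \<in> H" "g c < 0" using l r by (auto simp: H_def g_def c)
    ultimately have "0 \<in> g ` H"
      using nn that connectedD_interval[of "g ` H" "g c" "g z" 0] by auto
    then obtain w where w: "w \<in> H" "g w = 0" by auto
    have "\<bar>Im (c - w)\<bar> \<le> 2 * r"
      using w(1) abs_Im_le_cmod[of "c - w"] by (simp add: H_def dist_norm)
    \<comment> \<open>Radius below 1 keeps the half disc in the strip of the curve. There
      \<open>y * (1 - y) \<ge> 0\<close>, which forces the real part of a zero of \<open>g\<close>
      into \<open>{a..b}\<close>.\<close>
    then have y: "Im w \<in> {0..1}" using w(1) r by (auto simp: H_def c)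
    then have "0 \<le> Im w * (1 - Im w)" by simp
    then have "0 \<le> (Re w - a) * (b - Re w)" using w(2) by (simp add: g_def)
    then have "Re w \<in> {a..b}" using ab by (auto simp: zero_le_mult_iff)
    from zero_mem_Gamma_curve[OF ab this y] w(2) have "w \<in> Gamma_curve a b"
      by (simp add: g_def)
    then show False using disj w(1) by (auto simp: H_def c_def)
  qed
  show ?thesis
  proof (cases "Im z \<le> 1")
    case True
    then show ?thesis using neg[of z] z by (auto simp: H_def c_def g_def)
  next
    case False
    define x where "x = Complex (Re z) 1"
    have "\<bar>Re (c - z)\<bar> \<le> 2 * r"
      using z abs_Re_le_cmod[of "c - z"] by (simp add: dist_norm c_def)
    moreover have "c - x = complex_of_real (Re (c - z))"
      by (simp add: x_def c complex_eq_iff)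
    then have "norm (c - x) = \<bar>Re (c - z)\<bar>" by (simp only: norm_of_real)
    ultimately have "x \<in> H" by (simp add: H_def dist_norm x_def)
    from neg[OF this] have "0 < (Re z - a) * (b - Re z)" by (simp add: g_def x_def)
    moreover have "Im z * (1 - Im z) < 0" using False by (simp add: mult_pos_neg)
    ultimately show ?thesis by linarith
  qed
qed

section \<open>Uniform lower bound for the compression\<close>

context spectral
begin

text \<open>\<open>w\<close> stands for \<open>Q P Q u\<close>, of which only consequences of
  \<open>0 \<le> Q P Q \<le> 1\<close> are kept. If \<open>f = 0\<close>, reality of <A u, u> gives
  \<open>\<beta> = y * (norm u)\<^sup>2\<close>. Then \<open>(norm w)\<^sup>2 \<le> \<beta>\<close>
  bounds the norm of \<open>A u - ((a + b) / 2) *\<^sub>R u\<close> from above while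
  \<open>gap_lower_bound\<close> bounds it from below, and the difference of the two squared bounds
  is the conic expression. The right-hand side collects what a nonzero \<open>f\<close>
  contributes.\<close>

lemma gap_form_estimate:
  assumes ab: "a < b" and u: "u \<in> D" "E {a..b} u = 0" and s: "s \<in> {1, -1}"
    and w: "cinner w u = complex_of_real \<beta>" "(norm w)\<^sup>2 \<le> \<beta>" "norm w \<le> norm u"
    and f: "f = A u + (complex_of_real s * \<i>) *\<^sub>C w - Complex x (s * y) *\<^sub>C u"
  shows "((x - a) * (b - x) - y * (1 - y)) * (norm u)\<^sup>2
    \<le> (norm f)\<^sup>2 + (2 * (1 + norm (Complex (x - (a + b) / 2) (s * y))) + \<bar>1 - 2 * y\<bar>) * (norm f * norm u)"
proof -
  define c where "c = (a + b) / 2"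
  define z where "z = Complex (x - c) (s * y)"
  define k where "k = z *\<^sub>C u - (complex_of_real s * \<i>) *\<^sub>C w"
  have ss: "s * s = 1" using s by auto
  have Auc: "A u - c *\<^sub>R u = f + k"
  proof -
    have "z *\<^sub>C u = Complex x (s * y) *\<^sub>C u - c *\<^sub>R u"
      unfolding scaleC_of_real[symmetric] complex_vector.scale_left_diff_distrib[symmetric]
      by (rule arg_cong[where f = "\<lambda>z. z *\<^sub>C u"]) (simp add: z_def complex_eq_iff)
    then show ?thesis by (simp add: f k_def)
  qed
  have "Im (cinner (A u - c *\<^sub>R u) u) = 0"
    by (simp add: cinner_simps Im_cinner_op[OF u(1)] cinner_self)
  then have "Im (cinner f u) + s * y * (norm u)\<^sup>2 - s * \<beta> = 0"
    unfolding Auc by (simp add: k_def cinner_simps cinner_self w z_def)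
  then have "s * (s * \<beta>) = s * (Im (cinner f u) + s * y * (norm u)\<^sup>2)" by simp
  then have "(s * s) * \<beta> = s * Im (cinner f u) + (s * s) * y * (norm u)\<^sup>2"
    by (simp add: algebra_simps)
  then have \<beta>: "\<beta> = s * Im (cinner f u) + y * (norm u)\<^sup>2" by (simp add: ss)
  have "cinner u w = complex_of_real \<beta>"
    using w(1) by (subst cinner_commute) simp
  then have "Re (cinner (z *\<^sub>C u) ((complex_of_real s * \<i>) *\<^sub>C w)) = (s * s) * y * \<beta>"
    by (simp add: cinner_simps z_def)
  then have k2: "(norm k)\<^sup>2 = (norm z)\<^sup>2 * (norm u)\<^sup>2 - 2 * y * \<beta> + (norm w)\<^sup>2"
    unfolding k_def norm_diff_sq using s
    by (auto simp add: ss norm_scaleC norm_mult power_mult_distrib)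
  have z2: "(norm z)\<^sup>2 = (x - c)\<^sup>2 + y\<^sup>2"
    using s by (auto simp: z_def cmod_power2)
  have If: "\<bar>Im (cinner f u)\<bar> \<le> norm f * norm u" by (rule Im_cinner_le)
  have "(norm k)\<^sup>2 \<le> (norm z)\<^sup>2 * (norm u)\<^sup>2 + (1 - 2 * y) * \<beta>"
    using w(2) k2 by (simp add: algebra_simps)
  also have "\<dots> = ((x - c)\<^sup>2 + y - y\<^sup>2) * (norm u)\<^sup>2 + (1 - 2 * y) * (s * Im (cinner f u))"
    unfolding z2 \<beta> by (simp add: algebra_simps power2_eq_square)
  also have "(1 - 2 * y) * (s * Im (cinner f u)) \<le> \<bar>1 - 2 * y\<bar> * (norm f * norm u)"
  proof -
    have "(1 - 2 * y) * (s * Im (cinner f u)) \<le> \<bar>(1 - 2 * y) * (s * Im (cinner f u))\<bar>" by simp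
    also have "\<dots> = \<bar>1 - 2 * y\<bar> * \<bar>Im (cinner f u)\<bar>" using s by (auto simp: abs_mult)
    also have "\<dots> \<le> \<bar>1 - 2 * y\<bar> * (norm f * norm u)" by (intro mult_left_mono If) simp
    finally show ?thesis .
  qed
  finally have k: "(norm k)\<^sup>2 \<le> ((x - c)\<^sup>2 + y - y\<^sup>2) * (norm u)\<^sup>2 + \<bar>1 - 2 * y\<bar> * (norm f * norm u)"
    by simp
  have "norm k \<le> norm (z *\<^sub>C u) + norm ((complex_of_real s * \<i>) *\<^sub>C w)"
    unfolding k_def by (rule norm_triangle_ineq4)
  also have "\<dots> \<le> (1 + norm z) * norm u"
    using s w(3) by (auto simp: norm_scaleC norm_mult algebra_simps)
  finally have nk: "norm k \<le> (1 + norm z) * norm u" .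
  have "((b - a) / 2 * norm u)\<^sup>2 \<le> (norm (f + k))\<^sup>2"
    using gap_lower_bound[OF ab u] by (simp add: Auc flip: c_def)
  also have "\<dots> \<le> (norm f)\<^sup>2 + 2 * (norm f * norm k) + (norm k)\<^sup>2"
    using Re_cinner_le[of f k] by (simp add: norm_add_sq)
  also have "norm f * norm k \<le> norm f * ((1 + norm z) * norm u)"
    by (intro mult_left_mono nk) simp
  finally have "((b - a) / 2 * norm u)\<^sup>2 \<le> (norm f)\<^sup>2 + 2 * (norm f * ((1 + norm z) * norm u))
      + (((x - c)\<^sup>2 + y - y\<^sup>2) * (norm u)\<^sup>2 + \<bar>1 - 2 * y\<bar> * (norm f * norm u))"
    using k by linarith
  moreover have "((b - a) / 2)\<^sup>2 - ((x - c)\<^sup>2 + y - y\<^sup>2) = (x - a) * (b - x) - y * (1 - y)"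
    by (simp add: c_def power2_eq_square field_simps)
  then have "((x - a) * (b - x) - y * (1 - y)) * (norm u)\<^sup>2
      = ((b - a) / 2 * norm u)\<^sup>2 - ((x - c)\<^sup>2 + y - y\<^sup>2) * (norm u)\<^sup>2"
    unfolding power_mult_distrib left_diff_distrib[symmetric] by simp
  ultimately have "((x - a) * (b - x) - y * (1 - y)) * (norm u)\<^sup>2
    \<le> (norm f)\<^sup>2 + (2 * (1 + norm z) + \<bar>1 - 2 * y\<bar>) * (norm f * norm u)"
    by (simp add: algebra_simps)
  then show ?thesis by (simp add: z_def c_def)
qed

text \<open>The conic expression has a positive minimum on the compact disc, which makes the bound
  uniform in \<open>z\<close>. \<kappa> is obtained before \<open>P\<close>, so it is the same for
  the whole sequence.\<close>

lemma compressed_lower_bound: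
  assumes ab: "a < b" and l: "a < l" "l < b" and r: "0 < r" "r < 1/2"
    and disj: "cball (complex_of_real l + \<i>) (2 * r) \<inter> Gamma_curve a b = {}"
  obtains \<kappa> where "\<kappa> > 0"
    "\<And>P s z u. orthogonal_projection P \<Longrightarrow> s \<in> {1, -1} \<Longrightarrow> z \<in> cball (complex_of_real l + \<i>) (2 * r) \<Longrightarrow>
      u \<in> D \<Longrightarrow> E {a..b} u = 0 \<Longrightarrow>
      \<kappa> * norm u \<le> norm (A u + (complex_of_real s * \<i>) *\<^sub>C (P u - E {a..b} (P u))
         - Complex (Re z) (s * Im z) *\<^sub>C u)"
proof -
  define K where "K = cball (complex_of_real l + \<i>) (2 * r)"
  define g where "g z = (Re z - a) * (b - Re z) - Im z * (1 - Im z)" for z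
  have "compact K" "K \<noteq> {}" "continuous_on K g"
    unfolding K_def g_def using r by (auto intro!: continuous_intros)
  then obtain z0 where z0: "z0 \<in> K" "\<And>z. z \<in> K \<Longrightarrow> g z0 \<le> g z"
    using continuous_attains_inf[of K g] by blast
  define c where "c = g z0"
  have c: "c > 0"
    using disc_inside_Gamma_curve[OF ab l r disj, of z0] z0(1) by (simp add: c_def g_def K_def)
  \<comment> \<open>Bounds the coefficient of \<open>norm f * norm u\<close> in
    \<open>gap_form_estimate\<close>: within distance 1 of \<open>l + \<i>\<close> one has
    \<open>\<bar>Re z\<bar> \<le> \<bar>l\<bar> + 1\<close>, \<open>\<bar>Im z\<bar> \<le> 2\<close>
    and \<open>\<bar>1 - 2 * Im z\<bar> \<le> 3\<close>.\<close>
  define L where "L = 2 * (1 + (\<bar>l\<bar> + 3 + \<bar>(a + b) / 2\<bar>)) + 3"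
  have L: "L > 0" by (simp add: L_def)
  \<comment> \<open>The cap at 1 gives \<open>norm f \<le> norm u\<close> in the argument by
    contradiction, so that the term quadratic in \<open>f\<close> is absorbed into the linear
    one.\<close>
  define \<kappa> where "\<kappa> = min 1 (c / (1 + L))"
  show thesis
  proof
    show \<kappa>: "\<kappa> > 0" using c L by (simp add: \<kappa>_def)
    fix P :: "'a \<Rightarrow> 'a" and s :: real and z u
    assume P: "orthogonal_projection P" and s: "s \<in> {1, -1}"
      and z: "z \<in> cball (complex_of_real l + \<i>) (2 * r)" and u: "u \<in> D" "E {a..b} u = 0"
    interpret P: hilbert_projection P by unfold_locales (rule P)
    interpret Pi: hilbert_projection "E {a..b}" by (rule proj) simp
    define w where "w = P u - E {a..b} (P u)"
    define f where "f = A u + (complex_of_real s * \<i>) *\<^sub>C w - Complex (Re z) (s * Im z) *\<^sub>C u"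
    have "cinner w u = cinner (P u) u"
      using u(2) by (simp add: w_def Pi.compl_sym)
    then have w1: "cinner w u = complex_of_real ((norm (P u))\<^sup>2)"
      by (simp add: P.cinner_self_proj)
    have w2: "norm w \<le> norm (P u)"
      unfolding w_def by (rule Pi.norm_compl_le)
    then have w2': "(norm w)\<^sup>2 \<le> (norm (P u))\<^sup>2" by (simp add: power_mono)
    have w3: "norm w \<le> norm u" using w2 P.norm_le[of u] by linarith
    note est = gap_form_estimate[OF ab u s w1 w2' w3 f_def]
    have "norm (z - (complex_of_real l + \<i>)) \<le> 1"
      using z r by (simp add: dist_norm norm_minus_commute)
    then have "\<bar>Re z - l\<bar> \<le> 1" "\<bar>Im z - 1\<bar> \<le> 1"
      using abs_Re_le_cmod[of "z - (complex_of_real l + \<i>)"]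
        abs_Im_le_cmod[of "z - (complex_of_real l + \<i>)"] by auto
    then have zb: "\<bar>Re z\<bar> \<le> \<bar>l\<bar> + 1" "\<bar>Im z\<bar> \<le> 2" "\<bar>1 - 2 * Im z\<bar> \<le> 3" by linarith+
    have "norm (Complex (Re z - (a + b) / 2) (s * Im z)) \<le> \<bar>Re z - (a + b) / 2\<bar> + \<bar>s * Im z\<bar>"
      using cmod_le[of "Complex (Re z - (a + b) / 2) (s * Im z)"] by simp
    also have "\<bar>s * Im z\<bar> = \<bar>Im z\<bar>" using s by auto
    also have "\<bar>Re z - (a + b) / 2\<bar> + \<bar>Im z\<bar> \<le> \<bar>l\<bar> + 3 + \<bar>(a + b) / 2\<bar>" using zb by linarith
    finally have "2 * (1 + norm (Complex (Re z - (a + b) / 2) (s * Im z))) + \<bar>1 - 2 * Im z\<bar> \<le> L"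
      using zb(3) by (simp add: L_def)
    then have "(2 * (1 + norm (Complex (Re z - (a + b) / 2) (s * Im z))) + \<bar>1 - 2 * Im z\<bar>) * (norm f * norm u)
        \<le> L * (norm f * norm u)"
      by (intro mult_right_mono) auto
    moreover have "c * (norm u)\<^sup>2 \<le> g z * (norm u)\<^sup>2"
      using z0(2)[of z] z by (intro mult_right_mono) (auto simp: c_def K_def)
    ultimately have main: "c * (norm u)\<^sup>2 \<le> (norm f)\<^sup>2 + L * (norm f * norm u)"
      using est by (simp add: g_def)
    have "\<kappa> * norm u \<le> norm f"
    proof (rule ccontr)
      assume "\<not> \<kappa> * norm u \<le> norm f"
      then have less: "norm f < \<kappa> * norm u" by simp
      have "\<kappa> * norm u \<le> 1 * norm u" by (intro mult_right_mono) (auto simp: \<kappa>_def)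
      then have fu: "norm f \<le> norm u" using less by simp
      have u0: "norm u > 0" using less \<kappa> by (cases "u = 0") auto
      have "(norm f)\<^sup>2 \<le> norm f * norm u"
        unfolding power2_eq_square by (intro mult_left_mono fu) simp
      then have "c * norm u * norm u \<le> (1 + L) * norm f * norm u"
        using main by (simp add: power2_eq_square algebra_simps)
      then have "c * norm u \<le> (1 + L) * norm f" using u0 by simp
      then have "c / (1 + L) * norm u \<le> norm f" using L by (simp add: field_simps)
      moreover have "\<kappa> * norm u \<le> c / (1 + L) * norm u"
        by (intro mult_right_mono) (auto simp: \<kappa>_def)
      ultimately show False using less by simp
    qed
    then show "\<kappa> * norm u \<le> norm (A u + (complex_of_real s * \<i>) *\<^sub>C (P u - E {a..b} (P u))
         - Complex (Re z) (s * Im z) *\<^sub>C u)"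
      by (simp add: f_def w_def)
  qed
qed

end

section \<open>Perturbation by one projection\<close>

text \<open>Linearity and the resolvent identity hold by uniqueness of solutions, and the norm bound
  is the lower bound with \<open>s = 1\<close>. A general symmetric \<open>B\<close> covers both
  \<open>P\<close> and \<open>Q P Q\<close>.\<close>

lemma (in selfadj) resolvent_family_perturbation:
  assumes B: "clinear_on UNIV B" "bounded_linear B" "\<And>x y. cinner (B x) y = cinner x (B y)"
    and \<kappa>: "\<kappa> > 0"
    and lower: "\<And>s z u. z \<in> U \<Longrightarrow> s \<in> {1, -1} \<Longrightarrow> u \<in> D \<Longrightarrow>
      \<kappa> * norm u \<le> norm (A u + (complex_of_real s * \<i>) *\<^sub>C B u - Complex (Re z) (s * Im z) *\<^sub>C u)"
  shows "resolvent_family U (resolvent D (\<lambda>u. A u + \<i> *\<^sub>C B u)) (1 / \<kappa>)"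
    and "\<And>z. z \<in> U \<Longrightarrow> bij_betw (\<lambda>u. A u + \<i> *\<^sub>C B u - z *\<^sub>C u) D UNIV"
proof -
  define T where "T u = A u + \<i> *\<^sub>C B u" for u
  show bij: "bij_betw (\<lambda>u. A u + \<i> *\<^sub>C B u - z *\<^sub>C u) D UNIV" if "z \<in> U" for z
    by (rule bounded_below_bij[OF B \<kappa> lower[OF that]])
  note R = resolvent_props[of T, unfolded T_def, OF bij, folded T_def]
  have B_add: "B (x + y) = B x + B y" and B_sc: "B (k *\<^sub>C x) = k *\<^sub>C B x" for x y k
    using B(1) by (auto simp: clinear_on_def)
  have T_add: "T (x + y) = T x + T y" if "x \<in> D" "y \<in> D" for x y
    using that by (simp add: T_def op_add B_add scaleC_add_right)
  have T_sc: "T (k *\<^sub>C x) = k *\<^sub>C T x" if "x \<in> D" for x k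
    using that by (simp add: T_def op_scaleC B_sc scaleC_add_right scaleC_scaleC mult.commute)
  have eqI: "resolvent D T z x = y" if "z \<in> U" "y \<in> D" "T y - z *\<^sub>C y = x" for x y z
    using R(3)[OF that(1,2)] that(3) by simp
  have "resolvent_family U (resolvent D T) (1 / \<kappa>)"
  proof
    fix z assume z: "z \<in> U"
    show "resolvent D T z (x + y) = resolvent D T z x + resolvent D T z y" for x y
    proof (rule eqI[OF z])
      let ?x = "resolvent D T z x" and ?y = "resolvent D T z y"
      have "T (?x + ?y) - z *\<^sub>C (?x + ?y) = (T ?x - z *\<^sub>C ?x) + (T ?y - z *\<^sub>C ?y)"
        by (simp add: T_add R(1)[OF z] scaleC_add_right)
      then show "T (?x + ?y) - z *\<^sub>C (?x + ?y) = x + y" by (simp only: R(2)[OF z])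
    qed (intro dom_add R(1) z)
    show "resolvent D T z (k *\<^sub>C x) = k *\<^sub>C resolvent D T z x" for k x
    proof (rule eqI[OF z])
      let ?x = "resolvent D T z x"
      have "T (k *\<^sub>C ?x) - z *\<^sub>C (k *\<^sub>C ?x) = k *\<^sub>C (T ?x - z *\<^sub>C ?x)"
        by (simp add: T_sc R(1)[OF z] complex_vector.scale_right_diff_distrib scaleC_scaleC mult.commute)
      then show "T (k *\<^sub>C ?x) - z *\<^sub>C (k *\<^sub>C ?x) = k *\<^sub>C x" by (simp only: R(2)[OF z])
    qed (intro dom_scaleC R(1) z)
    show "norm (resolvent D T z x) \<le> 1 / \<kappa> * norm x" for x
    proof -
      have "\<kappa> * norm (resolvent D T z x) \<le> norm (T (resolvent D T z x) - z *\<^sub>C resolvent D T z x)"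
        using lower[OF z, of 1 "resolvent D T z x"] R(1)[OF z] by (simp add: T_def)
      then have "\<kappa> * norm (resolvent D T z x) \<le> norm x" by (simp only: R(2)[OF z])
      then show ?thesis using \<kappa> by (simp add: field_simps)
    qed
    fix w assume w: "w \<in> U"
    show "resolvent D T z x - resolvent D T w x = (z - w) *\<^sub>C resolvent D T z (resolvent D T w x)" for x
    proof -
      let ?y = "resolvent D T w x"
      let ?v = "?y + (z - w) *\<^sub>C resolvent D T z ?y"
      have "T ?v - z *\<^sub>C ?v = (T ?y - z *\<^sub>C ?y)
          + (z - w) *\<^sub>C (T (resolvent D T z ?y) - z *\<^sub>C resolvent D T z ?y)"
        by (simp add: T_add T_sc R(1)[OF z] R(1)[OF w] dom_scaleC scaleC_add_right
            complex_vector.scale_right_diff_distrib scaleC_scaleC mult.commute)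
      also have "T (resolvent D T z ?y) - z *\<^sub>C resolvent D T z ?y = ?y" by (rule R(2)[OF z])
      also have "T ?y - z *\<^sub>C ?y + (z - w) *\<^sub>C ?y = T ?y - w *\<^sub>C ?y"
        by (simp add: complex_vector.scale_left_diff_distrib)
      also have "\<dots> = x" by (rule R(2)[OF w])
      finally have "resolvent D T z x = ?v"
        by (intro eqI[OF z]) (auto intro!: dom_add dom_scaleC R(1) z w)
      then show ?thesis by simp
    qed
  qed
  moreover have "T = (\<lambda>u. A u + \<i> *\<^sub>C B u)" by (auto simp: T_def)
  ultimately show "resolvent_family U (resolvent D (\<lambda>u. A u + \<i> *\<^sub>C B u)) (1 / \<kappa>)" by simp
qed

text \<open>One member of the sequence, with a number \<epsilon> in place of its gap. The constants
  built in this locale are free of \<open>P\<close> and \<epsilon>, so they can be shared by all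
  large \<open>n\<close>.\<close>

locale gap_setting = spectral D A E + Pn: hilbert_projection P
  for D :: "'a::complex_hilbert_space set" and A :: "'a \<Rightarrow> 'a"
    and E :: "real set \<Rightarrow> 'a \<Rightarrow> 'a" and P :: "'a \<Rightarrow> 'a" +
  fixes a b l r \<kappa> \<epsilon> :: real and \<Lambda> :: "real set"
  assumes finite_\<Lambda>: "finite \<Lambda>" and \<Lambda>_sub: "\<Lambda> \<subseteq> {a..b}" and l_mem: "l \<in> \<Lambda>"
    and proj_sum: "\<And>x. E {a..b} x = (\<Sum>t\<in>\<Lambda>. E {t} x)"
    and sep: "\<And>t. t \<in> \<Lambda> \<Longrightarrow> t \<noteq> l \<Longrightarrow> 2 * r < \<bar>t - l\<bar>"
    and r_pos: "0 < r" and r_less: "r < 1/2"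
    and \<kappa>_pos: "0 < \<kappa>"
    and compressed: "\<And>s z u. s \<in> {1, -1} \<Longrightarrow> z \<in> cball (complex_of_real l + \<i>) (2 * r) \<Longrightarrow>
      u \<in> D \<Longrightarrow> E {a..b} u = 0 \<Longrightarrow>
      \<kappa> * norm u \<le> norm (A u + (complex_of_real s * \<i>) *\<^sub>C (P u - E {a..b} (P u))
         - Complex (Re z) (s * Im z) *\<^sub>C u)"
    and \<epsilon>_nonneg: "0 \<le> \<epsilon>"
    and defect: "\<And>u. E {a..b} u = u \<Longrightarrow> norm (u - P u) \<le> \<epsilon> * norm u"
    and \<epsilon>_small: "\<epsilon> * (2 * card \<Lambda> / r + 1 / \<kappa>) \<le> 1/2"
begin

abbreviation E\<^sub>\<Delta> :: "'a \<Rightarrow> 'a" where "E\<^sub>\<Delta> \<equiv> E {a..b}"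
abbreviation Q :: "'a \<Rightarrow> 'a" where "Q u \<equiv> u - E {a..b} u"
abbreviation c :: complex where "c \<equiv> complex_of_real l + \<i>"
abbreviation T :: "'a \<Rightarrow> 'a" where "T \<equiv> \<lambda>u. A u + \<i> *\<^sub>C P u"

text \<open>
  The compression of \<open>T\<close> to the range of \<open>Q\<close>, extended by \<open>A\<close> itself to the range of \<open>E\<^sub>\<Delta>\<close>: since the
  disc does not meet the real axis, its resolvent is holomorphic on the whole disc.
\<close>

abbreviation S :: "'a \<Rightarrow> 'a" where "S \<equiv> \<lambda>u. A u + \<i> *\<^sub>C Q (P (Q u))"

text \<open>Sum of the inverse lower bounds of the diagonal blocks: \<open>2 / r\<close> for each
  eigenvalue and \<open>1 / \<kappa>\<close> for the complement.\<close>

definition N :: real where "N = 2 * card \<Lambda> / r + 1 / \<kappa>"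

sublocale Pi: hilbert_projection E\<^sub>\<Delta>
  by (rule proj) simp

lemma N_pos: "N > 0"
  unfolding N_def using r_pos \<kappa>_pos by (intro add_nonneg_pos) auto

lemma sub_proj: "W \<in> sets borel \<Longrightarrow> W \<subseteq> {a..b} \<Longrightarrow> E\<^sub>\<Delta> (E W x) = E W x"
  by (simp add: Int Int_absorb1)

text \<open>Duality: \<open>defect\<close> controls \<open>(1 - P) E W\<close>; both factors are
  symmetric, so the adjoint \<open>E W (1 - P)\<close> obeys the same bound.\<close>

lemma defect_proj:
  assumes W: "W \<in> sets borel" "W \<subseteq> {a..b}"
  shows "norm (E W (P u - u)) \<le> \<epsilon> * norm u"
proof -
  define y where "y = E W (P u - u)"
  have "cinner y y = cinner y (P u - u)"
    unfolding y_def by (simp only: sym[OF W(1), symmetric] idem[OF W(1)])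
  also have "\<dots> = - cinner (y - P y) u"
    by (simp add: cinner_simps Pn.sym)
  finally have "(norm y)\<^sup>2 \<le> norm (y - P y) * norm u"
    using Re_cinner_le[of "y - P y" u] Re_cinner_self[of y] by simp
  also have "\<dots> \<le> (\<epsilon> * norm y) * norm u"
    using defect[of y] sub_proj[OF W] by (intro mult_right_mono) (auto simp: y_def)
  finally show ?thesis
    by (cases "y = 0") (auto simp: power2_eq_square y_def[symmetric] \<epsilon>_nonneg)
qed

text \<open>The radii \<open>r / 2\<close> and \<open>3 * r / 2\<close> are balanced: the inner one
  keeps \<open>z\<close> at distance \<open>r / 2\<close> from \<open>l + \<i>\<close>, and the
  other eigenvalues are more than \<open>2 * r\<close> from \<open>l\<close>, which leaves
  \<open>2 * r - 3 * r / 2\<close>.\<close>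

lemma eig_dist:
  assumes t: "t \<in> \<Lambda>" and z: "r / 2 < dist c z" "dist c z < 3 * r / 2"
  shows "r / 2 \<le> norm (complex_of_real t + \<i> - z)"
proof (cases "t = l")
  case True
  then show ?thesis using z by (simp add: dist_norm)
next
  case False
  have "norm (complex_of_real (t - l)) \<le> norm (complex_of_real t + \<i> - z) + norm (c - z)"
    using norm_triangle_ineq4[of "complex_of_real t + \<i> - z" "c - z"] by (simp add: algebra_simps)
  then have "\<bar>t - l\<bar> \<le> norm (complex_of_real t + \<i> - z) + norm (c - z)"
    by (simp only: norm_of_real)
  then show ?thesis using sep[OF t False] z by (simp add: dist_norm)
qed

lemma norm_Complex_sign:
  assumes "s \<in> {1, -1}"
  shows "norm (complex_of_real t + complex_of_real s * \<i> - Complex (Re z) (s * Im z))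
    = norm (complex_of_real t + \<i> - z)"
proof -
  have "(s - s * Im z)\<^sup>2 = (1 - Im z)\<^sup>2" using assms by (auto simp: power2_eq_square algebra_simps)
  then show ?thesis by (simp add: cmod_def)
qed

text \<open>Applying each spectral projection to \<open>f\<close> gives the block equations up to
  errors of size \<open>\<epsilon> * norm u\<close>. They sum to
  \<open>norm u \<le> N * (norm f + \<epsilon> * norm u)\<close>, and
  \<open>\<epsilon>_small\<close> absorbs the last term at the cost of the factor 2.\<close>

lemma T_lower_bound:
  assumes z: "r / 2 < dist c z" "dist c z < 3 * r / 2" and s: "s \<in> {1, -1}" and u: "u \<in> D"
  shows "1 / (2 * N) * norm u
    \<le> norm (A u + (complex_of_real s * \<i>) *\<^sub>C P u - Complex (Re z) (s * Im z) *\<^sub>C u)"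
proof -
  define w where "w = Complex (Re z) (s * Im z)"
  define \<sigma> where "\<sigma> = complex_of_real s * \<i>"
  have \<sigma>: "norm \<sigma> = 1" using s by (auto simp: \<sigma>_def norm_mult)
  define f where "f = A u + \<sigma> *\<^sub>C P u - w *\<^sub>C u"
  have eig: "norm (E {t} u) \<le> 2 / r * (norm f + \<epsilon> * norm u)" if t: "t \<in> \<Lambda>" for t
  proof -
    have tb: "{t} \<in> sets borel" "{t} \<subseteq> {a..b}" using t \<Lambda>_sub by auto
    have "E {t} f = (complex_of_real t + \<sigma> - w) *\<^sub>C E {t} u + \<sigma> *\<^sub>C E {t} (P u - u)"
      by (simp add: f_def add[OF tb(1)] diff[OF tb(1)] scaleC[OF tb(1)] eigen_op scaleC_of_real
          proj_op[OF tb(1) u, symmetric] scaleC_add_left complex_vector.scale_left_diff_distrib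
          complex_vector.scale_right_diff_distrib)
    then have "(complex_of_real t + \<sigma> - w) *\<^sub>C E {t} u = E {t} f - \<sigma> *\<^sub>C E {t} (P u - u)" by simp
    then have "norm (complex_of_real t + \<sigma> - w) * norm (E {t} u) = norm (E {t} f - \<sigma> *\<^sub>C E {t} (P u - u))"
      by (metis norm_scaleC)
    also have "\<dots> \<le> norm (E {t} f) + norm (\<sigma> *\<^sub>C E {t} (P u - u))" by (rule norm_triangle_ineq4)
    also have "\<dots> \<le> norm f + \<epsilon> * norm u"
      using norm_le[OF tb(1), of f] defect_proj[OF tb, of u] by (simp add: norm_scaleC \<sigma>)
    finally have "r / 2 * norm (E {t} u) \<le> norm f + \<epsilon> * norm u"
      using mult_right_mono[OF eig_dist[OF t z] norm_ge_zero[of "E {t} u"]]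
      by (simp add: norm_Complex_sign[OF s] w_def \<sigma>_def)
    then show ?thesis using r_pos by (simp add: field_simps)
  qed
  have Pi_u: "norm (E\<^sub>\<Delta> u) \<le> 2 * card \<Lambda> / r * (norm f + \<epsilon> * norm u)"
  proof -
    have "norm (E\<^sub>\<Delta> u) \<le> (\<Sum>t\<in>\<Lambda>. norm (E {t} u))" unfolding proj_sum by (rule norm_sum)
    also have "\<dots> \<le> (\<Sum>t\<in>\<Lambda>. 2 / r * (norm f + \<epsilon> * norm u))" by (intro sum_mono eig)
    finally show ?thesis by (simp add: mult_ac)
  qed
  have Q_u: "norm (Q u) \<le> 1 / \<kappa> * (norm f + \<epsilon> * norm u)"
  proof -
    have QD: "Q u \<in> D" "E\<^sub>\<Delta> u \<in> D" using u by (auto intro!: dom_diff proj_dom)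
    have Q0: "E\<^sub>\<Delta> (Q u) = 0" by (simp add: Pi.diff)
    have "P u = P (Q u) + P (E\<^sub>\<Delta> u)" by (simp flip: Pn.add)
    then have "Q f = A (Q u) + \<sigma> *\<^sub>C Q (P (Q u)) - w *\<^sub>C Q u + \<sigma> *\<^sub>C Q (P (E\<^sub>\<Delta> u))"
      by (simp add: f_def Pi.add Pi.diff Pi.scaleC op_diff u QD(2) proj_op[OF _ u]
          complex_vector.scale_right_diff_distrib scaleC_add_right)
    then have "norm (A (Q u) + \<sigma> *\<^sub>C Q (P (Q u)) - w *\<^sub>C Q u) = norm (Q f - \<sigma> *\<^sub>C Q (P (E\<^sub>\<Delta> u)))" by simp
    also have "\<dots> \<le> norm (Q f) + norm (\<sigma> *\<^sub>C Q (P (E\<^sub>\<Delta> u)))" by (rule norm_triangle_ineq4)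
    also have "norm (Q f) \<le> norm f" by (rule Pi.norm_compl_le)
    also have "norm (\<sigma> *\<^sub>C Q (P (E\<^sub>\<Delta> u))) \<le> \<epsilon> * norm u"
    proof -
      \<comment> \<open>\<open>Q\<close> kills the range of \<open>E\<^sub>\<Delta>\<close>, so the
        coupling term is \<open>Q (1 - P) E\<^sub>\<Delta> u\<close> up to sign, which the defect
        bounds.\<close>
      have "Q (E\<^sub>\<Delta> u - P (E\<^sub>\<Delta> u)) = - Q (P (E\<^sub>\<Delta> u))" by (simp add: Pi.diff)
      then have "norm (Q (P (E\<^sub>\<Delta> u))) = norm (Q (E\<^sub>\<Delta> u - P (E\<^sub>\<Delta> u)))"
        by (simp only: norm_minus_cancel)
      then have "norm (\<sigma> *\<^sub>C Q (P (E\<^sub>\<Delta> u))) \<le> norm (E\<^sub>\<Delta> u - P (E\<^sub>\<Delta> u))"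
        unfolding norm_scaleC \<sigma> using Pi.norm_compl_le[of "E\<^sub>\<Delta> u - P (E\<^sub>\<Delta> u)"] by linarith
      also have "\<dots> \<le> \<epsilon> * norm (E\<^sub>\<Delta> u)" by (rule defect) simp
      also have "\<dots> \<le> \<epsilon> * norm u" by (intro mult_left_mono Pi.norm_le \<epsilon>_nonneg)
      finally show ?thesis .
    qed
    finally have "norm (A (Q u) + \<sigma> *\<^sub>C Q (P (Q u)) - w *\<^sub>C Q u) \<le> norm f + \<epsilon> * norm u" by simp
    moreover have "\<kappa> * norm (Q u) \<le> norm (A (Q u) + \<sigma> *\<^sub>C Q (P (Q u)) - w *\<^sub>C Q u)"
      unfolding \<sigma>_def w_def using z r_pos by (intro compressed[OF s _ QD(1) Q0]) auto
    ultimately have "\<kappa> * norm (Q u) \<le> norm f + \<epsilon> * norm u" by linarith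
    then show ?thesis using \<kappa>_pos by (simp add: field_simps)
  qed
  have "norm u \<le> norm (Q u) + norm (E\<^sub>\<Delta> u)" using norm_triangle_ineq[of "Q u" "E\<^sub>\<Delta> u"] by simp
  also have "\<dots> \<le> N * (norm f + \<epsilon> * norm u)"
    using Q_u Pi_u by (simp add: N_def algebra_simps)
  also have "\<dots> \<le> N * norm f + 1/2 * norm u"
    using mult_right_mono[OF \<epsilon>_small[folded N_def] norm_ge_zero[of u]] by (simp add: algebra_simps)
  finally have "norm u \<le> 2 * N * norm f" by simp
  then show ?thesis using N_pos by (simp add: field_simps f_def \<sigma>_def w_def)
qed

text \<open>\<open>1 - 2 * r\<close> bounds from below the distance of the disc from the real axis,
  where the spectrum of \<open>A\<close>, the block of \<open>S\<close> on the range of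
  \<open>E\<^sub>\<Delta>\<close>, lies.\<close>

definition M :: real where "M = 1 / (1 - 2 * r) + 1 / \<kappa>"

lemma M_pos: "M > 0"
  unfolding M_def using r_less \<kappa>_pos by (intro add_nonneg_pos) auto

lemma Im_disc: "z \<in> ball c (2 * r) \<Longrightarrow> 1 - 2 * r \<le> Im z"
  using abs_Im_le_cmod[of "c - z"] by (simp add: dist_norm)

text \<open>\<open>S\<close> is exactly block diagonal, so there is no \<epsilon> term to absorb,
  and the bound reaches the centre of the disc.\<close>

lemma S_lower_bound:
  assumes z: "z \<in> ball c (2 * r)" and s: "s \<in> {1, -1}" and u: "u \<in> D"
  shows "1 / M * norm u
    \<le> norm (A u + (complex_of_real s * \<i>) *\<^sub>C Q (P (Q u)) - Complex (Re z) (s * Im z) *\<^sub>C u)"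
proof -
  define w where "w = Complex (Re z) (s * Im z)"
  define \<sigma> where "\<sigma> = complex_of_real s * \<i>"
  define f where "f = A u + \<sigma> *\<^sub>C Q (P (Q u)) - w *\<^sub>C u"
  have D: "Q u \<in> D" "E\<^sub>\<Delta> u \<in> D" using u by (auto intro!: dom_diff proj_dom)
  have Q0: "E\<^sub>\<Delta> (Q u) = 0" by (simp add: Pi.diff)
  have Pif: "E\<^sub>\<Delta> f = A (E\<^sub>\<Delta> u) - w *\<^sub>C E\<^sub>\<Delta> u"
    by (simp add: f_def Pi.add Pi.diff Pi.scaleC proj_op[OF _ u])
  have Qf: "Q f = A (Q u) + \<sigma> *\<^sub>C Q (P (Q u)) - w *\<^sub>C Q u"
    by (subst Pif) (simp add: f_def op_diff u D(2) complex_vector.scale_right_diff_distrib)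
  have "(1 - 2 * r) * norm (E\<^sub>\<Delta> u) \<le> \<bar>Im w\<bar> * norm (E\<^sub>\<Delta> u)"
    using Im_disc[OF z] r_less s by (intro mult_right_mono) (auto simp: w_def)
  also have "\<dots> \<le> norm (E\<^sub>\<Delta> f)" unfolding Pif by (rule norm_op_diff_ge_Im[OF D(2)])
  also have "\<dots> \<le> norm f" by (rule Pi.norm_le)
  finally have 1: "norm (E\<^sub>\<Delta> u) \<le> 1 / (1 - 2 * r) * norm f" using r_less by (simp add: field_simps)
  have "\<kappa> * norm (Q u) \<le> norm (Q f)"
    unfolding Qf \<sigma>_def w_def using z by (intro compressed[OF s _ D(1) Q0]) auto
  also have "\<dots> \<le> norm f" by (rule Pi.norm_compl_le)
  finally have 2: "norm (Q u) \<le> 1 / \<kappa> * norm f" using \<kappa>_pos by (simp add: field_simps)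
  have "norm u \<le> norm (Q u) + norm (E\<^sub>\<Delta> u)" using norm_triangle_ineq[of "Q u" "E\<^sub>\<Delta> u"] by simp
  also have "\<dots> \<le> M * norm f" using 1 2 by (simp add: M_def algebra_simps)
  finally show ?thesis using M_pos by (simp add: field_simps f_def \<sigma>_def w_def)
qed

text \<open>Leaves room on both sides of the circle; \<open>circle_integral_annulus\<close> shrinks
  the contour into the inner part.\<close>

abbreviation U\<^sub>T :: "complex set" where "U\<^sub>T \<equiv> {z. r / 2 < dist c z \<and> dist c z < 3 * r / 2}"

lemma P_facts: "clinear_on UNIV P" "bounded_linear P" "cinner (P x) y = cinner x (P y)"
  using Pn.orth_proj by (auto simp: orthogonal_projection_def Pn.bounded_linear)

lemma QPQ_facts:
  "clinear_on UNIV (\<lambda>u. Q (P (Q u)))" "bounded_linear (\<lambda>u. Q (P (Q u)))"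
  "cinner (Q (P (Q x))) y = cinner x (Q (P (Q y)))"
proof -
  show "clinear_on UNIV (\<lambda>u. Q (P (Q u)))"
    by (simp add: clinear_on_def complex_vector.subspace_UNIV Pi.add Pi.diff Pi.scaleC Pn.add Pn.diff Pn.scaleC
        complex_vector.scale_right_diff_distrib)
  have "bounded_linear (\<lambda>u. Q u)"
    by (intro bounded_linear_sub bounded_linear_ident Pi.bounded_linear)
  from bounded_linear_compose[OF this bounded_linear_compose[OF Pn.bounded_linear this]]
  show "bounded_linear (\<lambda>u. Q (P (Q u)))" .
  show "cinner (Q (P (Q x))) y = cinner x (Q (P (Q y)))"
    by (simp only: Pi.compl_sym Pn.sym)
qed

sublocale RT: resolvent_family U\<^sub>T "resolvent D T" "1 / (1 / (2 * N))"
  using N_pos T_lower_bound by (intro resolvent_family_perturbation P_facts) auto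

sublocale RS: resolvent_family "ball c (2 * r)" "resolvent D S" "1 / (1 / M)"
  using M_pos S_lower_bound by (intro resolvent_family_perturbation QPQ_facts) auto

lemma T_bij: "z \<in> U\<^sub>T \<Longrightarrow> bij_betw (\<lambda>u. T u - z *\<^sub>C u) D UNIV"
  by (rule resolvent_family_perturbation(2)[OF P_facts, of "1 / (2 * N)" "U\<^sub>T"])
     (use N_pos T_lower_bound in auto)

lemma S_bij: "z \<in> ball c (2 * r) \<Longrightarrow> bij_betw (\<lambda>u. S u - z *\<^sub>C u) D UNIV"
  by (rule resolvent_family_perturbation(2)[OF QPQ_facts, of "1 / M" "ball c (2 * r)"])
     (use M_pos S_lower_bound in auto)

end

section \<open>Parametrix and its distance to the resolvent\<close>

context gap_setting
begin

abbreviation R\<^sub>T :: "complex \<Rightarrow> 'a \<Rightarrow> 'a" where "R\<^sub>T \<equiv> resolvent D T"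
abbreviation R\<^sub>S :: "complex \<Rightarrow> 'a \<Rightarrow> 'a" where "R\<^sub>S \<equiv> resolvent D S"

text \<open>An approximate inverse of \<open>T - z\<close>, block diagonal with respect to the spectral projections.\<close>

definition parametrix :: "complex \<Rightarrow> 'a \<Rightarrow> 'a"
  where "parametrix z w = (\<Sum>t\<in>\<Lambda>. (1 / (complex_of_real t + \<i> - z)) *\<^sub>C E {t} w) + R\<^sub>S z (Q w)"

text \<open>Each term carries a factor that the defect makes small: \<open>P - 1\<close> after
  \<open>E {t}\<close>, or \<open>E\<^sub>\<Delta> P\<close> on the range of \<open>Q\<close>, where
  it equals \<open>E\<^sub>\<Delta> (P - 1)\<close>.\<close>

definition remainder :: "complex \<Rightarrow> 'a \<Rightarrow> 'a"
  where "remainder z w =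
    (\<Sum>t\<in>\<Lambda>. (\<i> / (complex_of_real t + \<i> - z)) *\<^sub>C (P (E {t} w) - E {t} w)) + \<i> *\<^sub>C E\<^sub>\<Delta> (P (R\<^sub>S z (Q w)))"

lemma singleton_sub: "t \<in> \<Lambda> \<Longrightarrow> {t} \<in> sets borel \<and> {t} \<subseteq> {a..b}"
  using \<Lambda>_sub by auto

lemma annulus_subset: "z \<in> U\<^sub>T \<Longrightarrow> z \<in> ball c (2 * r)"
  by auto

lemma sphere_subset: "sphere c r \<subseteq> U\<^sub>T" "sphere c r \<subseteq> ball c (2 * r)"
  using r_pos by auto

lemma denominator_nonzero: "z \<in> U\<^sub>T \<Longrightarrow> t \<in> \<Lambda> \<Longrightarrow> complex_of_real t + \<i> - z \<noteq> 0"
  using eig_dist[of t z] r_pos by (auto simp del: add_diff_eq)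

text \<open>On the range of \<open>E\<^sub>\<Delta>\<close> the operator \<open>S\<close> is
  \<open>A\<close>, so a nonzero component of the solution there would be an eigenvector of
  \<open>A\<close> at the nonreal \<open>z\<close>.\<close>

lemma RS_range:
  assumes z: "z \<in> ball c (2 * r)"
  shows "E\<^sub>\<Delta> (R\<^sub>S z (Q w)) = 0"
proof -
  define x where "x = R\<^sub>S z (Q w)"
  have x: "x \<in> D" "S x - z *\<^sub>C x = Q w"
    using resolvent_props(1,2)[OF S_bij[OF z]] by (auto simp: x_def)
  have "E\<^sub>\<Delta> (S x - z *\<^sub>C x) = 0" unfolding x(2) by (simp add: Pi.diff)
  then have "A (E\<^sub>\<Delta> x) - z *\<^sub>C E\<^sub>\<Delta> x = 0"
    by (simp add: Pi.diff Pi.add Pi.scaleC proj_op[OF _ x(1)])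
  then have "\<bar>Im z\<bar> * norm (E\<^sub>\<Delta> x) \<le> 0"
    using norm_op_diff_ge_Im[of "E\<^sub>\<Delta> x" z] proj_dom[of "{a..b}" x] x(1) by simp
  then show ?thesis
    using Im_disc[OF z] r_less by (auto simp: x_def mult_le_0_iff)
qed

lemma parametrix_dom: "z \<in> U\<^sub>T \<Longrightarrow> parametrix z w \<in> D"
  unfolding parametrix_def
  by (intro dom_add dom_sum dom_scaleC eigen_dom resolvent_props(1)[OF S_bij] annulus_subset)

lemma T_parametrix:
  assumes z: "z \<in> U\<^sub>T"
  shows "T (parametrix z w) - z *\<^sub>C parametrix z w = w + remainder z w"
proof -
  define L where "L u = T u - z *\<^sub>C u" for u
  have L_add: "L (x + y) = L x + L y" if "x \<in> D" "y \<in> D" for x y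
    using that by (simp add: L_def op_add Pn.add scaleC_add_right)
  have L_sc: "L (k *\<^sub>C x) = k *\<^sub>C L x" if "x \<in> D" for x k
    using that by (simp add: L_def op_scaleC Pn.scaleC scaleC_add_right scaleC_scaleC mult.commute
        complex_vector.scale_right_diff_distrib)
  have L_sum: "L (\<Sum>t\<in>F. f t) = (\<Sum>t\<in>F. L (f t))" if "finite F" "\<And>t. t \<in> F \<Longrightarrow> f t \<in> D" for F and f :: "real \<Rightarrow> 'a"
    using that
  proof (induction F rule: finite_induct)
    case empty
    show ?case using L_sc[of 0 0] by simp
  qed (simp add: L_add dom_sum)
  define x where "x = R\<^sub>S z (Q w)"
  have zb: "z \<in> ball c (2 * r)" by (rule annulus_subset[OF z])
  have x: "x \<in> D" "S x - z *\<^sub>C x = Q w"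
    using resolvent_props(1,2)[OF S_bij[OF zb]] by (auto simp: x_def)
  have x0: "E\<^sub>\<Delta> x = 0" unfolding x_def by (rule RS_range[OF zb])
  \<comment> \<open>\<open>x\<close> lies in the range of \<open>Q\<close>, where \<open>T\<close>
    differs from \<open>S\<close> exactly by the leak \<open>\<i> E\<^sub>\<Delta> P\<close> into
    the other block.\<close>
  have "L x = (S x - z *\<^sub>C x) + \<i> *\<^sub>C E\<^sub>\<Delta> (P x)"
    using x0 by (simp add: L_def complex_vector.scale_right_diff_distrib)
  then have Lx: "L x = Q w + \<i> *\<^sub>C E\<^sub>\<Delta> (P x)" by (simp only: x(2))
  have Lt: "L ((1 / (complex_of_real t + \<i> - z)) *\<^sub>C E {t} w)
      = E {t} w + (\<i> / (complex_of_real t + \<i> - z)) *\<^sub>C (P (E {t} w) - E {t} w)" if t: "t \<in> \<Lambda>" for t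
  proof -
    define k where "k = complex_of_real t + \<i> - z"
    have k: "k \<noteq> 0" unfolding k_def by (rule denominator_nonzero[OF z t])
    have "L (E {t} w) = k *\<^sub>C E {t} w + \<i> *\<^sub>C (P (E {t} w) - E {t} w)"
      by (simp add: L_def k_def eigen_op scaleC_of_real scaleC_add_left
          complex_vector.scale_left_diff_distrib complex_vector.scale_right_diff_distrib)
    then have "L ((1 / k) *\<^sub>C E {t} w) = E {t} w + (\<i> / k) *\<^sub>C (P (E {t} w) - E {t} w)"
      using k by (simp add: L_sc eigen_dom scaleC_add_right scaleC_scaleC)
    then show ?thesis by (simp add: k_def)
  qed
  have "L (parametrix z w) = (\<Sum>t\<in>\<Lambda>. L ((1 / (complex_of_real t + \<i> - z)) *\<^sub>C E {t} w)) + L x"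
    unfolding parametrix_def x_def[symmetric]
    by (simp only: L_add[OF dom_sum[OF dom_scaleC[OF eigen_dom]] x(1)]
        L_sum[OF finite_\<Lambda> dom_scaleC[OF eigen_dom]])
  also have "\<dots> = (\<Sum>t\<in>\<Lambda>. E {t} w) + Q w + remainder z w"
    unfolding remainder_def x_def[symmetric] by (simp add: Lt Lx sum.distrib)
  also have "(\<Sum>t\<in>\<Lambda>. E {t} w) + Q w = w" by (simp flip: proj_sum)
  finally show ?thesis by (simp add: L_def)
qed

definition K\<^sub>0 :: real where "K\<^sub>0 = 2 * card \<Lambda> / r + M"

lemma norm_remainder_le:
  assumes z: "z \<in> U\<^sub>T"
  shows "norm (remainder z w) \<le> K\<^sub>0 * \<epsilon> * norm w"
proof -
  have "norm ((\<i> / (complex_of_real t + \<i> - z)) *\<^sub>C (P (E {t} w) - E {t} w)) \<le> 2 / r * (\<epsilon> * norm w)"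
    if t: "t \<in> \<Lambda>" for t
  proof -
    have "norm (\<i> / (complex_of_real t + \<i> - z)) \<le> 2 / r"
    proof -
      have "r / 2 \<le> norm (complex_of_real t + \<i> - z)" using z by (intro eig_dist[OF t]) auto
      then have "1 / norm (complex_of_real t + \<i> - z) \<le> 1 / (r / 2)"
        using r_pos by (intro divide_left_mono mult_pos_pos) linarith+
      then show ?thesis by (simp add: norm_divide)
    qed
    moreover have "norm (P (E {t} w) - E {t} w) \<le> \<epsilon> * norm w"
    proof -
      have "norm (E {t} w - P (E {t} w)) \<le> \<epsilon> * norm (E {t} w)"
        using singleton_sub[OF t] by (intro defect sub_proj) auto
      also have "\<dots> \<le> \<epsilon> * norm w" by (intro mult_left_mono norm_le \<epsilon>_nonneg) simp
      finally show ?thesis by (simp add: norm_minus_commute)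
    qed
    ultimately show ?thesis
      unfolding norm_scaleC using r_pos by (intro mult_mono) auto
  qed
  then have 1: "norm (\<Sum>t\<in>\<Lambda>. (\<i> / (complex_of_real t + \<i> - z)) *\<^sub>C (P (E {t} w) - E {t} w))
      \<le> (\<Sum>t\<in>\<Lambda>. 2 / r * (\<epsilon> * norm w))"
    by (rule sum_norm_le)
  define x where "x = R\<^sub>S z (Q w)"
  have zb: "z \<in> ball c (2 * r)" by (rule annulus_subset[OF z])
  have x0: "E\<^sub>\<Delta> x = 0" unfolding x_def by (rule RS_range[OF zb])
  \<comment> \<open>Subtracting \<open>x\<close> is free because
    \<open>E\<^sub>\<Delta> x = 0\<close>, and it makes \<open>defect_proj\<close>
    applicable.\<close>
  have "norm (\<i> *\<^sub>C E\<^sub>\<Delta> (P x)) = norm (E\<^sub>\<Delta> (P x - x))"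
    using x0 by (simp add: norm_scaleC Pi.diff)
  also have "\<dots> \<le> \<epsilon> * norm x" by (rule defect_proj) auto
  also have "norm x \<le> M * norm (Q w)" using RS.R_bound[OF zb, of "Q w"] by (simp add: x_def)
  also have "M * norm (Q w) \<le> M * norm w" using M_pos by (intro mult_left_mono Pi.norm_compl_le) simp
  finally have 2: "norm (\<i> *\<^sub>C E\<^sub>\<Delta> (P x)) \<le> \<epsilon> * (M * norm w)"
    using \<epsilon>_nonneg by (simp add: mult_left_mono)
  show ?thesis
    unfolding remainder_def x_def[symmetric]
    using norm_triangle_ineq[of "\<Sum>t\<in>\<Lambda>. (\<i> / (complex_of_real t + \<i> - z)) *\<^sub>C (P (E {t} w) - E {t} w)" "\<i> *\<^sub>C E\<^sub>\<Delta> (P x)"]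
      1 2 by (simp add: K\<^sub>0_def algebra_simps)
qed

definition deviation :: "complex \<Rightarrow> 'a \<Rightarrow> 'a"
  where "deviation z w = R\<^sub>T z w - parametrix z w"

lemma deviation_dom: "z \<in> U\<^sub>T \<Longrightarrow> deviation z w \<in> D"
  unfolding deviation_def by (intro dom_diff parametrix_dom resolvent_props(1)[OF T_bij])

lemma T_deviation:
  assumes z: "z \<in> U\<^sub>T"
  shows "T (deviation z w) - z *\<^sub>C deviation z w = - remainder z w"
proof -
  have D: "R\<^sub>T z w \<in> D" "parametrix z w \<in> D"
    by (rule resolvent_props(1)[OF T_bij[OF z]], rule parametrix_dom[OF z])
  have "T (deviation z w) - z *\<^sub>C deviation z w
      = (T (R\<^sub>T z w) - z *\<^sub>C R\<^sub>T z w) - (T (parametrix z w) - z *\<^sub>C parametrix z w)"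
    by (simp add: deviation_def op_diff D Pn.diff complex_vector.scale_right_diff_distrib)
  then show ?thesis
    by (simp only: resolvent_props(2)[OF T_bij[OF z]] T_parametrix[OF z]) simp
qed

text \<open>The deviation solves an equation with right-hand side \<open>- remainder\<close>, so the
  lower bound for \<open>T - z\<close> suffices in place of a Neumann series.\<close>

lemma norm_deviation_le:
  assumes z: "z \<in> U\<^sub>T"
  shows "norm (deviation z w) \<le> 2 * N * K\<^sub>0 * \<epsilon> * norm w"
proof -
  have "1 / (2 * N) * norm (deviation z w) \<le> norm (T (deviation z w) - z *\<^sub>C deviation z w)"
    using T_lower_bound[of z 1 "deviation z w"] z deviation_dom[OF z] by simp
  also have "\<dots> \<le> K\<^sub>0 * \<epsilon> * norm w"
    unfolding T_deviation[OF z] norm_minus_cancel by (rule norm_remainder_le[OF z])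
  finally show ?thesis using N_pos by (simp add: field_simps)
qed

text \<open>Solving the equation for \<open>A\<close> carries norm bounds and continuity over to the
  graph norm, although \<open>A\<close> is unbounded.\<close>

lemma A_deviation:
  assumes z: "z \<in> U\<^sub>T"
  shows "A (deviation z w) = z *\<^sub>C deviation z w - \<i> *\<^sub>C P (deviation z w) - remainder z w"
  using T_deviation[OF z, of w] by (simp add: algebra_simps)

lemma norm_A_deviation_le:
  assumes z: "z \<in> U\<^sub>T"
  shows "norm (A (deviation z w)) \<le> ((\<bar>l\<bar> + 3) * (2 * N * K\<^sub>0) + K\<^sub>0) * \<epsilon> * norm w"
proof -
  define d where "d = deviation z w"
  \<comment> \<open>On the annulus \<open>norm z \<le> \<bar>l\<bar> + 2\<close>; the contraction
    \<open>P\<close> adds 1, whence \<open>\<bar>l\<bar> + 3\<close>.\<close>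
  have "norm c \<le> \<bar>l\<bar> + 1" using norm_triangle_ineq[of "complex_of_real l" \<i>] by simp
  moreover have "norm z \<le> norm c + dist c z"
    using norm_triangle_ineq4[of c "c - z"] by (simp add: dist_norm)
  ultimately have nz: "norm z \<le> \<bar>l\<bar> + 2" using z r_less by simp
  have "norm (A d) \<le> norm (z *\<^sub>C d) + norm (\<i> *\<^sub>C P d) + norm (remainder z w)"
    unfolding A_deviation[OF z, of w, folded d_def]
    using norm_triangle_ineq4[of "z *\<^sub>C d - \<i> *\<^sub>C P d" "remainder z w"]
      norm_triangle_ineq4[of "z *\<^sub>C d" "\<i> *\<^sub>C P d"] by linarith
  also have "norm (z *\<^sub>C d) \<le> (\<bar>l\<bar> + 2) * norm d"
    unfolding norm_scaleC by (intro mult_right_mono nz) simp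
  also have "norm (\<i> *\<^sub>C P d) \<le> norm d" by (simp add: norm_scaleC Pn.norm_le)
  finally have "norm (A d) \<le> (\<bar>l\<bar> + 3) * norm d + norm (remainder z w)"
    by (simp add: algebra_simps)
  also have "\<dots> \<le> (\<bar>l\<bar> + 3) * (2 * N * K\<^sub>0 * \<epsilon> * norm w) + K\<^sub>0 * \<epsilon> * norm w"
    unfolding d_def by (intro add_mono mult_left_mono norm_deviation_le norm_remainder_le z) simp
  finally show ?thesis by (simp add: d_def algebra_simps)
qed

lemma continuous_RT: "continuous_on (sphere c r) (\<lambda>z. R\<^sub>T z w)"
  by (rule continuous_on_subset[OF RT.R_continuous sphere_subset(1)])

lemma continuous_RS: "continuous_on (sphere c r) (\<lambda>z. R\<^sub>S z w)"
  by (rule continuous_on_subset[OF RS.R_continuous sphere_subset(2)])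

lemma continuous_eig:
  "t \<in> \<Lambda> \<Longrightarrow> continuous_on (sphere c r) (\<lambda>z. k / (complex_of_real t + \<i> - z))"
  by (intro continuous_intros ballI denominator_nonzero) (use sphere_subset in auto)

lemma continuous_parametrix: "continuous_on (sphere c r) (\<lambda>z. parametrix z w)"
  unfolding parametrix_def by (intro continuous_intros continuous_eig continuous_RS)

lemma continuous_deviation: "continuous_on (sphere c r) (\<lambda>z. deviation z w)"
  unfolding deviation_def by (intro continuous_intros continuous_parametrix continuous_RT)

lemma continuous_A_deviation: "continuous_on (sphere c r) (\<lambda>z. A (deviation z w))"
proof -
  have "continuous_on (sphere c r) (\<lambda>z. remainder z w)"
    unfolding remainder_def
    by (intro continuous_intros continuous_eig Pi.bl.continuous_on Pn.bl.continuous_on continuous_RS)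
  then have "continuous_on (sphere c r) (\<lambda>z. z *\<^sub>C deviation z w - \<i> *\<^sub>C P (deviation z w) - remainder z w)"
    by (intro continuous_intros Pn.bl.continuous_on continuous_deviation)
  then show ?thesis
    by (rule continuous_on_eq) (use sphere_subset A_deviation in auto)
qed

section \<open>The Riesz projection compared with \<open>E {l}\<close>\<close>

abbreviation riesz :: "'a \<Rightarrow> 'a" where "riesz \<equiv> riesz_projection D T c r"

text \<open>Residues: the only pole inside the circle is \<open>l + \<i>\<close>, the other
  eigenvalues lie outside the disc of radius \<open>2 * r\<close>, and \<open>R\<^sub>S\<close> is
  holomorphic there. The minus sign is that of \<open>1 / (c - z)\<close>.\<close>

lemma circle_integral_parametrix:
  "circle_integral c r (\<lambda>z. parametrix z w) = - (2 * complex_of_real pi * \<i>) *\<^sub>C E {l} w"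
proof -
  have r0: "0 \<le> r" using r_pos by simp
  have eig: "contour_integral (circlepath c r) (\<lambda>z. 1 / (complex_of_real t + \<i> - z))
      = (if t = l then - (2 * complex_of_real pi * \<i>) else 0)" if t: "t \<in> \<Lambda>" for t
  proof (cases "t = l")
    case True
    have "((\<lambda>z. - 1 / (z - c)) has_contour_integral (2 * of_real pi * \<i> * (- 1))) (circlepath c r)"
      using r_pos by (intro Cauchy_integral_circlepath_simple) auto
    moreover have "(\<lambda>z. - 1 / (z - c)) = (\<lambda>z. 1 / (c - z))"
      by (rule ext) (metis minus_diff_eq minus_divide_divide)
    ultimately show ?thesis using True by (simp add: contour_integral_unique)
  next
    case False
    have "complex_of_real t + \<i> \<notin> ball c (2 * r)"
    proof -
      have "dist c (complex_of_real t + \<i>) = norm (complex_of_real (l - t))"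
        by (simp add: dist_norm)
      also have "\<dots> = \<bar>t - l\<bar>" by (simp only: norm_of_real abs_minus_commute)
      finally show ?thesis using sep[OF t False] by simp
    qed
    then have "((\<lambda>z. 1 / (complex_of_real t + \<i> - z)) has_contour_integral 0) (circlepath c r)"
      using r_pos by (intro Cauchy_theorem_disc_simple[of _ c "2 * r"] holomorphic_intros) auto
    then show ?thesis using False by (simp add: contour_integral_unique)
  qed
  have "circle_integral c r (\<lambda>z. parametrix z w)
      = circle_integral c r (\<lambda>z. \<Sum>t\<in>\<Lambda>. (1 / (complex_of_real t + \<i> - z)) *\<^sub>C E {t} w)
        + circle_integral c r (\<lambda>z. R\<^sub>S z (Q w))"
    unfolding parametrix_def
    by (intro circle_integral_add r0 continuous_intros continuous_eig continuous_RS)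
  also have "circle_integral c r (\<lambda>z. R\<^sub>S z (Q w)) = 0"
    using r_pos by (intro RS.circle_integral_disc[of r "2 * r"]) auto
  also have "circle_integral c r (\<lambda>z. \<Sum>t\<in>\<Lambda>. (1 / (complex_of_real t + \<i> - z)) *\<^sub>C E {t} w)
      = (\<Sum>t\<in>\<Lambda>. circle_integral c r (\<lambda>z. (1 / (complex_of_real t + \<i> - z)) *\<^sub>C E {t} w))"
    by (intro circle_integral_sum r0 finite_\<Lambda> continuous_intros continuous_eig)
  also have "\<dots> = (\<Sum>t\<in>\<Lambda>. (if t = l then - (2 * complex_of_real pi * \<i>) else 0) *\<^sub>C E {t} w)"
    by (intro sum.cong refl) (simp only: circle_integral_scaleC[OF r0 continuous_eig] eig)
  also have "\<dots> = (\<Sum>t\<in>\<Lambda>. if t = l then - (2 * complex_of_real pi * \<i>) *\<^sub>C E {l} w else 0)"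
    by (intro sum.cong) auto
  also have "\<dots> = - (2 * complex_of_real pi * \<i>) *\<^sub>C E {l} w"
    using finite_\<Lambda> l_mem by (simp add: sum.delta)
  finally show ?thesis by simp
qed

lemma riesz_diff:
  "riesz w - E {l} w = (- 1 / (2 * complex_of_real pi * \<i>)) *\<^sub>C circle_integral c r (\<lambda>z. deviation z w)"
proof -
  have r0: "0 \<le> r" using r_pos by simp
  have "circle_integral c r (\<lambda>z. deviation z w)
      = circle_integral c r (\<lambda>z. R\<^sub>T z w) - circle_integral c r (\<lambda>z. parametrix z w)"
    unfolding deviation_def by (intro circle_integral_diff r0 continuous_RT continuous_parametrix)
  then show ?thesis
    by (simp add: riesz_projection_def circle_integral_parametrix scaleC_add_right scaleC_scaleC)
qed

text \<open>Serves the gap from the Riesz range to the eigenspace: a vector of that range must be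
  fixed by \<open>riesz\<close> before the size of \<open>riesz - E {l}\<close> says how far it is
  from the eigenspace.\<close>

lemma riesz_idem: "riesz (riesz w) = riesz w"
proof -
  define k where "k = - 1 / (2 * complex_of_real pi * \<i>)"
  define J where "J = circle_integral c r (\<lambda>z. R\<^sub>T z w)"
  have r0: "0 \<le> r" using r_pos by simp
  have rz: "riesz v = k *\<^sub>C circle_integral c r (\<lambda>z. R\<^sub>T z v)" for v
    by (simp add: riesz_projection_def k_def)
  have "circle_integral c r (\<lambda>z. R\<^sub>T z (k *\<^sub>C J)) = circle_integral c r (\<lambda>z. k *\<^sub>C R\<^sub>T z J)"
    using sphere_subset(1) by (intro circle_integral_cong r0 RT.R_scaleC) auto
  also have "\<dots> = k *\<^sub>C circle_integral c r (\<lambda>z. R\<^sub>T z J)"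
    by (rule circle_integral_linear[symmetric, OF r0 continuous_RT bounded_linear_scaleC_right])
       (simp add: scaleC_scaleC mult.commute)
  also have "circle_integral c r (\<lambda>z. R\<^sub>T z J) = - (2 * complex_of_real pi * \<i>) *\<^sub>C J"
    unfolding J_def using r_pos by (intro RT.circle_integral_annulus[of "r / 2" r "3 * r / 2"]) auto
  finally have "riesz (riesz w) = (k * (k * - (2 * complex_of_real pi * \<i>))) *\<^sub>C J"
    by (simp add: rz J_def scaleC_scaleC)
  also have "k * (k * - (2 * complex_of_real pi * \<i>)) = k" by (simp add: k_def)
  finally show ?thesis by (simp add: rz J_def)
qed

text \<open>The length \<open>2 * pi * r\<close> of the circle meets the normalisation
  \<open>1 / (2 * pi)\<close>, leaving \<open>r\<close>.\<close>

lemma norm_scaled_circle_integral_le: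
  assumes "continuous_on (sphere c r) f" "\<And>z. z \<in> sphere c r \<Longrightarrow> norm (f z) \<le> B"
  shows "norm ((- 1 / (2 * complex_of_real pi * \<i>)) *\<^sub>C circle_integral c r f) \<le> r * B"
  using norm_circle_integral_le[OF _ assms] r_pos
  by (simp add: norm_scaleC norm_divide norm_mult field_simps)

lemma riesz_estimate:
  shows "riesz w - E {l} w \<in> D"
    and "norm (riesz w - E {l} w) \<le> r * (2 * N * K\<^sub>0) * (\<epsilon> * norm w)"
    and "norm (A (riesz w - E {l} w)) \<le> r * ((\<bar>l\<bar> + 3) * (2 * N * K\<^sub>0) + K\<^sub>0) * (\<epsilon> * norm w)"
proof -
  have r0: "0 \<le> r" using r_pos by simp
  have sD: "deviation z w \<in> D" if "z \<in> sphere c r" for z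
    using that sphere_subset by (intro deviation_dom) auto
  have J1: "circle_integral c r (\<lambda>z. deviation z w) \<in> D"
    by (intro circle_integral_closed_op(1) r0 continuous_deviation continuous_A_deviation sD)
  have J2: "A (circle_integral c r (\<lambda>z. deviation z w)) = circle_integral c r (\<lambda>z. A (deviation z w))"
    by (intro circle_integral_closed_op(2) r0 continuous_deviation continuous_A_deviation sD)
  show "riesz w - E {l} w \<in> D"
    unfolding riesz_diff by (intro dom_scaleC J1)
  have "norm (riesz w - E {l} w) \<le> r * (2 * N * K\<^sub>0 * \<epsilon> * norm w)"
    unfolding riesz_diff using sphere_subset
    by (intro norm_scaled_circle_integral_le continuous_deviation norm_deviation_le) auto
  then show "norm (riesz w - E {l} w) \<le> r * (2 * N * K\<^sub>0) * (\<epsilon> * norm w)" by (simp add: mult_ac)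
  have "norm (A (riesz w - E {l} w)) \<le> r * (((\<bar>l\<bar> + 3) * (2 * N * K\<^sub>0) + K\<^sub>0) * \<epsilon> * norm w)"
    unfolding riesz_diff op_scaleC[OF J1] J2 using sphere_subset
    by (intro norm_scaled_circle_integral_le continuous_A_deviation norm_A_deviation_le) auto
  then show "norm (A (riesz w - E {l} w)) \<le> r * ((\<bar>l\<bar> + 3) * (2 * N * K\<^sub>0) + K\<^sub>0) * (\<epsilon> * norm w)"
    by (simp add: mult_ac)
qed

end

section \<open>The gap estimate\<close>

text \<open>Nonnegativity on differences bounds the set under \<open>INF\<close> from below, so that
  a single good \<open>v\<close> bounds the infimum.\<close>

lemma subspace_delta_le:
  assumes "0 \<le> K" "\<And>u v. u \<in> U \<Longrightarrow> v \<in> V \<Longrightarrow> 0 \<le> F (u - v)"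
    and "\<And>u. u \<in> U \<Longrightarrow> F u = 1 \<Longrightarrow> \<exists>v\<in>V. F (u - v) \<le> K"
  shows "subspace_delta F U V \<le> K"
  unfolding subspace_delta_def
proof (rule cSup_least)
  fix x assume "x \<in> insert 0 ((\<lambda>u. INF v\<in>V. F (u - v)) ` {u \<in> U. F u = 1})"
  then consider "x = 0" | u where "u \<in> U" "F u = 1" "x = (INF v\<in>V. F (u - v))" by auto
  then show "x \<le> K"
  proof cases
    case 2
    then obtain v where v: "v \<in> V" "F (u - v) \<le> K" using assms(3) by blast
    have "bdd_below ((\<lambda>v. F (u - v)) ` V)" using assms(2)[OF 2(1)] by (auto intro!: bdd_belowI)
    then show ?thesis unfolding 2(3) using v by (rule cINF_lower2)
  qed (use assms(1) in simp)
qed simp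

context hilbert_projection
begin

text \<open>Extracts a bound for single vectors from the supremum. The distance to the range is
  attained at \<open>P u\<close>, and comparison with 0 bounds the set by 1, so its
  \<open>Sup\<close> is a true supremum.\<close>

lemma subspace_delta_range:
  assumes V: "\<And>u t. u \<in> V \<Longrightarrow> t *\<^sub>R u \<in> V"
  shows "0 \<le> subspace_delta norm V (range P)"
    and "u \<in> V \<Longrightarrow> norm (u - P u) \<le> subspace_delta norm V (range P) * norm u"
proof -
  let ?X = "insert 0 ((\<lambda>u. INF v\<in>range P. norm (u - v)) ` {u \<in> V. norm u = 1})"
  have below: "bdd_below ((\<lambda>v. norm (u - v)) ` range P)" for u
    by (auto intro!: bdd_belowI[of _ 0])
  have bdd: "bdd_above ?X"
  proof (rule bdd_aboveI[of _ 1])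
    fix x assume "x \<in> ?X"
    then consider "x = 0" | u where "norm u = 1" "x = (INF v\<in>range P. norm (u - v))" by auto
    then show "x \<le> 1"
    proof cases
      case 2
      have "(INF v\<in>range P. norm (u - v)) \<le> norm (u - P 0)"
        by (rule cINF_lower[OF below]) (rule rangeI)
      with 2 show ?thesis by (simp add: bl.zero)
    qed simp
  qed
  show "0 \<le> subspace_delta norm V (range P)"
    unfolding subspace_delta_def by (rule cSup_upper[OF _ bdd]) simp
  assume u: "u \<in> V"
  show "norm (u - P u) \<le> subspace_delta norm V (range P) * norm u"
  proof (cases "u = 0")
    case False
    define e where "e = (1 / norm u) *\<^sub>R u"
    have e: "e \<in> V" "norm e = 1" using V[OF u] False by (auto simp: e_def)
    have "norm (e - P e) \<le> (INF v\<in>range P. norm (e - v))"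
      by (rule cINF_greatest) (auto intro: norm_diff_proj_le)
    also have "\<dots> \<le> subspace_delta norm V (range P)"
      unfolding subspace_delta_def by (rule cSup_upper[OF _ bdd]) (use e in auto)
    finally have "norm (e - P e) \<le> subspace_delta norm V (range P)" .
    moreover have "norm (e - P e) = norm (u - P u) / norm u"
      by (simp add: e_def scaleR flip: scaleR_diff_right)
    ultimately show ?thesis using False by (simp add: field_simps)
  qed (simp add: bl.zero)
qed

end

context spectral
begin

lemma form_norm_minus_commute:
  assumes "x \<in> D" "y \<in> D"
  shows "form_norm E m (x - y) = form_norm E m (y - x)"
proof -
  have "A (y - x) = - A (x - y)" using assms by (simp add: op_diff)
  moreover have "y - x = - (x - y)" by simp
  ultimately have "cinner (A (y - x)) (y - x) = cinner (A (x - y)) (x - y)"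
    by (metis cinner_minus_left cinner_minus_right minus_minus)
  then show ?thesis using assms by (simp add: form_norm_sq dom_diff norm_minus_commute)
qed

text \<open>The bounds \<open>p * e\<close> and \<open>q * e\<close> enter as a product, quadratic
  in \<open>e\<close>, so the square root is again linear in \<open>e\<close>.\<close>

lemma form_norm_le:
  assumes x: "x \<in> D" "norm x \<le> p * e" "norm (A x) \<le> q * e" and nn: "0 \<le> p" "0 \<le> q" "0 \<le> e"
  shows "form_norm E m x \<le> sqrt (q * p + \<bar>m - 1\<bar> * p\<^sup>2) * e"
proof -
  have "Re (cinner (A x) x) \<le> norm (A x) * norm x" using Re_cinner_le[of "A x" x] by linarith
  also have "\<dots> \<le> (q * e) * (p * e)" using nn by (intro mult_mono x) auto
  finally have 1: "Re (cinner (A x) x) \<le> (q * p) * e\<^sup>2" by (simp add: power2_eq_square mult_ac)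
  have "- ((m - 1) * (norm x)\<^sup>2) \<le> \<bar>m - 1\<bar> * (norm x)\<^sup>2"
    unfolding mult_minus_left[symmetric] by (intro mult_right_mono) auto
  also have "\<dots> \<le> \<bar>m - 1\<bar> * (p * e)\<^sup>2" using x(2) by (intro mult_left_mono power_mono) auto
  finally have "Re (cinner (A x) x) - (m - 1) * (norm x)\<^sup>2 \<le> (q * p + \<bar>m - 1\<bar> * p\<^sup>2) * e\<^sup>2"
    using 1 by (simp add: power_mult_distrib algebra_simps)
  then have "form_norm E m x \<le> sqrt ((q * p + \<bar>m - 1\<bar> * p\<^sup>2) * e\<^sup>2)"
    unfolding form_norm_sq[OF x(1)] by (rule real_sqrt_le_mono)
  then show ?thesis using nn(3) by (simp add: real_sqrt_mult)
qed

end

context gap_setting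
begin

definition K\<^sub>1 :: real where "K\<^sub>1 = r * (2 * N * K\<^sub>0)"
definition K\<^sub>2 :: real where "K\<^sub>2 = r * ((\<bar>l\<bar> + 3) * (2 * N * K\<^sub>0) + K\<^sub>0)"

lemma constants_nonneg: "0 \<le> K\<^sub>0" "0 \<le> K\<^sub>1" "0 \<le> K\<^sub>2"
  using r_pos M_pos N_pos by (auto simp: K\<^sub>0_def K\<^sub>1_def K\<^sub>2_def)

text \<open>Each vector is compared with its image under the other idempotent, so both directions
  reduce to one estimate of \<open>riesz u - E {l} u\<close>. The shift by \<open>m - 1\<close>
  ensures \<open>norm u \<le> 1\<close> for unit vectors of the form norm.\<close>

lemma gap_estimate:
  assumes m: "\<And>u. u \<in> D \<Longrightarrow> m * (norm u)\<^sup>2 \<le> Re (cinner (A u) u)"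
  shows "subspace_gap (form_norm E m) (range (E {l})) (range riesz)
    \<le> sqrt (K\<^sub>2 * K\<^sub>1 + \<bar>m - 1\<bar> * K\<^sub>1\<^sup>2) * \<epsilon>"
proof -
  define C where "C = sqrt (K\<^sub>2 * K\<^sub>1 + \<bar>m - 1\<bar> * K\<^sub>1\<^sup>2)"
  have C: "0 \<le> C" using constants_nonneg by (simp add: C_def)
  have rD: "riesz w \<in> D" for w
    using dom_add[OF riesz_estimate(1)[of w] eigen_dom[of l w]] by simp
  have nonneg: "0 \<le> form_norm E m u" if "u \<in> D" for u
  proof -
    have "(m - 1) * (norm u)\<^sup>2 \<le> m * (norm u)\<^sup>2" by (intro mult_right_mono) auto
    then show ?thesis using m[OF that] by (simp add: form_norm_sq that)
  qed
  have unit: "norm u \<le> 1" if "u \<in> D" "form_norm E m u = 1" for u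
  proof -
    have "(norm u)\<^sup>2 \<le> 1"
      using m[OF that(1)] that(2) unfolding form_norm_sq[OF that(1)] by (simp add: algebra_simps)
    then show ?thesis by (simp add: power_le_one_iff abs_square_le_1)
  qed
  have est: "form_norm E m (riesz u - E {l} u) \<le> C * \<epsilon>" if "u \<in> D" "form_norm E m u = 1" for u
  proof -
    have "form_norm E m (riesz u - E {l} u) \<le> C * (\<epsilon> * norm u)"
      unfolding C_def using riesz_estimate[of u] constants_nonneg \<epsilon>_nonneg
      by (intro form_norm_le) (auto simp: K\<^sub>1_def K\<^sub>2_def)
    also have "\<dots> \<le> C * (\<epsilon> * 1)" by (intro mult_left_mono unit that C \<epsilon>_nonneg)
    finally show ?thesis by simp
  qed
  have "subspace_delta (form_norm E m) (range (E {l})) (range riesz) \<le> C * \<epsilon>"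
  proof (rule subspace_delta_le)
    fix u assume u: "u \<in> range (E {l})" "form_norm E m u = 1"
    then have "u \<in> D" "E {l} u = u" using eigen_dom by (auto simp: idem)
    with est[OF _ u(2)] have "form_norm E m (u - riesz u) \<le> C * \<epsilon>"
      using form_norm_minus_commute[OF _ rD, of u] by simp
    then show "\<exists>v\<in>range riesz. form_norm E m (u - v) \<le> C * \<epsilon>" by blast
  qed (auto intro!: nonneg dom_diff rD eigen_dom mult_nonneg_nonneg C \<epsilon>_nonneg)
  moreover have "subspace_delta (form_norm E m) (range riesz) (range (E {l})) \<le> C * \<epsilon>"
  proof (rule subspace_delta_le)
    fix u assume u: "u \<in> range riesz" "form_norm E m u = 1"
    then have "u \<in> D" "riesz u = u" using rD by (auto simp: riesz_idem)
    with est[OF _ u(2)] show "\<exists>v\<in>range (E {l}). form_norm E m (u - v) \<le> C * \<epsilon>" by auto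
  qed (auto intro!: nonneg dom_diff rD eigen_dom mult_nonneg_nonneg C \<epsilon>_nonneg)
  ultimately show ?thesis by (simp add: subspace_gap_def C_def)
qed

end

text \<open>Gram--Schmidt, phrased through the reproducing identity so that no orthogonality is needed later.\<close>

lemma finite_span_reproducing:
  fixes B :: "'a::complex_hilbert_space set"
  assumes "finite B"
  obtains F where "finite F" "F \<subseteq> cspan B" "\<And>e. e \<in> F \<Longrightarrow> norm e = 1"
    "\<And>u. u \<in> cspan B \<Longrightarrow> (\<Sum>e\<in>F. cinner u e *\<^sub>C e) = u"
proof -
  have "\<exists>F. finite F \<and> F \<subseteq> cspan B \<and> (\<forall>e\<in>F. norm e = 1) \<and>
    (\<forall>u\<in>cspan B. (\<Sum>e\<in>F. cinner u e *\<^sub>C e) = u)"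
    using assms
  proof (induction B rule: finite_induct)
    case empty
    show ?case by (intro exI[of _ "{}"]) simp
  next
    case (insert b B)
    then obtain F where F: "finite F" "F \<subseteq> cspan B" "\<And>e. e \<in> F \<Longrightarrow> norm e = 1"
      "\<And>u. u \<in> cspan B \<Longrightarrow> (\<Sum>e\<in>F. cinner u e *\<^sub>C e) = u" by blast
    define L where "L u = (\<Sum>e\<in>F. cinner u e *\<^sub>C e)" for u
    have L_add: "L (u + v) = L u + L v" for u v
      by (simp add: L_def cinner_add_left scaleC_add_left sum.distrib)
    have L_sc: "L (k *\<^sub>C u) = k *\<^sub>C L u" for k u
      by (simp add: L_def cinner_scaleC_left scaleC_scaleC complex_vector.scale_sum_right)
    have L_mem: "L u \<in> cspan B" for u
      unfolding L_def using F(2) by (intro complex_vector.span_sum complex_vector.span_scale) auto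
    have L_sym: "cinner (L u) v = cinner u (L v)" for u v
      unfolding L_def cinner_sum_left cinner_sum_right cinner_scaleC_left cinner_scaleC_right
    proof (rule sum.cong[OF refl])
      show "cinner u e * cinner e v = cnj (cinner v e) * cinner u e" for e
        by (subst (2) cinner_commute) (rule mult.commute)
    qed
    \<comment> \<open>The part of \<open>b\<close> orthogonal to the old span; if it vanishes, the
      old family still reproduces.\<close>
    define d where "d = b - L b"
    have d_orth: "cinner w d = 0" if "w \<in> cspan B" for w
      using F(4)[OF that] L_sym[of w b] by (simp add: d_def cinner_diff_right L_def)
    have sub: "cspan B \<subseteq> cspan (insert b B)" by (rule complex_vector.span_mono) auto
    have decomp: "\<exists>k w. w \<in> cspan B \<and> u = k *\<^sub>C b + w" if u: "u \<in> cspan (insert b B)" for u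
    proof -
      obtain k where "u - k *\<^sub>C b \<in> cspan B"
        using u unfolding complex_vector.span_insert by blast
      then show ?thesis by (intro exI[of _ k] exI[of _ "u - k *\<^sub>C b"]) simp
    qed
    show ?case
    proof (cases "d = 0")
      case True
      then have "L b = b" by (simp add: d_def)
      have "L u = u" if u: "u \<in> cspan (insert b B)" for u
      proof -
        obtain k w where "w \<in> cspan B" "u = k *\<^sub>C b + w" using decomp[OF u] by blast
        then show ?thesis using F(4) \<open>L b = b\<close> by (simp add: L_add L_sc) (simp add: L_def)
      qed
      then show ?thesis using F sub by (intro exI[of _ F]) (auto simp: L_def)
    next
      case False
      define e where "e = complex_of_real (1 / norm d) *\<^sub>C d"
      have e1: "norm e = 1" using False by (simp add: e_def norm_scaleC norm_divide)
      have e_orth: "cinner w e = 0" if "w \<in> cspan B" for w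
        using d_orth[OF that] by (simp add: e_def cinner_scaleC_right)
      have eF: "e \<notin> F"
      proof
        assume "e \<in> F"
        then have "cinner e e = 0" using F(2) e_orth by auto
        then show False using e1 by (simp add: cinner_self)
      qed
      have e_mem: "e \<in> cspan (insert b B)"
        unfolding e_def d_def using L_mem[of b] sub
        by (intro complex_vector.span_scale complex_vector.span_diff) (auto intro: complex_vector.span_base)
      have "cinner b d = cinner d d"
        using d_orth[OF L_mem[of b]] by (simp add: d_def cinner_diff_left)
      then have bd: "cinner b e *\<^sub>C e = d"
        using False by (simp add: e_def cinner_scaleC_right scaleC_scaleC cinner_self power2_eq_square)
      have "cinner u e *\<^sub>C e + L u = u" if u: "u \<in> cspan (insert b B)" for u
      proof -
        obtain k w where w: "w \<in> cspan B" "u = k *\<^sub>C b + w" using decomp[OF u] by blast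
        have "cinner u e *\<^sub>C e = k *\<^sub>C (cinner b e *\<^sub>C e)"
          by (simp add: w cinner_add_left cinner_scaleC_left e_orth scaleC_scaleC)
        moreover have "L u = k *\<^sub>C L b + w" using F(4)[OF w(1)] by (simp add: w L_add L_sc) (simp add: L_def)
        ultimately have "cinner u e *\<^sub>C e + L u = k *\<^sub>C (d + L b) + w"
          by (simp add: bd scaleC_add_right)
        then show ?thesis by (simp add: d_def w(2))
      qed
      then show ?thesis
        using F(1-3) eF e1 e_mem sub by (intro exI[of _ "insert e F"]) (auto simp: L_def)
    qed
  qed
  then show ?thesis using that by blast
qed

text \<open>Strong convergence is uniform on a finite-dimensional space: expanding in the families
  \<open>F t\<close> bounds the defect by \<open>\<theta> n\<close>, a finite sum of null sequences.
  This is where finite multiplicity enters.\<close>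

lemma (in spectral) eventually_defect:
  assumes "finite \<Lambda>" "\<And>x. E {a..b} x = (\<Sum>t\<in>\<Lambda>. E {t} x)"
    and fin: "\<And>t. t \<in> \<Lambda> \<Longrightarrow> \<exists>B. finite B \<and> eigenspace D A (complex_of_real t) \<subseteq> cspan B"
    and P: "\<And>n. orthogonal_projection (P n)" "\<And>x. (\<lambda>n. P n x) \<longlonglongrightarrow> x"
    and "\<eta> > 0"
  shows "\<forall>\<^sub>F n in sequentially. \<forall>u. E {a..b} u = u \<longrightarrow> norm (u - P n u) \<le> \<eta> * norm u"
proof -
  have "\<exists>F. finite F \<and> (\<forall>u. (\<Sum>e\<in>F. cinner (E {t} u) e *\<^sub>C e) = E {t} u) \<and> (\<forall>e\<in>F. norm e = 1)"
    if t: "t \<in> \<Lambda>" for t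
  proof -
    obtain B where B: "finite B" "eigenspace D A (complex_of_real t) \<subseteq> cspan B"
      using fin[OF t] by blast
    obtain F where F: "finite F" "\<And>e. e \<in> F \<Longrightarrow> norm e = 1"
      "\<And>u. u \<in> cspan B \<Longrightarrow> (\<Sum>e\<in>F. cinner u e *\<^sub>C e) = u"
      using finite_span_reproducing[OF B(1)] by metis
    have "E {t} u \<in> cspan B" for u
      using B(2) by (auto simp: eigenspace_def eigen_dom eigen_op scaleC_of_real)
    then show ?thesis using F by blast
  qed
  then obtain F where F: "\<And>t. t \<in> \<Lambda> \<Longrightarrow> finite (F t)"
    "\<And>t u. t \<in> \<Lambda> \<Longrightarrow> (\<Sum>e\<in>F t. cinner (E {t} u) e *\<^sub>C e) = E {t} u"
    "\<And>t e. t \<in> \<Lambda> \<Longrightarrow> e \<in> F t \<Longrightarrow> norm e = 1" by metis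
  define \<theta> where "\<theta> n = (\<Sum>t\<in>\<Lambda>. \<Sum>e\<in>F t. norm (e - P n e))" for n
  have "\<theta> \<longlonglongrightarrow> (\<Sum>t\<in>\<Lambda>. \<Sum>e\<in>F t. norm (e - e))"
    unfolding \<theta>_def by (intro tendsto_intros P(2))
  then have "\<theta> \<longlonglongrightarrow> 0" by simp
  from order_tendstoD(2)[OF this \<open>\<eta> > 0\<close>] show ?thesis
  proof (rule eventually_mono, intro allI impI)
    fix n u assume \<theta>: "\<theta> n < \<eta>" and u: "E {a..b} u = u"
    interpret Pn: hilbert_projection "P n" by unfold_locales (rule P(1))
    have "norm (E {t} u - P n (E {t} u)) \<le> (\<Sum>e\<in>F t. norm (e - P n e)) * norm u" if t: "t \<in> \<Lambda>" for t
    proof -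
      have "E {t} u - P n (E {t} u) = (\<Sum>e\<in>F t. cinner (E {t} u) e *\<^sub>C e) - P n (\<Sum>e\<in>F t. cinner (E {t} u) e *\<^sub>C e)"
        by (simp only: F(2)[OF t])
      also have "\<dots> = (\<Sum>e\<in>F t. cinner (E {t} u) e *\<^sub>C (e - P n e))"
        by (simp add: Pn.bl.sum Pn.scaleC complex_vector.scale_right_diff_distrib sum_subtractf)
      also have "norm \<dots> \<le> (\<Sum>e\<in>F t. norm (e - P n e) * norm u)"
      proof (rule sum_norm_le)
        fix e assume e: "e \<in> F t"
        have "norm (cinner (E {t} u) e) \<le> norm (E {t} u) * norm e" by (rule cinner_Cauchy_Schwarz)
        also have "\<dots> \<le> norm u" using F(3)[OF t e] norm_le[of "{t}" u] by simp
        finally show "norm (cinner (E {t} u) e *\<^sub>C (e - P n e)) \<le> norm (e - P n e) * norm u"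
          unfolding norm_scaleC mult.commute[of "norm (e - P n e)"] by (intro mult_right_mono) auto
      qed
      finally show ?thesis by (simp add: sum_distrib_right)
    qed
    then have "(\<Sum>t\<in>\<Lambda>. norm (E {t} u - P n (E {t} u))) \<le> (\<Sum>t\<in>\<Lambda>. (\<Sum>e\<in>F t. norm (e - P n e)) * norm u)"
      by (rule sum_mono)
    moreover have "u - P n u = (\<Sum>t\<in>\<Lambda>. E {t} u) - P n (\<Sum>t\<in>\<Lambda>. E {t} u)"
      using u assms(2)[of u] by simp
    then have "u - P n u = (\<Sum>t\<in>\<Lambda>. E {t} u - P n (E {t} u))"
      by (simp add: Pn.bl.sum sum_subtractf)
    then have "norm (u - P n u) \<le> (\<Sum>t\<in>\<Lambda>. norm (E {t} u - P n (E {t} u)))"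
      by (simp add: norm_sum)
    ultimately have "norm (u - P n u) \<le> \<theta> n * norm u" by (simp add: \<theta>_def sum_distrib_right)
    also have "\<dots> \<le> \<eta> * norm u" using \<theta> by (intro mult_right_mono) auto
    finally show "norm (u - P n u) \<le> \<eta> * norm u" .
  qed
qed

theorem theorem4p5:
  fixes D :: "'a::complex_hilbert_space set"
    and A :: "'a \<Rightarrow> 'a"
    and E :: "real set \<Rightarrow> 'a \<Rightarrow> 'a"
    and a b l r :: real
    and \<Lambda> :: "real set"
    and P :: "nat \<Rightarrow> 'a \<Rightarrow> 'a"
  assumes "self_adjoint D A"
    and "semibounded_below D A"
    and "spectral_measure_of E D A"
    and "a < b"
    and "complex_of_real a \<in> resolvent_set D A"
    and "complex_of_real b \<in> resolvent_set D A"
    and "finite \<Lambda>"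
    and "spectrum D A \<inter> complex_of_real ` {a..b} = complex_of_real ` \<Lambda>"
    and "complex_of_real ` \<Lambda> \<subseteq> discrete_spectrum D A"
    and "l \<in> \<Lambda>"
    and "0 < r" and "r < 1/2"
    and "cball (complex_of_real l + \<i>) (2 * r) \<inter> (\<lambda>z. z + \<i>) ` spectrum D A
           = {complex_of_real l + \<i>}"
    and "cball (complex_of_real l + \<i>) (2 * r) \<inter> Gamma_curve a b = {}"
    and "\<And>n. orthogonal_projection (P n)"
    and "\<And>x. (\<lambda>n. P n x) \<longlonglongrightarrow> x"
  shows "\<exists>c\<^sub>0>0. \<forall>\<^sub>F n in sequentially.
           subspace_gap (form_norm E (spectrum_min D A))
             (range (E {l}))
             (range (riesz_projection D (\<lambda>x. A x + \<i> *\<^sub>C P n x) (complex_of_real l + \<i>) r))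
           \<le> c\<^sub>0 * subspace_delta norm (range (E {a..b})) (range (P n))"
proof -
  interpret spectral D A E
    using assms(1,3) by unfold_locales (auto simp: spectral_measure_of_def)
  define c where "c = complex_of_real l + \<i>"
  have \<Lambda>: "\<Lambda> \<subseteq> {a..b}" "\<And>t. t \<in> \<Lambda> \<Longrightarrow> complex_of_real t \<in> spectrum D A"
    using assms(8) by (blast dest: of_real_eq_iff[THEN iffD1])+
  \<comment> \<open>Endpoints in the resolvent set put \<open>l\<close> strictly inside, which gives
    the conic expression its strict sign at the centre of the disc.\<close>
  have "a \<notin> \<Lambda>" "b \<notin> \<Lambda>"
    using assms(5,6) \<Lambda>(2) by (auto simp: spectrum_def)
  then have l: "a < l" "l < b"
    using assms(10) \<Lambda>(1) by (force simp: less_le)+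
  have ps: "E {a..b} x = (\<Sum>t\<in>\<Lambda>. E {t} x)" for x
    using assms(7,8) \<Lambda>(1) by (intro proj_Icc_eq_sum) auto
  have sep: "2 * r < \<bar>t - l\<bar>" if t: "t \<in> \<Lambda>" "t \<noteq> l" for t
  proof (rule ccontr)
    assume "\<not> 2 * r < \<bar>t - l\<bar>"
    moreover have "dist c (complex_of_real t + \<i>) = norm (complex_of_real (l - t))"
      by (simp add: c_def dist_norm)
    then have "dist c (complex_of_real t + \<i>) = \<bar>t - l\<bar>"
      by (simp only: norm_of_real abs_minus_commute)
    ultimately have "complex_of_real t + \<i> \<in> cball c (2 * r) \<inter> (\<lambda>z. z + \<i>) ` spectrum D A"
      using \<Lambda>(2)[OF t(1)] by auto
    then have "complex_of_real t + \<i> = complex_of_real l + \<i>"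
      using assms(13) unfolding c_def by blast
    then show False using t(2) by simp
  qed
  obtain \<kappa> where \<kappa>: "\<kappa> > 0"
    "\<And>P s z u. orthogonal_projection P \<Longrightarrow> s \<in> {1, -1} \<Longrightarrow> z \<in> cball (complex_of_real l + \<i>) (2 * r) \<Longrightarrow>
      u \<in> D \<Longrightarrow> E {a..b} u = 0 \<Longrightarrow>
      \<kappa> * norm u \<le> norm (A u + (complex_of_real s * \<i>) *\<^sub>C (P u - E {a..b} (P u))
         - Complex (Re z) (s * Im z) *\<^sub>C u)"
    using compressed_lower_bound[OF assms(4) l assms(11,12,14)] by blast
  define m where "m = spectrum_min D A"
  have m: "m * (norm u)\<^sup>2 \<le> Re (cinner (A u) u)" if "u \<in> D" for u
    unfolding m_def by (rule form_lower_bound[OF assms(2) \<Lambda>(2)[OF assms(10)] that])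
  define \<epsilon> where "\<epsilon> n = subspace_delta norm (range (E {a..b})) (range (P n))" for n
  define N where "N = 2 * card \<Lambda> / r + 1 / \<kappa>"
  have N: "N > 0" unfolding N_def using assms(11) \<kappa>(1) by (intro add_nonneg_pos) auto
  \<comment> \<open>Taken from the locale with explicit parameters before \<open>n\<close> is fixed,
    so that \<open>C\<close> is the same for all \<open>n\<close>.\<close>
  define K\<^sub>1 where "K\<^sub>1 = gap_setting.K\<^sub>1 r \<kappa> \<Lambda>"
  define K\<^sub>2 where "K\<^sub>2 = gap_setting.K\<^sub>2 l r \<kappa> \<Lambda>"
  define C where "C = sqrt (K\<^sub>2 * K\<^sub>1 + \<bar>m - 1\<bar> * K\<^sub>1\<^sup>2)"
  have "\<forall>\<^sub>F n in sequentially. \<forall>u. E {a..b} u = u \<longrightarrow> norm (u - P n u) \<le> 1 / (2 * N) * norm u"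
  proof (rule eventually_defect[OF assms(7) ps _ assms(15,16)])
    show "\<exists>B. finite B \<and> eigenspace D A (complex_of_real t) \<subseteq> cspan B" if "t \<in> \<Lambda>" for t
      using assms(9) that by (auto simp: discrete_spectrum_def)
  qed (use N in auto)
  then have "\<forall>\<^sub>F n in sequentially.
      subspace_gap (form_norm E m) (range (E {l})) (range (riesz_projection D (\<lambda>x. A x + \<i> *\<^sub>C P n x) c r))
      \<le> (\<bar>C\<bar> + 1) * \<epsilon> n"
  proof (rule eventually_mono)
    fix n assume small: "\<forall>u. E {a..b} u = u \<longrightarrow> norm (u - P n u) \<le> 1 / (2 * N) * norm u"
    interpret Pi: hilbert_projection "E {a..b}" by (rule proj) simp
    interpret Pn: hilbert_projection "P n" by unfold_locales (rule assms(15))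
    have V: "t *\<^sub>R u \<in> range (E {a..b})" if "u \<in> range (E {a..b})" for u t
      using that by (auto simp flip: Pi.scaleR)
    have \<epsilon>0: "0 \<le> \<epsilon> n" and \<epsilon>: "norm (u - P n u) \<le> \<epsilon> n * norm u" if "E {a..b} u = u" for u
      using Pn.subspace_delta_range[OF V] that unfolding \<epsilon>_def Pi.in_range_iff by auto
    \<comment> \<open>The uniform bound on single vectors passes to the supremum; this is the
      smallness \<open>\<epsilon>_small\<close> of the locale.\<close>
    have "\<epsilon> n \<le> 1 / (2 * N)"
      unfolding \<epsilon>_def
    proof (rule subspace_delta_le)
      fix u assume "u \<in> range (E {a..b})" "norm u = 1"
      then have "norm (u - P n u) \<le> 1 / (2 * N)"
        using small by (metis Pi.in_range_iff mult.right_neutral)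
      then show "\<exists>v\<in>range (P n). norm (u - v) \<le> 1 / (2 * N)" by blast
    qed (use N in auto)
    then have \<epsilon>N: "\<epsilon> n * N \<le> 1 / 2" using N by (simp add: field_simps)
    interpret G: gap_setting D A E "P n" a b l r \<kappa> "\<epsilon> n" \<Lambda>
    proof
      show "0 \<le> \<epsilon> n" by (rule \<epsilon>0[of 0]) simp
    qed (use assms \<Lambda> ps sep \<kappa> \<epsilon> \<epsilon>N in \<open>auto simp: N_def\<close>)
    have "subspace_gap (form_norm E m) (range (E {l})) (range (riesz_projection D (\<lambda>x. A x + \<i> *\<^sub>C P n x) c r))
        \<le> C * \<epsilon> n"
      using G.gap_estimate[OF m] by (simp add: C_def K\<^sub>1_def K\<^sub>2_def c_def)
    \<comment> \<open>The added 1 makes the final constant positive without inspecting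
      \<open>C\<close>.\<close>
    also have "\<dots> \<le> (\<bar>C\<bar> + 1) * \<epsilon> n" by (intro mult_right_mono \<epsilon>0[of 0]) auto
    finally show "subspace_gap (form_norm E m) (range (E {l}))
        (range (riesz_projection D (\<lambda>x. A x + \<i> *\<^sub>C P n x) c r)) \<le> (\<bar>C\<bar> + 1) * \<epsilon> n" .
  qed
  then show ?thesis
    unfolding \<epsilon>_def m_def c_def by (intro exI[of _ "\<bar>C\<bar> + 1"]) auto
qed

end
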